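(* Let $u\colon R\to U$ be a flat epimorphism of commutative rings, and let $\mathbb{G}$ be the set of all ideals $I\subset R$ such that $R/I\otimes_R U=0$. Assume that for every $I\in\mathbb{G}$ the quotient ring $R/I$ is semilocal of Krull dimension zero. Then the projective dimension of the $R$-module $U$ does not exceed $1$.
   Context: A flat epimorphism of commutative rings is a homomorphism $u\colon R\to U$ of commutative rings such that $U$ is a flat $R$-module and the multiplication map $U\otimes_R U\to U$ is an isomorphism (equivalently, the two induced maps $U\rightrightarrows U\otimes_R U$ are isomorphisms). A commutative ring $T$ is semilocal if it has only finitely many maximal ideals; it has Krull dimension zero if all its prime ideals are maximal (the zero ring satisfies both conditions vacuously). *)

theory Defs
  imports "HOL-Algebra.Free_Abelian_Groups"
    "HOL-Library.Extended_Nat" "HOL-Algebra.QuotRing" "HOL-Algebra.Module"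
begin

section \<open>Modules and their homomorphisms\<close>

definition mod_hom ::
  "('a, 'k) ring_scheme \<Rightarrow> ('a, 'm, 'c) module_scheme \<Rightarrow> ('a, 'n, 'd) module_scheme \<Rightarrow> ('m \<Rightarrow> 'n) set"
where
  "mod_hom R M N =
     {f \<in> carrier M \<rightarrow> carrier N.
        (\<forall>x\<in>carrier M. \<forall>y\<in>carrier M. f (x \<oplus>\<^bsub>M\<^esub> y) = f x \<oplus>\<^bsub>N\<^esub> f y) \<and>
        (\<forall>a\<in>carrier R. \<forall>x\<in>carrier M. f (a \<odot>\<^bsub>M\<^esub> x) = a \<odot>\<^bsub>N\<^esub> f x)}"

definition restrict_scalars :: "('b, 'l) ring_scheme \<Rightarrow> ('a \<Rightarrow> 'b) \<Rightarrow> ('a, 'b) module" where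
  "restrict_scalars S h =
     \<lparr>carrier = carrier S, monoid.mult = monoid.mult S, one = one S,
      ring.zero = ring.zero S, add = add S, module.smult = (\<lambda>a x. h a \<otimes>\<^bsub>S\<^esub> x)\<rparr>"

lemma restrict_scalars_simps [simp]:
  "carrier (restrict_scalars S h) = carrier S"
  "ring.zero (restrict_scalars S h) = ring.zero S"
  "add (restrict_scalars S h) = add S"
  "module.smult (restrict_scalars S h) = (\<lambda>a x. h a \<otimes>\<^bsub>S\<^esub> x)"
  by (simp_all add: restrict_scalars_def)

lemma module_restrict_scalars:
  assumes "cring R" "cring S" "h \<in> ring_hom R S"
  shows "module R (restrict_scalars S h)"
proof -
  interpret S: cring S by fact
  note h = ring_hom_closed[OF assms(3)] ring_hom_add[OF assms(3)]
    ring_hom_mult[OF assms(3)] ring_hom_one[OF assms(3)]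
  have "\<exists>y\<in>carrier S. y \<oplus>\<^bsub>S\<^esub> x = \<zero>\<^bsub>S\<^esub>" if "x \<in> carrier S" for x
    using S.l_neg[OF that] S.a_inv_closed[OF that] by blast
  then have "abelian_group (restrict_scalars S h)"
    by (intro abelian_groupI) (auto simp: S.a_ac)
  then show ?thesis
    by (intro moduleI assms(1)) (auto simp: h S.l_distr S.r_distr S.m_assoc)
qed


section \<open>Tensor products\<close>

text \<open>
  The tensor product is taken as an abelian group (written multiplicatively, like every
  \<^const>\<open>FactGroup\<close>), since only vanishing, injectivity and bijectivity are asked of it.
\<close>

definition tensor_relators ::
  "('a, 'k) ring_scheme \<Rightarrow> ('a, 'm, 'c) module_scheme \<Rightarrow> ('a, 'n, 'd) module_scheme
     \<Rightarrow> ('m \<times> 'n \<Rightarrow>\<^sub>0 int) set"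
where
  "tensor_relators R M N =
     {frag_of (x \<oplus>\<^bsub>M\<^esub> x', y) - (frag_of (x, y) + frag_of (x', y)) | x x' y.
        x \<in> carrier M \<and> x' \<in> carrier M \<and> y \<in> carrier N} \<union>
     {frag_of (x, y \<oplus>\<^bsub>N\<^esub> y') - (frag_of (x, y) + frag_of (x, y')) | x y y'.
        x \<in> carrier M \<and> y \<in> carrier N \<and> y' \<in> carrier N} \<union>
     {frag_of (a \<odot>\<^bsub>M\<^esub> x, y) - frag_of (x, a \<odot>\<^bsub>N\<^esub> y) | a x y.
        a \<in> carrier R \<and> x \<in> carrier M \<and> y \<in> carrier N}"

definition tensor_kernel ::
  "('a, 'k) ring_scheme \<Rightarrow> ('a, 'm, 'c) module_scheme \<Rightarrow> ('a, 'n, 'd) module_scheme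
     \<Rightarrow> ('m \<times> 'n \<Rightarrow>\<^sub>0 int) set"
where
  "tensor_kernel R M N =
     generate (free_Abelian_group (carrier M \<times> carrier N)) (tensor_relators R M N)"

definition tensor ::
  "('a, 'k) ring_scheme \<Rightarrow> ('a, 'm, 'c) module_scheme \<Rightarrow> ('a, 'n, 'd) module_scheme
     \<Rightarrow> ('m \<times> 'n \<Rightarrow>\<^sub>0 int) set monoid"
where
  "tensor R M N = free_Abelian_group (carrier M \<times> carrier N) Mod tensor_kernel R M N"

definition pure_tensor ::
  "('a, 'k) ring_scheme \<Rightarrow> ('a, 'm, 'c) module_scheme \<Rightarrow> ('a, 'n, 'd) module_scheme
     \<Rightarrow> 'm \<Rightarrow> 'n \<Rightarrow> ('m \<times> 'n \<Rightarrow>\<^sub>0 int) set"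
where
  "pure_tensor R M N x y =
     tensor_kernel R M N #>\<^bsub>free_Abelian_group (carrier M \<times> carrier N)\<^esub> frag_of (x, y)"

definition balanced ::
  "('a, 'k) ring_scheme \<Rightarrow> ('a, 'm, 'c) module_scheme \<Rightarrow> ('a, 'n, 'd) module_scheme
     \<Rightarrow> ('g, 'e) monoid_scheme \<Rightarrow> ('m \<Rightarrow> 'n \<Rightarrow> 'g) \<Rightarrow> bool"
where
  "balanced R M N G \<beta> \<longleftrightarrow>
     (\<forall>x\<in>carrier M. \<forall>y\<in>carrier N. \<beta> x y \<in> carrier G) \<and>
     (\<forall>x\<in>carrier M. \<forall>x'\<in>carrier M. \<forall>y\<in>carrier N. \<beta> (x \<oplus>\<^bsub>M\<^esub> x') y = \<beta> x y \<otimes>\<^bsub>G\<^esub> \<beta> x' y) \<and>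
     (\<forall>x\<in>carrier M. \<forall>y\<in>carrier N. \<forall>y'\<in>carrier N. \<beta> x (y \<oplus>\<^bsub>N\<^esub> y') = \<beta> x y \<otimes>\<^bsub>G\<^esub> \<beta> x y') \<and>
     (\<forall>a\<in>carrier R. \<forall>x\<in>carrier M. \<forall>y\<in>carrier N. \<beta> (a \<odot>\<^bsub>M\<^esub> x) y = \<beta> x (a \<odot>\<^bsub>N\<^esub> y))"

text \<open>
  The homomorphism out of the tensor product induced by a balanced map \<open>\<beta>\<close>: the linear
  extension of \<open>\<beta>\<close> to the free abelian group is constant on each coset.
\<close>

definition tensor_lift ::
  "('a, 'm, 'c) module_scheme \<Rightarrow> ('a, 'n, 'd) module_scheme \<Rightarrow> ('g, 'e) monoid_scheme
     \<Rightarrow> ('m \<Rightarrow> 'n \<Rightarrow> 'g) \<Rightarrow> ('m \<times> 'n \<Rightarrow>\<^sub>0 int) set \<Rightarrow> 'g"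
where
  "tensor_lift M N G \<beta> X =
     the_elem ((\<lambda>c. gfinprod G (\<lambda>p. case_prod \<beta> p [^]\<^bsub>G\<^esub> Poly_Mapping.lookup c p)
                      (carrier M \<times> carrier N)) ` X)"

definition tensor_map ::
  "('a, 'k) ring_scheme \<Rightarrow> ('a, 'm, 'c) module_scheme \<Rightarrow> ('a, 'n, 'd) module_scheme
     \<Rightarrow> ('a, 'm1, 'c1) module_scheme \<Rightarrow> ('a, 'n1, 'd1) module_scheme
     \<Rightarrow> ('m \<Rightarrow> 'm1) \<Rightarrow> ('n \<Rightarrow> 'n1)
     \<Rightarrow> ('m \<times> 'n \<Rightarrow>\<^sub>0 int) set \<Rightarrow> ('m1 \<times> 'n1 \<Rightarrow>\<^sub>0 int) set"
where
  "tensor_map R M N M' N' f g =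
     tensor_lift M N (tensor R M' N') (\<lambda>x y. pure_tensor R M' N' (f x) (g y))"


subsection \<open>The universal property\<close>

lemma tensor_relators_subset:
  assumes "module R M" "module R N"
  shows "tensor_relators R M N \<subseteq> carrier (free_Abelian_group (carrier M \<times> carrier N))"
proof -
  interpret M: module R M by fact
  interpret N: module R N by fact
  have d: "Poly_Mapping.keys (a - b) \<subseteq> S" if "Poly_Mapping.keys a \<subseteq> S" "Poly_Mapping.keys b \<subseteq> S"
    for a b :: "'x \<Rightarrow>\<^sub>0 int" and S
    using that keys_diff[of a b] by blast
  have p: "Poly_Mapping.keys (a + b) \<subseteq> S" if "Poly_Mapping.keys a \<subseteq> S" "Poly_Mapping.keys b \<subseteq> S"
    for a b :: "'x \<Rightarrow>\<^sub>0 int" and S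
    using that keys_add[of a b] by blast
  show ?thesis
  proof
    fix r assume "r \<in> tensor_relators R M N"
    then have "Poly_Mapping.keys r \<subseteq> carrier M \<times> carrier N"
      unfolding tensor_relators_def
      by (elim UnE CollectE exE conjE; hypsubst; intro d p; simp)
    then show "r \<in> carrier (free_Abelian_group (carrier M \<times> carrier N))" by simp
  qed
qed

lemma tensor_kernel_normal:
  assumes "module R M" "module R N"
  shows "tensor_kernel R M N \<lhd> free_Abelian_group (carrier M \<times> carrier N)"
proof -
  interpret F: comm_group "free_Abelian_group (carrier M \<times> carrier N)"
    by (rule abelian_free_Abelian_group)
  show ?thesis
    unfolding tensor_kernel_def
    by (intro F.subgroup_imp_normal F.generate_is_subgroup tensor_relators_subset assms)
qed

lemma comm_group_tensor:
  assumes "module R M" "module R N"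
  shows "comm_group (tensor R M N)"
  unfolding tensor_def
  using comm_group.abelian_FactGroup[OF abelian_free_Abelian_group
      normal_imp_subgroup[OF tensor_kernel_normal[OF assms]]] .

lemma pure_tensor_closed:
  assumes "module R M" "module R N" "x \<in> carrier M" "y \<in> carrier N"
  shows "pure_tensor R M N x y \<in> carrier (tensor R M N)"
  unfolding pure_tensor_def tensor_def FactGroup_def RCOSETS_def
  using assms by auto

lemma tensor_quotient_hom:
  assumes "module R M" "module R N"
  shows "(\<lambda>c. tensor_kernel R M N #>\<^bsub>free_Abelian_group (carrier M \<times> carrier N)\<^esub> c)
           \<in> hom (free_Abelian_group (carrier M \<times> carrier N)) (tensor R M N)"
  unfolding tensor_def by (rule normal.r_coset_hom_Mod[OF tensor_kernel_normal[OF assms]])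

lemma balanced_pure_tensor:
  assumes "module R M" "module R N"
  shows "balanced R M N (tensor R M N) (pure_tensor R M N)"
proof -
  interpret M: module R M by fact
  interpret N: module R N by fact
  let ?F = "free_Abelian_group (carrier M \<times> carrier N)"
  let ?K = "tensor_kernel R M N"
  interpret K: normal ?K ?F by (rule tensor_kernel_normal[OF assms])
  have eq: "?K #>\<^bsub>?F\<^esub> a = ?K #>\<^bsub>?F\<^esub> b"
    if "a - b \<in> tensor_relators R M N" "a \<in> carrier ?F" "b \<in> carrier ?F" for a b
  proof -
    have "a - b \<in> ?K"
      using that(1) unfolding tensor_kernel_def by (rule generate.incl)
    then have "a \<in> ?K #>\<^bsub>?F\<^esub> b"
      unfolding r_coset_def by (force intro: bexI[of _ "a - b"])
    then show ?thesis
      using K.repr_independence[OF _ that(3) K.subgroup_axioms] by metis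
  qed
  have mult: "(?K #>\<^bsub>?F\<^esub> a) \<otimes>\<^bsub>tensor R M N\<^esub> (?K #>\<^bsub>?F\<^esub> b) = ?K #>\<^bsub>?F\<^esub> (a + b)"
    if "a \<in> carrier ?F" "b \<in> carrier ?F" for a b
    using K.rcos_sum[OF that] by (simp add: tensor_def FactGroup_def)
  have p: "Poly_Mapping.keys (a + b) \<subseteq> S" if "Poly_Mapping.keys a \<subseteq> S" "Poly_Mapping.keys b \<subseteq> S"
    for a b :: "'x \<Rightarrow>\<^sub>0 int" and S
    using that keys_add[of a b] by blast
  show ?thesis
    unfolding balanced_def
  proof (intro conjI ballI)
    fix x y assume "x \<in> carrier M" "y \<in> carrier N"
    then show "pure_tensor R M N x y \<in> carrier (tensor R M N)"
      by (rule pure_tensor_closed[OF assms])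
  next
    fix x x' y assume *: "x \<in> carrier M" "x' \<in> carrier M" "y \<in> carrier N"
    show "pure_tensor R M N (x \<oplus>\<^bsub>M\<^esub> x') y
        = pure_tensor R M N x y \<otimes>\<^bsub>tensor R M N\<^esub> pure_tensor R M N x' y"
      unfolding pure_tensor_def
      by (subst mult, use * in simp, use * in simp, rule eq)
        (use * in \<open>auto simp: tensor_relators_def p\<close>)
  next
    fix x y y' assume *: "x \<in> carrier M" "y \<in> carrier N" "y' \<in> carrier N"
    show "pure_tensor R M N x (y \<oplus>\<^bsub>N\<^esub> y')
        = pure_tensor R M N x y \<otimes>\<^bsub>tensor R M N\<^esub> pure_tensor R M N x y'"
      unfolding pure_tensor_def
      by (subst mult, use * in simp, use * in simp, rule eq)
        (use * in \<open>auto simp: tensor_relators_def p\<close>)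
  next
    fix a x y assume *: "a \<in> carrier R" "x \<in> carrier M" "y \<in> carrier N"
    show "pure_tensor R M N (a \<odot>\<^bsub>M\<^esub> x) y = pure_tensor R M N x (a \<odot>\<^bsub>N\<^esub> y)"
      unfolding pure_tensor_def
      by (rule eq) (use * in \<open>auto simp: tensor_relators_def\<close>)
  qed
qed

lemma
  fixes M :: "('a, 'm, 'c) module_scheme" and N :: "('a, 'n, 'd) module_scheme"
  assumes MN: "module R M" "module R N" and G: "comm_group G" and \<beta>: "balanced R M N G \<beta>"
  shows tensor_lift_hom: "tensor_lift M N G \<beta> \<in> hom (tensor R M N) G"
    and tensor_lift_pure: "\<And>x y. \<lbrakk>x \<in> carrier M; y \<in> carrier N\<rbrakk>
          \<Longrightarrow> tensor_lift M N G \<beta> (pure_tensor R M N x y) = \<beta> x y"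
proof -
  interpret M: module R M by fact
  interpret N: module R N by fact
  interpret G: comm_group G by fact
  let ?S = "carrier M \<times> carrier N"
  let ?F = "free_Abelian_group ?S"
  let ?K = "tensor_kernel R M N"
  interpret F: comm_group ?F by (rule abelian_free_Abelian_group)
  interpret K: normal ?K ?F by (rule tensor_kernel_normal[OF MN])
  define h :: "('m \<times> 'n \<Rightarrow>\<^sub>0 int) \<Rightarrow> _"
    where "h = (\<lambda>c. gfinprod G (\<lambda>p. case_prod \<beta> p [^]\<^bsub>G\<^esub> Poly_Mapping.lookup c p) ?S)"
  have cl: "case_prod \<beta> p \<in> carrier G" if "p \<in> ?S" for p
    using \<beta> that by (auto simp: balanced_def)
  have fin: "finite {p \<in> ?S. case_prod \<beta> p [^]\<^bsub>G\<^esub> Poly_Mapping.lookup c p \<noteq> \<one>\<^bsub>G\<^esub>}"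
    for c :: "'m \<times> 'n \<Rightarrow>\<^sub>0 int"
    by (rule finite_subset[OF _ finite_keys[of c]]) (auto simp: in_keys_iff)
  have h_hom: "h \<in> hom ?F G"
  proof (rule homI)
    fix x y assume xy: "x \<in> carrier ?F" "y \<in> carrier ?F"
    have "h (x + y) = gfinprod G (\<lambda>p. (case_prod \<beta> p [^]\<^bsub>G\<^esub> Poly_Mapping.lookup x p)
              \<otimes>\<^bsub>G\<^esub> (case_prod \<beta> p [^]\<^bsub>G\<^esub> Poly_Mapping.lookup y p)) ?S"
      unfolding h_def using cl
      by (intro G.gfinprod_cong) (auto simp: lookup_add G.int_pow_mult simp_implies_def)
    also have "\<dots> = h x \<otimes>\<^bsub>G\<^esub> h y"
      unfolding h_def using cl by (intro G.gfinprod_distrib fin) auto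
    finally show "h (x \<otimes>\<^bsub>?F\<^esub> y) = h x \<otimes>\<^bsub>G\<^esub> h y" by simp
  next
    fix x assume "x \<in> carrier ?F"
    show "h x \<in> carrier G"
      unfolding h_def by (rule G.gfinprod_closed) (use cl in auto)
  qed
  interpret h: group_hom ?F G h
    by unfold_locales (rule h_hom)
  have h_frag: "h (frag_of (x, y)) = \<beta> x y" if "x \<in> carrier M" "y \<in> carrier N" for x y
  proof -
    have b: "\<beta> x y \<in> carrier G" using cl[of "(x, y)"] that by simp
    have "h (frag_of (x, y)) = gfinprod G (\<lambda>p. if p = (x, y) then \<beta> x y else \<one>\<^bsub>G\<^esub>) ?S"
      unfolding h_def using cl that b
      by (intro G.gfinprod_cong) (auto simp: simp_implies_def)
    also have "\<dots> = \<beta> x y"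
    proof (cases "\<beta> x y = \<one>\<^bsub>G\<^esub>")
      case True
      then show ?thesis by (simp add: gfinprod_def)
    next
      case False
      then have "{p \<in> ?S. (if p = (x, y) then \<beta> x y else \<one>\<^bsub>G\<^esub>) \<noteq> \<one>\<^bsub>G\<^esub>} = {(x, y)}"
        using that by auto
      then show ?thesis
        using b by (simp add: gfinprod_def)
    qed
    finally show ?thesis .
  qed
  have pk: "Poly_Mapping.keys (a + b) \<subseteq> S" if "Poly_Mapping.keys a \<subseteq> S" "Poly_Mapping.keys b \<subseteq> S"
    for a b :: "'x \<Rightarrow>\<^sub>0 int" and S
    using that keys_add[of a b] by blast
  have h_diff: "h (a - b) = \<one>\<^bsub>G\<^esub>"
    if "a \<in> carrier ?F" "b \<in> carrier ?F" "h a = h b" for a b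
  proof -
    have "h (a - b) = h (a \<otimes>\<^bsub>?F\<^esub> inv\<^bsub>?F\<^esub> b)" using that by simp
    also have "\<dots> = \<one>\<^bsub>G\<^esub>" using that by (simp only: h.hom_mult F.inv_closed h.hom_inv h.hom_closed G.r_inv)
    finally show ?thesis .
  qed
  have h_add: "h (a + b) = h a \<otimes>\<^bsub>G\<^esub> h b" if "a \<in> carrier ?F" "b \<in> carrier ?F" for a b
    using h.hom_mult[OF that] by simp
  have rel: "tensor_relators R M N \<subseteq> kernel ?F G h"
  proof
    fix r assume r: "r \<in> tensor_relators R M N"
    then have "r \<in> carrier ?F" using tensor_relators_subset[OF MN] by blast
    moreover have "h r = \<one>\<^bsub>G\<^esub>"
      using r unfolding tensor_relators_def
      by (auto intro!: h_diff simp: pk h_add h_frag) (use \<beta> in \<open>auto simp: balanced_def\<close>)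
    ultimately show "r \<in> kernel ?F G h" by (simp add: kernel_def)
  qed
  have "?K \<subseteq> kernel ?F G h"
    unfolding tensor_kernel_def
    by (rule F.generate_subgroup_incl[OF rel h.subgroup_kernel])
  then obtain g where g: "g \<in> hom (?F Mod ?K) G" "\<And>x. x \<in> carrier ?F \<Longrightarrow> g (?K #>\<^bsub>?F\<^esub> x) = h x"
    using h.FactGroup_universal_kernel[OF K.normal_axioms] by metis
  have lift: "tensor_lift M N G \<beta> X = g X" if "X \<in> carrier (tensor R M N)" for X
  proof -
    obtain c where c: "c \<in> carrier ?F" "X = ?K #>\<^bsub>?F\<^esub> c"
      using \<open>X \<in> _\<close> by (auto simp: tensor_def FactGroup_def RCOSETS_def)
    have "h c' = g X" if "c' \<in> X" for c'
    proof -
      have c': "c' \<in> carrier ?F"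
        using F.r_coset_subset_G[OF K.subset c(1)] that c(2) by blast
      have "?K #>\<^bsub>?F\<^esub> c = ?K #>\<^bsub>?F\<^esub> c'"
        using F.repr_independence[OF _ c(1) K.subgroup_axioms] that c(2) by blast
      then show ?thesis using g(2)[OF c'] c(2) by simp
    qed
    moreover have "c \<in> X" using F.rcos_self[OF c(1) K.subgroup_axioms] c(2) by simp
    ultimately have "h ` X = {g X}" by (auto intro: rev_image_eqI)
    then show ?thesis unfolding tensor_lift_def h_def[symmetric] by simp
  qed
  show "tensor_lift M N G \<beta> \<in> hom (tensor R M N) G"
  proof -
    interpret T: comm_group "tensor R M N" by (rule comm_group_tensor[OF MN])
    show ?thesis
      using g(1) unfolding tensor_def[symmetric] hom_def by (auto simp: lift Pi_def)
  qed
  fix x y assume xy: "x \<in> carrier M" "y \<in> carrier N"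
  show "tensor_lift M N G \<beta> (pure_tensor R M N x y) = \<beta> x y"
    unfolding lift[OF pure_tensor_closed[OF MN xy]]
    unfolding pure_tensor_def using g(2)[of "frag_of (x, y)"] xy h_frag[OF xy] by simp
qed


lemma
  assumes mods: "module R M" "module R N" "module R M'" "module R N'"
    and f: "f \<in> mod_hom R M M'" and g: "g \<in> mod_hom R N N'"
  shows tensor_map_hom: "tensor_map R M N M' N' f g \<in> hom (tensor R M N) (tensor R M' N')"
    and tensor_map_pure: "\<And>x y. \<lbrakk>x \<in> carrier M; y \<in> carrier N\<rbrakk>
          \<Longrightarrow> tensor_map R M N M' N' f g (pure_tensor R M N x y) = pure_tensor R M' N' (f x) (g y)"
proof -
  have "balanced R M N (tensor R M' N') (\<lambda>x y. pure_tensor R M' N' (f x) (g y))"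
    using balanced_pure_tensor[OF mods(3,4)] f g
    unfolding balanced_def mod_hom_def by (simp add: Pi_iff)
  note lift = tensor_lift_hom[OF mods(1,2) comm_group_tensor[OF mods(3,4)] this]
    tensor_lift_pure[OF mods(1,2) comm_group_tensor[OF mods(3,4)] this]
  show "tensor_map R M N M' N' f g \<in> hom (tensor R M N) (tensor R M' N')"
    "\<And>x y. \<lbrakk>x \<in> carrier M; y \<in> carrier N\<rbrakk>
          \<Longrightarrow> tensor_map R M N M' N' f g (pure_tensor R M N x y) = pure_tensor R M' N' (f x) (g y)"
    unfolding tensor_map_def by (fact lift(1), rule lift(2))
qed

lemma balanced_mult:
  assumes "cring R" "cring S" "h \<in> ring_hom R S"
  shows "balanced R (restrict_scalars S h) (restrict_scalars S h) (add_monoid S) (\<lambda>x y. x \<otimes>\<^bsub>S\<^esub> y)"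
proof -
  interpret S: cring S by fact
  show ?thesis
    using ring_hom_closed[OF assms(3)]
    by (auto simp: balanced_def S.l_distr S.r_distr S.m_ac)
qed


section \<open>Flat and projective modules, projective dimension\<close>

text \<open>
  A quantifier over modules inside a definition has to fix the type of their elements. For an
  \<open>R\<close>-module with elements of type \<open>'m\<close> we use \<open>('a \<times> 'm) list\<close>, where \<open>'a\<close> is the type
  of \<open>R\<close>: it is infinite and as large as \<open>'a\<close> and \<open>'m\<close>, so up to isomorphism it carries all
  submodules, quotients and (iterated) free covers of \<open>R\<close> and of the module. This loses nothing:
  flatness is detected on the inclusions of ideals of \<open>R\<close>; projectivity is detected on a free
  cover of the module (see \<open>projective_module_lift\<close> below); and the restriction of
  resolutions to that type is harmless because successive free covers of kernels stay in it.
\<close>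

definition flat_module ::
  "('a, 'k) ring_scheme \<Rightarrow> ('a, 'm, 'c) module_scheme \<Rightarrow> bool"
where
  "flat_module R F \<longleftrightarrow>
     module R F \<and>
     (\<forall>(M :: ('a, ('a \<times> 'm) list) module) (N :: ('a, ('a \<times> 'm) list) module) f.
        module R M \<and> module R N \<and> f \<in> mod_hom R M N \<and> inj_on f (carrier M) \<longrightarrow>
        inj_on (tensor_map R M F N F f (\<lambda>x. x)) (carrier (tensor R M F)))"

definition projective_module ::
  "('a, 'k) ring_scheme \<Rightarrow> ('a, 'm, 'c) module_scheme \<Rightarrow> bool"
where
  "projective_module R P \<longleftrightarrow>
     module R P \<and>
     (\<forall>(M :: ('a, ('a \<times> 'm) list) module) (N :: ('a, ('a \<times> 'm) list) module) g f.
        module R M \<and> module R N \<and> g \<in> mod_hom R M N \<and> g ` carrier M = carrier N \<and>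
        f \<in> mod_hom R P N \<longrightarrow>
        (\<exists>h \<in> mod_hom R P M. \<forall>x\<in>carrier P. g (h x) = f x))"


subsection \<open>Projectivity does not depend on the type of the test modules\<close>

lemma mod_hom_closed: "\<lbrakk>f \<in> mod_hom R M N; x \<in> carrier M\<rbrakk> \<Longrightarrow> f x \<in> carrier N"
  by (auto simp: mod_hom_def)

lemma mod_hom_add:
  "\<lbrakk>f \<in> mod_hom R M N; x \<in> carrier M; y \<in> carrier M\<rbrakk> \<Longrightarrow> f (x \<oplus>\<^bsub>M\<^esub> y) = f x \<oplus>\<^bsub>N\<^esub> f y"
  by (auto simp: mod_hom_def)

lemma mod_hom_smult:
  "\<lbrakk>f \<in> mod_hom R M N; a \<in> carrier R; x \<in> carrier M\<rbrakk> \<Longrightarrow> f (a \<odot>\<^bsub>M\<^esub> x) = a \<odot>\<^bsub>N\<^esub> f x"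
  by (auto simp: mod_hom_def)

lemma mod_hom_comp:
  "\<lbrakk>f \<in> mod_hom R M N; g \<in> mod_hom R N L\<rbrakk> \<Longrightarrow> (\<lambda>x. g (f x)) \<in> mod_hom R M L"
  by (auto simp: mod_hom_def Pi_def)

lemma mod_hom_zero:
  assumes "module R M" "module R N" "f \<in> mod_hom R M N"
  shows "f \<zero>\<^bsub>M\<^esub> = \<zero>\<^bsub>N\<^esub>"
proof -
  interpret M: module R M by fact
  interpret N: module R N by fact
  have "f (\<zero>\<^bsub>R\<^esub> \<odot>\<^bsub>M\<^esub> \<zero>\<^bsub>M\<^esub>) = \<zero>\<^bsub>R\<^esub> \<odot>\<^bsub>N\<^esub> f \<zero>\<^bsub>M\<^esub>"
    by (rule mod_hom_smult[OF assms(3)]) auto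
  then show ?thesis using mod_hom_closed[OF assms(3)] by simp
qed

definition transport_module ::
  "('m \<Rightarrow> 'n) \<Rightarrow> ('a, 'm, 'c) module_scheme \<Rightarrow> ('a, 'n) module"
where
  "transport_module \<phi> M =
     (let \<psi> = inv_into (carrier M) \<phi> in
      \<lparr>carrier = \<phi> ` carrier M, monoid.mult = undefined, one = undefined,
       ring.zero = \<phi> \<zero>\<^bsub>M\<^esub>, add = (\<lambda>x y. \<phi> (\<psi> x \<oplus>\<^bsub>M\<^esub> \<psi> y)),
       module.smult = (\<lambda>a x. \<phi> (a \<odot>\<^bsub>M\<^esub> \<psi> x))\<rparr>)"

lemma
  assumes "module R M" and inj: "inj_on \<phi> (carrier M)"
  shows module_transport: "module R (transport_module \<phi> M)"
    and transport_hom: "\<phi> \<in> mod_hom R M (transport_module \<phi> M)"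
    and transport_inv_hom: "inv_into (carrier M) \<phi> \<in> mod_hom R (transport_module \<phi> M) M"
proof -
  interpret M: module R M by fact
  let ?T = "transport_module \<phi> M"
  note inv [simp] = inv_into_f_f[OF inj]
  have T [simp]: "carrier ?T = \<phi> ` carrier M" "\<zero>\<^bsub>?T\<^esub> = \<phi> \<zero>\<^bsub>M\<^esub>"
    "\<And>x y. x \<oplus>\<^bsub>?T\<^esub> y = \<phi> (inv_into (carrier M) \<phi> x \<oplus>\<^bsub>M\<^esub> inv_into (carrier M) \<phi> y)"
    "\<And>a x. a \<odot>\<^bsub>?T\<^esub> x = \<phi> (a \<odot>\<^bsub>M\<^esub> inv_into (carrier M) \<phi> x)"
    by (simp_all add: transport_module_def Let_def)
  have neg: "\<exists>y\<in>carrier M. y \<oplus>\<^bsub>M\<^esub> x = \<zero>\<^bsub>M\<^esub>" if "x \<in> carrier M" for x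
    using M.l_neg[OF that] M.a_inv_closed[OF that] by blast
  have "\<exists>y\<in>\<phi> ` carrier M. y \<oplus>\<^bsub>?T\<^esub> x = \<phi> \<zero>\<^bsub>M\<^esub>" if "x \<in> \<phi> ` carrier M" for x
  proof -
    obtain z where z: "z \<in> carrier M" "x = \<phi> z" using \<open>x \<in> \<phi> ` carrier M\<close> by blast
    with neg obtain y where "y \<in> carrier M" "y \<oplus>\<^bsub>M\<^esub> z = \<zero>\<^bsub>M\<^esub>" by blast
    with z show ?thesis by (intro bexI[of _ "\<phi> y"]) auto
  qed
  then have "abelian_group ?T"
    by (intro abelian_groupI) (auto simp: M.a_ac)
  then show "module R ?T"
    by (intro moduleI M.is_cring)
      (auto simp: M.smult_l_distr M.smult_r_distr M.smult_assoc1)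
  show "\<phi> \<in> mod_hom R M ?T" "inv_into (carrier M) \<phi> \<in> mod_hom R ?T M"
    by (auto simp: mod_hom_def)
qed

definition free_module :: "('a, 'k) ring_scheme \<Rightarrow> 's set \<Rightarrow> ('a, 's \<Rightarrow> 'a) module" where
  "free_module R S =
     \<lparr>carrier = {c. (\<forall>s. c s \<in> carrier R) \<and> {s. c s \<noteq> \<zero>\<^bsub>R\<^esub>} \<subseteq> S \<and> finite {s. c s \<noteq> \<zero>\<^bsub>R\<^esub>}},
      monoid.mult = undefined, one = undefined,
      ring.zero = (\<lambda>s. \<zero>\<^bsub>R\<^esub>), add = (\<lambda>c d s. c s \<oplus>\<^bsub>R\<^esub> d s),
      module.smult = (\<lambda>a c s. a \<otimes>\<^bsub>R\<^esub> c s)\<rparr>"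

lemma module_free_module:
  assumes "cring R"
  shows "module R (free_module R S)"
proof -
  interpret R: cring R by fact
  let ?F = "free_module R S"
  have F: "carrier ?F = {c. (\<forall>s. c s \<in> carrier R) \<and> {s. c s \<noteq> \<zero>\<^bsub>R\<^esub>} \<subseteq> S \<and> finite {s. c s \<noteq> \<zero>\<^bsub>R\<^esub>}}"
    "\<zero>\<^bsub>?F\<^esub> = (\<lambda>s. \<zero>\<^bsub>R\<^esub>)" "\<And>c d. c \<oplus>\<^bsub>?F\<^esub> d = (\<lambda>s. c s \<oplus>\<^bsub>R\<^esub> d s)"
    "\<And>a c. a \<odot>\<^bsub>?F\<^esub> c = (\<lambda>s. a \<otimes>\<^bsub>R\<^esub> c s)"
    by (simp_all add: free_module_def)
  have supp_add: "{s. c s \<oplus>\<^bsub>R\<^esub> d s \<noteq> \<zero>\<^bsub>R\<^esub>} \<subseteq> {s. c s \<noteq> \<zero>\<^bsub>R\<^esub>} \<union> {s. d s \<noteq> \<zero>\<^bsub>R\<^esub>}" for c d :: "'c \<Rightarrow> 'a"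
    by auto
  have add: "c \<oplus>\<^bsub>?F\<^esub> d \<in> carrier ?F" if "c \<in> carrier ?F" "d \<in> carrier ?F" for c d
    using that finite_subset[OF supp_add, of c d] supp_add[of c d] unfolding F by blast
  have supp_smult: "{s. a \<otimes>\<^bsub>R\<^esub> c s \<noteq> \<zero>\<^bsub>R\<^esub>} \<subseteq> {s. c s \<noteq> \<zero>\<^bsub>R\<^esub>}" if "a \<in> carrier R" for a and c :: "'c \<Rightarrow> 'a"
    using that by auto
  have smult: "a \<odot>\<^bsub>?F\<^esub> c \<in> carrier ?F" if "a \<in> carrier R" "c \<in> carrier ?F" for a c
    using that finite_subset[OF supp_smult, of a c] supp_smult[of a c] unfolding F by blast
  have zero: "\<zero>\<^bsub>?F\<^esub> \<in> carrier ?F" by (simp add: F)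
  have neg: "\<exists>d\<in>carrier ?F. d \<oplus>\<^bsub>?F\<^esub> c = \<zero>\<^bsub>?F\<^esub>" if "c \<in> carrier ?F" for c
  proof
    show "(\<ominus>\<^bsub>R\<^esub> \<one>\<^bsub>R\<^esub>) \<odot>\<^bsub>?F\<^esub> c \<in> carrier ?F" using that by (intro smult) auto
    show "(\<ominus>\<^bsub>R\<^esub> \<one>\<^bsub>R\<^esub>) \<odot>\<^bsub>?F\<^esub> c \<oplus>\<^bsub>?F\<^esub> c = \<zero>\<^bsub>?F\<^esub>"
      using that by (auto simp: F fun_eq_iff R.l_minus R.l_neg)
  qed
  have "abelian_group ?F"
    by (intro abelian_groupI add zero neg) (auto simp: F R.a_ac)
  then show ?thesis
    by (intro moduleI assms smult) (auto simp: F R.l_distr R.r_distr R.m_assoc)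
qed

definition linear_combination ::
  "('a, 'k) ring_scheme \<Rightarrow> ('a, 'm, 'c) module_scheme \<Rightarrow> ('s \<Rightarrow> 'm) \<Rightarrow> ('s \<Rightarrow> 'a) \<Rightarrow> 'm"
where
  "linear_combination R M m c = (\<Oplus>\<^bsub>M\<^esub>s\<in>{s. c s \<noteq> \<zero>\<^bsub>R\<^esub>}. c s \<odot>\<^bsub>M\<^esub> m s)"

lemma linear_combination_eq:
  assumes "module R M" "m \<in> S \<rightarrow> carrier M" "\<And>s. c s \<in> carrier R"
    "finite A" "{s. c s \<noteq> \<zero>\<^bsub>R\<^esub>} \<subseteq> A" "A \<subseteq> S"
  shows "linear_combination R M m c = (\<Oplus>\<^bsub>M\<^esub>s\<in>A. c s \<odot>\<^bsub>M\<^esub> m s)"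
proof -
  interpret M: module R M by fact
  show ?thesis
    unfolding linear_combination_def
    by (rule M.add.finprod_mono_neutral_cong_left) (use assms in \<open>auto simp: Pi_def subset_iff\<close>)
qed

lemma linear_combination_hom:
  assumes "module R M" "m \<in> S \<rightarrow> carrier M"
  shows "linear_combination R M m \<in> mod_hom R (free_module R S) M"
proof -
  interpret M: module R M by fact
  note eq = linear_combination_eq[OF assms]
  have ms: "m s \<in> carrier M" if "s \<in> S" for s using assms(2) that by auto
  show ?thesis
    unfolding mod_hom_def
  proof (intro CollectI conjI ballI funcsetI)
    fix c assume "c \<in> carrier (free_module R S)"
    then show "linear_combination R M m c \<in> carrier M"
      unfolding linear_combination_def using ms
      by (intro M.finsum_closed) (auto simp: free_module_def)
  next
    fix c d assume c: "c \<in> carrier (free_module R S)" and d: "d \<in> carrier (free_module R S)"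
    let ?A = "{s. c s \<noteq> \<zero>\<^bsub>R\<^esub>} \<union> {s. d s \<noteq> \<zero>\<^bsub>R\<^esub>}"
    have A: "finite ?A" "?A \<subseteq> S" using c d by (auto simp: free_module_def)
    have cl: "c s \<in> carrier R" "d s \<in> carrier R" for s using c d by (auto simp: free_module_def)
    have "linear_combination R M m (c \<oplus>\<^bsub>free_module R S\<^esub> d)
        = (\<Oplus>\<^bsub>M\<^esub>s\<in>?A. (c s \<oplus>\<^bsub>R\<^esub> d s) \<odot>\<^bsub>M\<^esub> m s)"
      by (subst eq[where A = ?A]) (use A cl in \<open>auto simp: free_module_def\<close>)
    also have "\<dots> = (\<Oplus>\<^bsub>M\<^esub>s\<in>?A. c s \<odot>\<^bsub>M\<^esub> m s \<oplus>\<^bsub>M\<^esub> d s \<odot>\<^bsub>M\<^esub> m s)"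
      by (rule M.finsum_cong') (use A cl ms in \<open>auto simp: M.smult_l_distr subset_iff\<close>)
    also have "\<dots> = (\<Oplus>\<^bsub>M\<^esub>s\<in>?A. c s \<odot>\<^bsub>M\<^esub> m s) \<oplus>\<^bsub>M\<^esub> (\<Oplus>\<^bsub>M\<^esub>s\<in>?A. d s \<odot>\<^bsub>M\<^esub> m s)"
      by (rule M.finsum_addf) (use A cl ms in \<open>auto simp: subset_iff\<close>)
    also have "\<dots> = linear_combination R M m c \<oplus>\<^bsub>M\<^esub> linear_combination R M m d"
      by (simp add: eq[where A = ?A and c = c, OF cl(1) A(1) _ A(2)]
          eq[where A = ?A and c = d, OF cl(2) A(1) _ A(2)])
    finally show "linear_combination R M m (c \<oplus>\<^bsub>free_module R S\<^esub> d)
        = linear_combination R M m c \<oplus>\<^bsub>M\<^esub> linear_combination R M m d" .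
  next
    fix a c assume a: "a \<in> carrier R" and c: "c \<in> carrier (free_module R S)"
    let ?A = "{s. c s \<noteq> \<zero>\<^bsub>R\<^esub>}"
    have A: "finite ?A" "?A \<subseteq> S" using c by (auto simp: free_module_def)
    have cl: "c s \<in> carrier R" for s using c by (auto simp: free_module_def)
    have "linear_combination R M m (a \<odot>\<^bsub>free_module R S\<^esub> c)
        = (\<Oplus>\<^bsub>M\<^esub>s\<in>?A. (a \<otimes>\<^bsub>R\<^esub> c s) \<odot>\<^bsub>M\<^esub> m s)"
      by (subst eq[where A = ?A]) (use a A cl in \<open>auto simp: free_module_def\<close>)
    also have "\<dots> = (\<Oplus>\<^bsub>M\<^esub>s\<in>?A. a \<odot>\<^bsub>M\<^esub> (c s \<odot>\<^bsub>M\<^esub> m s))"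
      by (rule M.finsum_cong') (use a A cl ms in \<open>auto simp: M.smult_assoc1 subset_iff\<close>)
    also have "\<dots> = a \<odot>\<^bsub>M\<^esub> linear_combination R M m c"
      unfolding linear_combination_def
      by (rule M.finsum_smult_ldistr[symmetric]) (use a A cl ms in \<open>auto simp: subset_iff\<close>)
    finally show "linear_combination R M m (a \<odot>\<^bsub>free_module R S\<^esub> c)
        = a \<odot>\<^bsub>M\<^esub> linear_combination R M m c" .
  qed
qed

lemma mod_hom_linear_combination:
  assumes MN: "module R M" "module R N" and f: "f \<in> mod_hom R M N"
    and m: "m \<in> S \<rightarrow> carrier M" and c: "c \<in> carrier (free_module R S)"
  shows "f (linear_combination R M m c) = linear_combination R N (\<lambda>s. f (m s)) c"
proof -
  interpret M: module R M by fact
  interpret N: module R N by fact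
  let ?A = "{s. c s \<noteq> \<zero>\<^bsub>R\<^esub>}"
  have A: "finite ?A" "?A \<subseteq> S" and cl: "\<And>s. c s \<in> carrier R" using c by (auto simp: free_module_def)
  have "f (\<Oplus>\<^bsub>M\<^esub>s\<in>B. c s \<odot>\<^bsub>M\<^esub> m s) = (\<Oplus>\<^bsub>N\<^esub>s\<in>B. c s \<odot>\<^bsub>N\<^esub> f (m s))"
    if "finite B" "B \<subseteq> S" for B
    using that
  proof (induction B rule: finite_induct)
    case empty
    then show ?case by (simp add: mod_hom_zero[OF MN f])
  next
    case (insert x B)
    then have "m \<in> insert x B \<rightarrow> carrier M" using m by blast
    then have 1: "(\<lambda>s. c s \<odot>\<^bsub>M\<^esub> m s) \<in> B \<rightarrow> carrier M" "c x \<odot>\<^bsub>M\<^esub> m x \<in> carrier M" "m x \<in> carrier M"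
      and 2: "(\<lambda>s. c s \<odot>\<^bsub>N\<^esub> f (m s)) \<in> B \<rightarrow> carrier N" "c x \<odot>\<^bsub>N\<^esub> f (m x) \<in> carrier N"
      using cl mod_hom_closed[OF f] by auto
    have "(\<Oplus>\<^bsub>M\<^esub>s\<in>B. c s \<odot>\<^bsub>M\<^esub> m s) \<in> carrier M" using 1(1) by (rule M.finsum_closed)
    then show ?case
      using insert 1 2 cl by (simp add: mod_hom_add[OF f] mod_hom_smult[OF f])
  qed
  from this[OF A] show ?thesis by (simp add: linear_combination_def)
qed

theorem projective_module_lift:
  fixes M :: "('a, 'm, 'c) module_scheme" and N :: "('a, 'n, 'd) module_scheme"
    and P :: "('a, 'p, 'e) module_scheme"
  assumes P: "projective_module R P" and M: "module R M" and N: "module R N"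
    and g: "g \<in> mod_hom R M N" "g ` carrier M = carrier N" and f: "f \<in> mod_hom R P N"
  shows "\<exists>h \<in> mod_hom R P M. \<forall>x\<in>carrier P. g (h x) = f x"
proof -
  have modP: "module R P" using P by (simp add: projective_module_def)
  interpret P: module R P by fact
  let ?F = "free_module R (carrier P)"
  have modF: "module R ?F" by (rule module_free_module[OF P.is_cring])
  define \<phi> :: "('p \<Rightarrow> 'a) \<Rightarrow> ('a \<times> 'p) list"
    where "\<phi> = (\<lambda>c. map (\<lambda>p. (c p, p)) (SOME ps. set ps = {p. c p \<noteq> \<zero>\<^bsub>R\<^esub>}))"
  define \<phi>' :: "'p \<Rightarrow> ('a \<times> 'p) list" where "\<phi>' = (\<lambda>p. [(undefined, p)])"
  have set_\<phi>: "set (\<phi> c) = (\<lambda>p. (c p, p)) ` {p. c p \<noteq> \<zero>\<^bsub>R\<^esub>}" if "c \<in> carrier ?F" for c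
  proof -
    have "finite {p. c p \<noteq> \<zero>\<^bsub>R\<^esub>}" using that by (simp add: free_module_def)
    from someI_ex[OF finite_list[OF this]]
    have "set (SOME ps. set ps = {p. c p \<noteq> \<zero>\<^bsub>R\<^esub>}) = {p. c p \<noteq> \<zero>\<^bsub>R\<^esub>}" .
    then show ?thesis by (simp add: \<phi>_def)
  qed
  have inj: "inj_on \<phi> (carrier ?F)"
  proof (rule inj_onI, rule ext)
    fix c d p assume *: "c \<in> carrier ?F" "d \<in> carrier ?F" "\<phi> c = \<phi> d"
    then have eq: "(\<lambda>p. (c p, p)) ` {p. c p \<noteq> \<zero>\<^bsub>R\<^esub>} = (\<lambda>p. (d p, p)) ` {p. d p \<noteq> \<zero>\<^bsub>R\<^esub>}"
      using set_\<phi>[OF *(1)] set_\<phi>[OF *(2)] by simp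
    show "c p = d p"
    proof (cases "c p = \<zero>\<^bsub>R\<^esub> \<and> d p = \<zero>\<^bsub>R\<^esub>")
      case False
      then have "(c p, p) \<in> (\<lambda>p. (d p, p)) ` {p. d p \<noteq> \<zero>\<^bsub>R\<^esub>} \<or> (d p, p) \<in> (\<lambda>p. (c p, p)) ` {p. c p \<noteq> \<zero>\<^bsub>R\<^esub>}"
        using eq by blast
      then show ?thesis by auto
    qed simp
  qed
  have inj': "inj_on \<phi>' (carrier P)" by (simp add: \<phi>'_def inj_on_def)
  let ?M = "transport_module \<phi> ?F" and ?N = "transport_module \<phi>' P"
  let ?\<psi> = "inv_into (carrier ?F) \<phi>" and ?\<pi> = "linear_combination R P (\<lambda>p. p)"
  have \<pi>: "?\<pi> \<in> mod_hom R ?F P" by (rule linear_combination_hom[OF modP]) auto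
  have \<psi>: "?\<psi> \<in> mod_hom R ?M ?F" by (rule transport_inv_hom[OF modF inj])
  have \<phi>': "\<phi>' \<in> mod_hom R P ?N" by (rule transport_hom[OF modP inj'])
  have hom: "(\<lambda>x. \<phi>' (?\<pi> (?\<psi> x))) \<in> mod_hom R ?M ?N"
    by (rule mod_hom_comp[OF mod_hom_comp[OF \<psi> \<pi>] \<phi>'])
  have surj: "(\<lambda>x. \<phi>' (?\<pi> (?\<psi> x))) ` carrier ?M = carrier ?N"
  proof (intro equalityI subsetI)
    fix y assume "y \<in> carrier ?N"
    then obtain p where p: "p \<in> carrier P" "y = \<phi>' p" by (auto simp: transport_module_def Let_def)
    let ?c = "\<lambda>q. if q = p then \<one>\<^bsub>R\<^esub> else \<zero>\<^bsub>R\<^esub>"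
    have c: "?c \<in> carrier ?F"
      using p by (auto simp: free_module_def intro: finite_subset[of _ "{p}"])
    have "?\<pi> ?c = (\<Oplus>\<^bsub>P\<^esub>q\<in>{p}. ?c q \<odot>\<^bsub>P\<^esub> q)"
      by (rule linear_combination_eq[OF modP, where S = "carrier P"]) (use p in auto)
    also have "\<dots> = p" using p by simp
    finally have "y = \<phi>' (?\<pi> (?\<psi> (\<phi> ?c)))" using c inj p by simp
    moreover have "\<phi> ?c \<in> carrier ?M" using c by (simp add: transport_module_def Let_def)
    ultimately show "y \<in> (\<lambda>x. \<phi>' (?\<pi> (?\<psi> x))) ` carrier ?M" by blast
  qed (use mod_hom_closed[OF hom] in blast)
  note lift = conjunct2[OF P[unfolded projective_module_def], rule_format,
      of ?M ?N "\<lambda>x. \<phi>' (?\<pi> (?\<psi> x))" \<phi>']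
  have "\<exists>h\<in>mod_hom R P ?M. \<forall>x\<in>carrier P. \<phi>' (?\<pi> (?\<psi> (h x))) = \<phi>' x"
    by (rule lift) (intro conjI module_transport modF modP inj inj' hom surj \<phi>')
  then obtain h where h: "h \<in> mod_hom R P ?M" "\<forall>x\<in>carrier P. \<phi>' (?\<pi> (?\<psi> (h x))) = \<phi>' x"
    by blast
  define s where "s = (\<lambda>x. ?\<psi> (h x))"
  have s: "s \<in> mod_hom R P ?F" unfolding s_def by (rule mod_hom_comp[OF h(1) \<psi>])
  have \<pi>s: "?\<pi> (s x) = x" if "x \<in> carrier P" for x
    using h(2) that by (auto simp: s_def \<phi>'_def)
  have "\<forall>p\<in>carrier P. \<exists>m\<in>carrier M. g m = f p"
    using g(2) mod_hom_closed[OF f] by (metis imageE)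
  then obtain m where m: "\<And>p. p \<in> carrier P \<Longrightarrow> m p \<in> carrier M \<and> g (m p) = f p" by metis
  then have m': "m \<in> carrier P \<rightarrow> carrier M" by blast
  have "g (linear_combination R M m (s x)) = f x" if x: "x \<in> carrier P" for x
  proof -
    have sx: "s x \<in> carrier ?F" by (rule mod_hom_closed[OF s x])
    then have supp: "{p. s x p \<noteq> \<zero>\<^bsub>R\<^esub>} \<subseteq> carrier P" and cl: "\<And>p. s x p \<in> carrier R"
      by (auto simp: free_module_def)
    interpret N: module R N by fact
    have "g (linear_combination R M m (s x)) = linear_combination R N (\<lambda>p. g (m p)) (s x)"
      by (rule mod_hom_linear_combination[OF M N g(1) m' sx])
    also have "\<dots> = linear_combination R N (\<lambda>p. f p) (s x)"
      unfolding linear_combination_def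
      by (rule N.finsum_cong') (use supp cl m mod_hom_closed[OF f] in \<open>auto simp: subset_iff\<close>)
    also have "\<dots> = f (?\<pi> (s x))"
      by (rule mod_hom_linear_combination[OF modP N f _ sx, symmetric]) auto
    finally show ?thesis using \<pi>s[OF x] by simp
  qed
  moreover have "(\<lambda>x. linear_combination R M m (s x)) \<in> mod_hom R P M"
    by (rule mod_hom_comp[OF s linear_combination_hom[OF M m']])
  ultimately show ?thesis
    by (intro bexI[of _ "\<lambda>x. linear_combination R M m (s x)"]) auto
qed

text \<open>
  A resolution \<open>\<dots> \<rightarrow> P 1 \<rightarrow> P 0 \<rightarrow> M \<rightarrow> 0\<close>: the map \<open>\<epsilon>\<close> is the augmentation,
  and \<open>d i\<close> goes from \<open>P (Suc i)\<close> to \<open>P i\<close>.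
\<close>

definition projective_resolution ::
  "('a, 'k) ring_scheme \<Rightarrow> ('a, 'm, 'c) module_scheme \<Rightarrow> (nat \<Rightarrow> ('a, 'p, 'd) module_scheme)
     \<Rightarrow> (nat \<Rightarrow> 'p \<Rightarrow> 'p) \<Rightarrow> ('p \<Rightarrow> 'm) \<Rightarrow> bool"
where
  "projective_resolution R M P d \<epsilon> \<longleftrightarrow>
     (\<forall>i. projective_module R (P i)) \<and>
     \<epsilon> \<in> mod_hom R (P 0) M \<and> (\<forall>i. d i \<in> mod_hom R (P (Suc i)) (P i)) \<and>
     \<epsilon> ` carrier (P 0) = carrier M \<and>
     d 0 ` carrier (P 1) = {x \<in> carrier (P 0). \<epsilon> x = \<zero>\<^bsub>M\<^esub>} \<and>
     (\<forall>i. d (Suc i) ` carrier (P (Suc (Suc i))) =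
            {x \<in> carrier (P (Suc i)). d i x = \<zero>\<^bsub>P i\<^esub>})"

definition projective_dimension ::
  "('a, 'k) ring_scheme \<Rightarrow> ('a, 'm, 'c) module_scheme \<Rightarrow> enat"
where
  "projective_dimension R M =
     Inf {enat n | n. \<exists>(P :: nat \<Rightarrow> ('a, ('a \<times> 'm) list) module) d \<epsilon>.
            projective_resolution R M P d \<epsilon> \<and> (\<forall>i>n. carrier (P i) = {\<zero>\<^bsub>P i\<^esub>})}"


section \<open>Flat epimorphisms and the associated set of ideals\<close>

definition flat_epimorphism ::
  "('a, 'k) ring_scheme \<Rightarrow> ('b, 'l) ring_scheme \<Rightarrow> ('a \<Rightarrow> 'b) \<Rightarrow> bool"
where
  "flat_epimorphism R U u \<longleftrightarrow>
     cring R \<and> cring U \<and> u \<in> ring_hom R U \<and>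
     flat_module R (restrict_scalars U u) \<and>
     tensor_lift (restrict_scalars U u) (restrict_scalars U u) (add_monoid U) (\<lambda>x y. x \<otimes>\<^bsub>U\<^esub> y)
       \<in> iso (tensor R (restrict_scalars U u) (restrict_scalars U u)) (add_monoid U)"

definition annihilated_ideals ::
  "('a, 'k) ring_scheme \<Rightarrow> ('b, 'l) ring_scheme \<Rightarrow> ('a \<Rightarrow> 'b) \<Rightarrow> 'a set set"
where
  "annihilated_ideals R U u =
     {I. ideal I R \<and>
         trivial_group (tensor R (restrict_scalars (R Quot I) (\<lambda>a. I +>\<^bsub>R\<^esub> a)) (restrict_scalars U u))}"

definition semilocal :: "('a, 'k) ring_scheme \<Rightarrow> bool" where
  "semilocal T \<longleftrightarrow> finite {\<mm>. maximalideal \<mm> T}"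

definition krull_dimension_zero :: "('a, 'k) ring_scheme \<Rightarrow> bool" where
  "krull_dimension_zero T \<longleftrightarrow> (\<forall>\<pp>. primeideal \<pp> T \<longrightarrow> maximalideal \<pp> T)"

end

theory Submission
  imports Defs "HOL-Algebra.Ring_Divisibility"
begin

text \<open>
  Call an ideal \<open>I\<close> of \<open>R\<close> dense if \<open>I U = U\<close>; the dense ideals are those with
  \<open>R/I \<otimes>\<^sub>R U = 0\<close>. Flatness and \<open>U \<otimes>\<^sub>R U = U\<close> say that every element of \<open>U\<close> has a dense ideal of
  denominators and that every element of the kernel of \<open>u\<close> has a dense annihilator. By the
  hypothesis the dense primes form a set \<open>\<Lambda>\<close> of maximal ideals, and for each \<open>\<mm> \<in> \<Lambda>\<close> there are
  finitely many \<open>a \<in> \<mm>\<close>, contained in no other maximal ideal, and \<open>x\<^sub>a \<in> U\<close> with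
  \<open>\<Sum> a x\<^sub>a = 1\<close>: finitely many generators are needed to write \<open>1\<close>, and semilocality leaves only
  finitely many other maximal ideals to be avoided.

  For one \<open>\<mm>\<close>, let \<open>T\<close> be the free module on these generators and
  \<open>A\<^sub>\<mm>\<close> the colimit of \<open>R \<rightarrow> T \<rightarrow> T \<otimes> T \<rightarrow> \<dots>\<close> along multiplication by \<open>\<Sum> a \<cdot> [a]\<close>. It has the free
  resolution with the words \<open>w\<close> as generators and the relators \<open>w - \<Sum> a \<cdot> aw\<close>, and it maps to \<open>U\<close>
  by \<open>a \<mapsto> x\<^sub>a\<close> (a noncommutative form of Jouanolou's trick). Amalgamating all \<open>A\<^sub>\<mm>\<close> over \<open>R\<close> gives
  a module of projective dimension at most one, because the torsion at different \<open>\<mm>\<close> is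
  independent. Finally \<open>U\<close> is a direct summand of the amalgam: locally at \<open>\<mm>\<close> an element \<open>y \<in> U\<close>
  lifts to \<open>\<Sum> (w y) \<cdot> [w]\<close>, summed over the words \<open>w\<close> of a sufficiently large fixed length, and
  gluing over the maximal ideals of \<open>R\<close> shows that a lift of \<open>0\<close> is a combination of relators.
\<close>

section \<open>Ideals\<close>

text \<open>Telescopes bound the projective dimension of countable direct limits of free modules,
  but nothing here is assumed countable. Zero-dimensionality repairs this locally: up to a factor
  outside \<open>\<mm>\<close>, every dense ideal contains all products of sufficiently many of the
  chosen generators, so one sequence for each \<open>\<mm>\<close> captures all denominators there
  and all torsion killed by dense ideals. That \<open>\<mm>\<close> is the only maximal ideal
  containing its generators makes different \<open>\<mm>\<close> interact trivially, since at any
  other maximal ideal some word is invertible. Torsion killed by long words at \<open>\<mm>\<close>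
  is thus invisible elsewhere, and elsewhere a compatible family at \<open>\<mm>\<close> comes from
  a multiple of the empty word. Words with equal products stay distinct, so the amalgam is in
  general larger than \<open>U\<close>, and only a splitting can be expected. It suffices: the
  kernel of the map from the free module onto \<open>U\<close> becomes a direct summand of a sum of
  two free modules.\<close>

lemma (in cring) idealI_smult:
  assumes "I \<subseteq> carrier R" "\<zero> \<in> I" "\<And>a b. a \<in> I \<Longrightarrow> b \<in> I \<Longrightarrow> a \<oplus> b \<in> I"
    and "\<And>a x. a \<in> I \<Longrightarrow> x \<in> carrier R \<Longrightarrow> x \<otimes> a \<in> I"
  shows "ideal I R"
proof (rule idealI)
  have "\<ominus> a \<in> I" if "a \<in> I" for a
    using assms(4)[OF that, of "\<ominus> \<one>"] assms(1) that by (auto simp: l_minus)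
  then show "subgroup I (add_monoid R)"
    using assms by (intro add.subgroupI) (auto simp: a_inv_def)
qed (use assms m_comm ring_axioms in \<open>auto simp: subset_iff\<close>)

text \<open>Finiteness makes avoidance pass to unions of chains: a finite set inside such a union
  already lies in one member. The family \<open>{{\<one>}}\<close> yields maximal ideals; products
  of words with a fixed factor yield the prime ideal in
  \<open>dense_locally_nilpotent\<close>.\<close>

lemma (in cring) ideal_avoiding_finite_sets:
  assumes I: "ideal I R" and fin: "\<And>X. X \<in> \<X> \<Longrightarrow> finite X \<and> \<not> X \<subseteq> I"
  obtains H where "ideal H R" "I \<subseteq> H" "\<And>X. X \<in> \<X> \<Longrightarrow> \<not> X \<subseteq> H"
    "\<And>J. \<lbrakk>ideal J R; H \<subseteq> J; \<And>X. X \<in> \<X> \<Longrightarrow> \<not> X \<subseteq> J\<rbrakk> \<Longrightarrow> J = H"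
proof -
  let ?A = "{H. ideal H R \<and> I \<subseteq> H \<and> (\<forall>X\<in>\<X>. \<not> X \<subseteq> H)}"
  have "\<exists>M\<in>?A. \<forall>X\<in>?A. M \<subseteq> X \<longrightarrow> X = M"
  proof (rule subset_Zorn_nonempty)
    show "?A \<noteq> {}" using I fin by blast
    fix C assume C: "C \<noteq> {}" "subset.chain ?A C"
    have ch: "H \<subseteq> H' \<or> H' \<subseteq> H" if "H \<in> C" "H' \<in> C" for H H'
      using C(2) that by (auto simp: subset_chain_def)
    have "\<not> X \<subseteq> \<Union>C" if "X \<in> \<X>" for X
    proof
      assume "X \<subseteq> \<Union>C"
      then obtain H where "H \<in> C" "X \<subseteq> H"
        using finite_subset_Union_chain[of X C UNIV] fin[OF \<open>X \<in> \<X>\<close>] C(1) ch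
        by (auto simp: subset_chain_def)
      then show False using C(2) that by (auto simp: subset_chain_def)
    qed
    moreover have "ideal (\<Union>C) R"
      using chain_Union_is_ideal[of C] C by (auto simp: subset_chain_def)
    moreover have "I \<subseteq> \<Union>C" using C unfolding subset_chain_def by blast
    ultimately show "\<Union>C \<in> ?A" by blast
  qed
  then obtain M where M: "M \<in> ?A" and max: "\<forall>J\<in>?A. M \<subseteq> J \<longrightarrow> J = M" ..
  show ?thesis
  proof (rule that[of M])
    fix J assume "ideal J R" "M \<subseteq> J" "\<And>X. X \<in> \<X> \<Longrightarrow> \<not> X \<subseteq> J"
    moreover from this M have "J \<in> ?A" by auto
    ultimately show "J = M" using max by blast
  qed (use M in auto)
qed

lemma (in cring) exists_maximalideal:
  assumes "ideal I R" "\<one> \<notin> I"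
  obtains \<mm> where "maximalideal \<mm> R" "I \<subseteq> \<mm>"
proof -
  obtain H where H: "ideal H R" "I \<subseteq> H" "\<one> \<notin> H"
    "\<And>J. \<lbrakk>ideal J R; H \<subseteq> J; \<one> \<notin> J\<rbrakk> \<Longrightarrow> J = H"
  proof (rule ideal_avoiding_finite_sets[of I "{{\<one>}}"])
    fix H
    assume *: "ideal H R" "I \<subseteq> H" "\<And>X. X \<in> {{\<one>}} \<Longrightarrow> \<not> X \<subseteq> H"
      "\<And>J. \<lbrakk>ideal J R; H \<subseteq> J; \<And>X. X \<in> {{\<one>}} \<Longrightarrow> \<not> X \<subseteq> J\<rbrakk> \<Longrightarrow> J = H"
    show thesis by (rule that[of H]) (use * in auto)
  qed (use assms in auto)
  have "maximalideal H R"
  proof (rule maximalidealI)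
    show "ideal H R" by fact
    show "carrier R \<noteq> H" using H(3) by auto
    fix J assume "ideal J R" "H \<subseteq> J"
    then show "J = H \<or> J = carrier R"
      using H(4) ideal.one_imp_carrier by (cases "\<one> \<in> J") auto
  qed
  then show ?thesis using H(2) by (rule that)
qed

text \<open>The substitute for localisation. Something holds at \<open>\<mm>\<close> if it holds
  after multiplication by an element outside \<open>\<mm>\<close>; if the good multipliers form an
  ideal and one exists at every maximal ideal, then \<open>\<one>\<close> is a good multiplier.
  Injectivity of \<open>D\<close>, the kernel and the lifts are all glued this way.\<close>

lemma (in cring) one_in_ideal_if_local:
  assumes "ideal X R" "\<And>\<mm>. maximalideal \<mm> R \<Longrightarrow> \<exists>f\<in>X. f \<notin> \<mm>"
  shows "\<one> \<in> X"
proof (rule ccontr)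
  assume "\<one> \<notin> X"
  then obtain \<mm> where "maximalideal \<mm> R" "X \<subseteq> \<mm>" using exists_maximalideal[OF assms(1)] by blast
  then show False using assms(2) by blast
qed

lemma (in cring) maximalideal_m_notin:
  assumes "maximalideal \<mm> R" "a \<in> carrier R" "b \<in> carrier R" "a \<notin> \<mm>" "b \<notin> \<mm>"
  shows "a \<otimes> b \<notin> \<mm>"
  using primeideal.I_prime[OF maximalideal_prime[OF assms(1)]] assms by blast

lemma (in cring) maximalideal_one_notin:
  assumes "maximalideal \<mm> R"
  shows "\<one> \<notin> \<mm>"
  using ideal.one_imp_carrier[OF maximalideal.axioms(1)[OF assms]] maximalideal.I_notcarr[OF assms]
  by metis

lemma (in cring) maximalideal_subset_eq:
  assumes "maximalideal \<mm> R" "ideal I R" "\<mm> \<subseteq> I" "\<one> \<notin> I"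
  shows "I = \<mm>"
  using maximalideal.I_maximal[OF assms(1,2,3)] assms(4) ideal.Icarr[OF assms(2)] by auto

section \<open>Free modules\<close>

definition basis_vector :: "('a, 'k) ring_scheme \<Rightarrow> 's \<Rightarrow> 's \<Rightarrow> 'a" where
  "basis_vector R s = (\<lambda>t. if t = s then \<one>\<^bsub>R\<^esub> else \<zero>\<^bsub>R\<^esub>)"

lemma carrier_free_module:
  "carrier (free_module R S) =
     {c. (\<forall>s. c s \<in> carrier R) \<and> {s. c s \<noteq> \<zero>\<^bsub>R\<^esub>} \<subseteq> S \<and> finite {s. c s \<noteq> \<zero>\<^bsub>R\<^esub>}}"
  by (simp add: free_module_def)

lemma free_module_simps [simp]:
  "\<zero>\<^bsub>free_module R S\<^esub> = (\<lambda>s. \<zero>\<^bsub>R\<^esub>)"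
  "(c \<oplus>\<^bsub>free_module R S\<^esub> d) = (\<lambda>s. c s \<oplus>\<^bsub>R\<^esub> d s)"
  "(a \<odot>\<^bsub>free_module R S\<^esub> c) = (\<lambda>s. a \<otimes>\<^bsub>R\<^esub> c s)"
  by (simp_all add: free_module_def)

lemma (in cring) free_moduleD:
  assumes "c \<in> carrier (free_module R S)"
  shows "c i \<in> carrier R" "i \<notin> S \<Longrightarrow> c i = \<zero>" "finite {i. c i \<noteq> \<zero>}"
  using assms by (auto simp: carrier_free_module)

lemma (in cring) free_moduleI:
  assumes "\<And>i. c i \<in> carrier R" "\<And>i. i \<notin> S \<Longrightarrow> c i = \<zero>" "finite {i. c i \<noteq> \<zero>}"
  shows "c \<in> carrier (free_module R S)"
  using assms by (auto simp: carrier_free_module)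

lemma (in cring) basis_vector_closed [intro, simp]:
  "s \<in> S \<Longrightarrow> basis_vector R s \<in> carrier (free_module R S)"
  by (auto simp: carrier_free_module basis_vector_def intro: finite_subset[of _ "{s}"])

lemma linear_combination_basis_vector:
  assumes "module R M" "m \<in> S \<rightarrow> carrier M" "s \<in> S"
  shows "linear_combination R M m (basis_vector R s) = m s"
proof -
  interpret M: module R M by fact
  have "m s \<in> carrier M" using assms by blast
  moreover have "linear_combination R M m (basis_vector R s) = (\<Oplus>\<^bsub>M\<^esub>t\<in>{s}. basis_vector R s t \<odot>\<^bsub>M\<^esub> m t)"
    by (rule linear_combination_eq[OF assms(1,2)]) (use assms in \<open>auto simp: basis_vector_def\<close>)
  ultimately show ?thesis by (simp add: basis_vector_def)
qed

lemma free_module_induct [consumes 2, case_names zero add]: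
  assumes "cring R" and c: "c \<in> carrier (free_module R S)"
    and zero: "P (\<lambda>s. \<zero>\<^bsub>R\<^esub>)"
    and add: "\<And>a s c. \<lbrakk>a \<in> carrier R; s \<in> S; c \<in> carrier (free_module R S); P c\<rbrakk>
       \<Longrightarrow> P (a \<odot>\<^bsub>free_module R S\<^esub> basis_vector R s \<oplus>\<^bsub>free_module R S\<^esub> c)"
  shows "P c"
proof -
  interpret cring R by fact
  have "\<forall>c \<in> carrier (free_module R S). {s. c s \<noteq> \<zero>\<^bsub>R\<^esub>} \<subseteq> A \<longrightarrow> P c" if "finite A" "A \<subseteq> S" for A
    using that
  proof (induction A rule: finite_induct)
    case empty
    have "c = (\<lambda>s. \<zero>\<^bsub>R\<^esub>)" if "{s. c s \<noteq> \<zero>\<^bsub>R\<^esub>} \<subseteq> {}" for c :: "'c \<Rightarrow> 'a" using that by auto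
    then show ?case using zero by blast
  next
    case (insert x A)
    show ?case
    proof (intro ballI impI)
      fix c assume c: "c \<in> carrier (free_module R S)" "{s. c s \<noteq> \<zero>\<^bsub>R\<^esub>} \<subseteq> insert x A"
      have cl: "c s \<in> carrier R" for s using c(1) by (auto simp: carrier_free_module)
      let ?c = "c(x := \<zero>\<^bsub>R\<^esub>)"
      have "{s. ?c s \<noteq> \<zero>\<^bsub>R\<^esub>} \<subseteq> {s. c s \<noteq> \<zero>\<^bsub>R\<^esub>}" by auto
      then have "?c \<in> carrier (free_module R S)" "{s. ?c s \<noteq> \<zero>\<^bsub>R\<^esub>} \<subseteq> A"
        using c cl finite_subset[of "{s. ?c s \<noteq> \<zero>\<^bsub>R\<^esub>}"] by (auto simp: carrier_free_module)
      then have "P (c x \<odot>\<^bsub>free_module R S\<^esub> basis_vector R x \<oplus>\<^bsub>free_module R S\<^esub> ?c)"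
        using insert cl by (intro add) auto
      also have "c x \<odot>\<^bsub>free_module R S\<^esub> basis_vector R x \<oplus>\<^bsub>free_module R S\<^esub> ?c = c"
        using cl by (auto simp: basis_vector_def fun_eq_iff)
      finally show "P c" .
    qed
  qed
  then show ?thesis using c by (auto simp: carrier_free_module)
qed

lemma mod_hom_free_module_eqI:
  assumes "module R N" "f \<in> mod_hom R (free_module R S) N" "g \<in> mod_hom R (free_module R S) N"
    and "\<And>s. s \<in> S \<Longrightarrow> f (basis_vector R s) = g (basis_vector R s)"
    and c: "c \<in> carrier (free_module R S)"
  shows "f c = g c"
proof -
  interpret N: module R N by fact
  interpret F: module R "free_module R S" by (rule module_free_module[OF N.is_cring])
  note simps = mod_hom_add[OF assms(2)] mod_hom_add[OF assms(3)]
    mod_hom_smult[OF assms(2)] mod_hom_smult[OF assms(3)]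
  from N.is_cring c show ?thesis
  proof (induction rule: free_module_induct)
    case zero
    then show ?case
      using mod_hom_zero[OF F.module_axioms assms(1,2)] mod_hom_zero[OF F.module_axioms assms(1,3)]
      by simp
  next
    case (add a s c)
    have b: "basis_vector R s \<in> carrier (free_module R S)"
      using add by simp
    then have "a \<odot>\<^bsub>free_module R S\<^esub> basis_vector R s \<in> carrier (free_module R S)"
      using add F.smult_closed by blast
    with b show ?case
      using add assms(4)[of s] by (simp only: simps)
  qed
qed

lemma free_module_lift:
  assumes "module R M" "module R N" "g \<in> mod_hom R M N" "g ` carrier M = carrier N"
    and f: "f \<in> mod_hom R (free_module R S) N"
  shows "\<exists>h \<in> mod_hom R (free_module R S) M. \<forall>x\<in>carrier (free_module R S). g (h x) = f x"
proof -
  interpret M: module R M by fact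
  have "\<forall>s\<in>S. \<exists>m\<in>carrier M. g m = f (basis_vector R s)"
  proof
    fix s assume "s \<in> S"
    then have "f (basis_vector R s) \<in> carrier N" using mod_hom_closed[OF f] by simp
    then show "\<exists>m\<in>carrier M. g m = f (basis_vector R s)" unfolding assms(4)[symmetric] by auto
  qed
  then obtain m where m: "\<And>s. s \<in> S \<Longrightarrow> m s \<in> carrier M" "\<And>s. s \<in> S \<Longrightarrow> g (m s) = f (basis_vector R s)"
    by metis
  have m': "m \<in> S \<rightarrow> carrier M" using m(1) by auto
  let ?h = "linear_combination R M m"
  have h: "?h \<in> mod_hom R (free_module R S) M" by (rule linear_combination_hom[OF assms(1) m'])
  have "g (?h c) = f c" if "c \<in> carrier (free_module R S)" for c
    using mod_hom_free_module_eqI[OF assms(2) mod_hom_comp[OF h assms(3)] f _ that]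
    by (simp add: m linear_combination_basis_vector[OF assms(1) m'])
  then show ?thesis using h by blast
qed

section \<open>Projectivity of modules, and resolutions of length one\<close>

lemma projective_moduleI:
  fixes P :: "('a, 'm, 'c) module_scheme"
  assumes "module R P"
    and "\<And>(M :: ('a, ('a \<times> 'm) list) module) (N :: ('a, ('a \<times> 'm) list) module) g f.
      \<lbrakk>module R M; module R N; g \<in> mod_hom R M N; g ` carrier M = carrier N; f \<in> mod_hom R P N\<rbrakk>
      \<Longrightarrow> \<exists>h \<in> mod_hom R P M. \<forall>x\<in>carrier P. g (h x) = f x"
  shows "projective_module R P"
  unfolding projective_module_def
proof (intro conjI allI impI)
  fix M N :: "('a, ('a \<times> 'm) list) module" and g f
  assume "module R M \<and> module R N \<and> g \<in> mod_hom R M N \<and> g ` carrier M = carrier N \<and> f \<in> mod_hom R P N"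
  then show "\<exists>h\<in>mod_hom R P M. \<forall>x\<in>carrier P. g (h x) = f x"
    by (elim conjE) (rule assms(2))
qed (rule assms(1))

lemma projective_free_module: "cring R \<Longrightarrow> projective_module R (free_module R S)"
  by (rule projective_moduleI[OF module_free_module free_module_lift])

text \<open>A change of element type also changes the type of the test modules in the definition, so
  the lifting property of \<open>P\<close> is used in the type-independent form
  \<open>projective_module_lift\<close>.\<close>

lemma projective_transport:
  fixes P :: "('a, 'p, 'c) module_scheme" and \<phi> :: "'p \<Rightarrow> 'q"
  assumes P: "projective_module R P" and inj: "inj_on \<phi> (carrier P)"
  shows "projective_module R (transport_module \<phi> P)"
proof -
  have mod: "module R P" using P by (simp add: projective_module_def)
  let ?T = "transport_module \<phi> P" and ?\<psi> = "inv_into (carrier P) \<phi>"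
  note \<phi> = transport_hom[OF mod inj] and \<psi> = transport_inv_hom[OF mod inj]
  have "\<exists>h\<in>mod_hom R ?T M. \<forall>x\<in>carrier ?T. g (h x) = f x"
    if "module R M" "module R N" "g \<in> mod_hom R M N" "g ` carrier M = carrier N" "f \<in> mod_hom R ?T N"
    for M N :: "('a, ('a \<times> 'q) list) module" and g f
  proof -
    from projective_module_lift[OF P that(1-4) mod_hom_comp[OF \<phi> that(5)]]
    obtain h where h: "h \<in> mod_hom R P M" "\<forall>x\<in>carrier P. g (h x) = f (\<phi> x)" by blast
    have "carrier ?T = \<phi> ` carrier P" by (simp add: transport_module_def Let_def)
    then have "g (h (?\<psi> x)) = f x" if "x \<in> carrier ?T" for x
      using h(2) that inj by auto
    then show ?thesis using mod_hom_comp[OF \<psi> h(1)] by (intro bexI[of _ "\<lambda>x. h (?\<psi> x)"] ballI)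
  qed
  with module_transport[OF mod inj] show ?thesis by (rule projective_moduleI)
qed

lemma mod_hom_plus:
  assumes "module R N" "f \<in> mod_hom R M N" "g \<in> mod_hom R M N"
  shows "(\<lambda>x. f x \<oplus>\<^bsub>N\<^esub> g x) \<in> mod_hom R M N"
proof -
  interpret N: module R N by fact
  show ?thesis
    using assms(2,3) unfolding mod_hom_def Pi_def by (auto simp: N.a_ac N.smult_r_distr)
qed

lemma module_kernel:
  assumes "module R M" "module R N" "f \<in> mod_hom R M N"
  shows "module R (M\<lparr>carrier := {x \<in> carrier M. f x = \<zero>\<^bsub>N\<^esub>}\<rparr>)"
proof -
  interpret M: module R M by fact
  interpret N: module R N by fact
  have neg: "f (\<ominus>\<^bsub>M\<^esub> a) = \<zero>\<^bsub>N\<^esub>" if a: "a \<in> carrier M" "f a = \<zero>\<^bsub>N\<^esub>" for a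
  proof -
    have "\<ominus>\<^bsub>M\<^esub> a = (\<ominus>\<^bsub>R\<^esub> \<one>\<^bsub>R\<^esub>) \<odot>\<^bsub>M\<^esub> a" using a by (simp add: M.smult_l_minus)
    then show ?thesis using a mod_hom_smult[OF assms(3), of "\<ominus>\<^bsub>R\<^esub> \<one>\<^bsub>R\<^esub>" a] by simp
  qed
  show ?thesis
    by (intro submodule.submodule_is_module M.submoduleI assms(1))
      (auto simp: mod_hom_zero[OF assms] mod_hom_add[OF assms(3)] mod_hom_smult[OF assms(3)] neg)
qed

text \<open>
  If \<open>x = (x - E x) + E x\<close> on the kernel and \<open>E x\<close> comes from a free module there,
  the kernel is a direct summand of a free module.
\<close>

lemma projective_kernel:
  fixes S :: "'s set" and M :: "('a, 'm, 'c) module_scheme"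
  assumes M: "module R M" and \<rho>: "\<rho> \<in> mod_hom R (free_module R S) M"
    and E: "E \<in> mod_hom R (free_module R S) (free_module R S)"
    and \<rho>E: "\<And>x. x \<in> carrier (free_module R S) \<Longrightarrow> \<rho> (E x) = \<rho> x"
    and D: "D \<in> mod_hom R (free_module R S') (free_module R S)"
    and inj: "inj_on D (carrier (free_module R S'))"
    and \<rho>D: "\<And>y. y \<in> carrier (free_module R S') \<Longrightarrow> \<rho> (D y) = \<zero>\<^bsub>M\<^esub>"
    and ED: "\<And>x. \<lbrakk>x \<in> carrier (free_module R S); \<rho> x = \<zero>\<^bsub>M\<^esub>\<rbrakk> \<Longrightarrow> E x \<in> D ` carrier (free_module R S')"
  shows "projective_module R
    ((free_module R S)\<lparr>carrier := {x \<in> carrier (free_module R S). \<rho> x = \<zero>\<^bsub>M\<^esub>}\<rparr>)"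
proof -
  interpret M: module R M by fact
  let ?F = "free_module R S" and ?Q = "free_module R S'"
  interpret F: module R ?F by (rule module_free_module[OF M.is_cring])
  interpret Q: module R ?Q by (rule module_free_module[OF M.is_cring])
  let ?K = "?F\<lparr>carrier := {x \<in> carrier ?F. \<rho> x = \<zero>\<^bsub>M\<^esub>}\<rparr>"
  have K: "module R ?K" by (rule module_kernel[OF F.module_axioms M \<rho>])
  define p where "p x = x \<oplus>\<^bsub>?F\<^esub> (\<ominus>\<^bsub>R\<^esub> \<one>\<^bsub>R\<^esub>) \<odot>\<^bsub>?F\<^esub> E x" for x
  note E_simps = mod_hom_closed[OF E] mod_hom_add[OF E] mod_hom_smult[OF E]
  have p: "p \<in> mod_hom R ?F ?K"
    unfolding mod_hom_def
  proof (intro CollectI conjI ballI funcsetI)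
    fix x assume x: "x \<in> carrier ?F"
    then have "\<rho> (p x) = \<rho> x \<oplus>\<^bsub>M\<^esub> (\<ominus>\<^bsub>R\<^esub> \<one>\<^bsub>R\<^esub>) \<odot>\<^bsub>M\<^esub> \<rho> x"
      unfolding p_def using E_simps(1)[OF x]
      by (subst mod_hom_add[OF \<rho>])
        (auto simp: mod_hom_smult[OF \<rho>] \<rho>E simp del: free_module_simps intro!: F.smult_closed)
    then have "\<rho> (p x) = \<zero>\<^bsub>M\<^esub>"
      using mod_hom_closed[OF \<rho> x] by (simp add: M.smult_l_minus M.r_neg)
    moreover have "p x \<in> carrier ?F"
      unfolding p_def using E_simps(1)[OF x] x by (intro F.a_closed F.smult_closed) auto
    ultimately show "p x \<in> carrier ?K" by simp
  next
    fix x y assume x: "x \<in> carrier ?F" and y: "y \<in> carrier ?F"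
    have "p (x \<oplus>\<^bsub>?F\<^esub> y) = p x \<oplus>\<^bsub>?F\<^esub> p y"
      unfolding p_def using x y E_simps(1)[OF x] E_simps(1)[OF y]
      by (simp only: E_simps F.smult_r_distr M.R.a_inv_closed M.R.one_closed F.smult_closed F.a_ac F.a_closed)
    then show "p (x \<oplus>\<^bsub>?F\<^esub> y) = p x \<oplus>\<^bsub>?K\<^esub> p y" by simp
  next
    fix a x assume a: "a \<in> carrier R" and x: "x \<in> carrier ?F"
    have "p (a \<odot>\<^bsub>?F\<^esub> x) = a \<odot>\<^bsub>?F\<^esub> p x"
      unfolding p_def using a x E_simps(1)[OF x]
      by (simp only: E_simps F.smult_r_distr M.R.a_inv_closed M.R.one_closed F.smult_closed
          F.smult_assoc1[symmetric] M.R.m_comm)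
    then show "p (a \<odot>\<^bsub>?F\<^esub> x) = a \<odot>\<^bsub>?K\<^esub> p x" by simp
  qed
  have DK: "D \<in> mod_hom R ?Q ?K"
    using D \<rho>D mod_hom_closed[OF D] by (auto simp: mod_hom_def)
  define q where "q x = inv_into (carrier ?Q) D (E x)" for x
  have Dq: "D (q x) = E x" and q_closed: "q x \<in> carrier ?Q" if "x \<in> carrier ?K" for x
    using that ED[of x] by (auto simp: q_def f_inv_into_f intro: inv_into_into)
  have q: "q \<in> mod_hom R ?K ?Q"
    unfolding mod_hom_def
  proof (intro CollectI conjI ballI funcsetI q_closed)
    fix x y assume x: "x \<in> carrier ?K" and y: "y \<in> carrier ?K"
    have xy: "x \<oplus>\<^bsub>?K\<^esub> y \<in> carrier ?K" using K x y by (simp only: module.axioms abelian_groupE)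
    show "q (x \<oplus>\<^bsub>?K\<^esub> y) = q x \<oplus>\<^bsub>?Q\<^esub> q y"
    proof (rule inj_onD[OF inj])
      have "D (q x \<oplus>\<^bsub>?Q\<^esub> q y) = E x \<oplus>\<^bsub>?F\<^esub> E y"
        by (simp only: mod_hom_add[OF D] q_closed x y Dq)
      also have "\<dots> = E (x \<oplus>\<^bsub>?F\<^esub> y)" using x y by (subst mod_hom_add[OF E]) auto
      finally show "D (q (x \<oplus>\<^bsub>?K\<^esub> y)) = D (q x \<oplus>\<^bsub>?Q\<^esub> q y)" using Dq[OF xy] by simp
      show "q x \<oplus>\<^bsub>?Q\<^esub> q y \<in> carrier ?Q" by (intro Q.a_closed q_closed x y)
    qed (rule q_closed[OF xy])
  next
    fix a x assume a: "a \<in> carrier R" and x: "x \<in> carrier ?K"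
    have ax: "a \<odot>\<^bsub>?K\<^esub> x \<in> carrier ?K" by (rule module.smult_closed[OF K a x])
    show "q (a \<odot>\<^bsub>?K\<^esub> x) = a \<odot>\<^bsub>?Q\<^esub> q x"
    proof (rule inj_onD[OF inj])
      have "D (a \<odot>\<^bsub>?Q\<^esub> q x) = a \<odot>\<^bsub>?F\<^esub> E x"
        by (simp only: mod_hom_smult[OF D] q_closed a x Dq)
      also have "\<dots> = E (a \<odot>\<^bsub>?F\<^esub> x)" using a x by (subst mod_hom_smult[OF E]) auto
      finally show "D (q (a \<odot>\<^bsub>?K\<^esub> x)) = D (a \<odot>\<^bsub>?Q\<^esub> q x)" using Dq[OF ax] by simp
      show "a \<odot>\<^bsub>?Q\<^esub> q x \<in> carrier ?Q" by (intro Q.smult_closed q_closed x a)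
    qed (rule q_closed[OF ax])
  qed
  have lift: "\<exists>h\<in>mod_hom R ?K A. \<forall>x\<in>carrier ?K. g (h x) = f x"
    if A: "module R A" and B: "module R B" and g: "g \<in> mod_hom R A B" "g ` carrier A = carrier B"
      and f: "f \<in> mod_hom R ?K B" for A B :: "('a, ('a \<times> ('s \<Rightarrow> 'a)) list) module" and g f
  proof -
    obtain h1 where h1: "h1 \<in> mod_hom R ?F A" "\<forall>x\<in>carrier ?F. g (h1 x) = f (p x)"
      using free_module_lift[OF A B g mod_hom_comp[OF p f]] by blast
    obtain h2 where h2: "h2 \<in> mod_hom R ?Q A" "\<forall>x\<in>carrier ?Q. g (h2 x) = f (D x)"
      using free_module_lift[OF A B g mod_hom_comp[OF DK f]] by blast
    have incl: "(\<lambda>x. x) \<in> mod_hom R ?K ?F" by (auto simp: mod_hom_def)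
    \<comment> \<open>As \<open>x = p x + D (q x)\<close>, the map \<open>f\<close> is a sum of two
      maps factoring through free modules, and each summand is lifted there.\<close>
    have h: "(\<lambda>x. h1 x \<oplus>\<^bsub>A\<^esub> h2 (q x)) \<in> mod_hom R ?K A"
      by (rule mod_hom_plus[OF A mod_hom_comp[OF incl h1(1)] mod_hom_comp[OF q h2(1)]])
    have "g (h1 x \<oplus>\<^bsub>A\<^esub> h2 (q x)) = f x" if x: "x \<in> carrier ?K" for x
    proof -
      have xF: "x \<in> carrier ?F" using x by simp
      have "g (h1 x \<oplus>\<^bsub>A\<^esub> h2 (q x)) = f (p x) \<oplus>\<^bsub>B\<^esub> f (D (q x))"
        using h1(2) h2(2) xF q_closed[OF x]
        by (simp add: mod_hom_add[OF g(1)] mod_hom_closed[OF h1(1)] mod_hom_closed[OF h2(1)])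
      also have "\<dots> = f (p x \<oplus>\<^bsub>?K\<^esub> D (q x))"
        using mod_hom_add[OF f mod_hom_closed[OF p xF] mod_hom_closed[OF DK q_closed[OF x]]] by simp
      also have "p x \<oplus>\<^bsub>?K\<^esub> D (q x) = x"
      proof -
        have cl: "x s \<in> carrier R" "E x s \<in> carrier R" for s
          using xF E_simps(1)[OF xF] by (auto simp: carrier_free_module)
        show ?thesis
          unfolding Dq[OF x] p_def using cl
          by (simp add: fun_eq_iff M.R.l_minus M.R.a_assoc M.R.l_neg)
      qed
      finally show ?thesis .
    qed
    then show ?thesis using h by (intro bexI[of _ "\<lambda>x. h1 x \<oplus>\<^bsub>A\<^esub> h2 (q x)"] ballI)
  qed
  from K lift show ?thesis by (rule projective_moduleI)
qed

text \<open>The list is padded so that its length encodes the lengths of the pieces.\<close>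

lemma ex_inj_flatten: "\<exists>f :: 'x list list \<Rightarrow> 'x list. inj f"
proof -
  define code :: "'x list list \<Rightarrow> nat"
    where "code xss = prod_encode (list_encode (map length xss), length (concat xss))" for xss
  \<comment> \<open>Only the length of the padding carries information, so this works even over a
    one-element type. The code is at least the length of the concatenation, hence it can be realised
    as the total length.\<close>
  define f :: "'x list list \<Rightarrow> 'x list"
    where "f xss = concat xss @ replicate (code xss - length (concat xss)) undefined" for xss
  have len: "length (f xss) = code xss" for xss
    using le_prod_encode_2[of "length (concat xss)" "list_encode (map length xss)"]
    by (simp add: f_def code_def del: length_concat)
  have "xss = yss" if eq: "f xss = f yss" for xss yss
  proof -
    have c: "code xss = code yss" using len eq by metis
    then have l: "map length xss = map length yss" "length (concat xss) = length (concat yss)"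
      by (simp_all add: code_def list_encode_eq del: length_concat)
    then have "concat xss = concat yss" using eq c by (simp add: f_def del: length_concat)
    moreover have "\<forall>(x, y) \<in> set (zip xss yss). length x = length y"
    proof safe
      fix x y assume "(x, y) \<in> set (zip xss yss)"
      then obtain i where "i < length xss" "i < length yss" "x = xss ! i" "y = yss ! i"
        by (auto simp: set_zip)
      then show "length x = length y" using arg_cong[OF l(1), of "\<lambda>ns. ns ! i"] by simp
    qed
    ultimately show ?thesis using map_eq_imp_length_eq[OF l(1)] by (intro concat_injective)
  qed
  then show ?thesis by (auto simp: inj_def)
qed

text \<open>\<open>projective_dimension\<close> admits only resolutions with elements of type
  \<open>('a \<times> 'm) list\<close>, so the free cover must be coded there. A finitely supported
  function becomes a list of pairs of coefficient and index, which is flattened twice; the second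
  components of the final list are a dummy.\<close>

lemma ex_inj_free_module:
  fixes R :: "('a, 'k) ring_scheme" and \<iota> :: "'s \<Rightarrow> 'a list list"
  assumes \<iota>: "inj_on \<iota> S"
  shows "\<exists>\<Phi> :: ('s \<Rightarrow> 'a) \<Rightarrow> ('a \<times> 'm) list. inj_on \<Phi> (carrier (free_module R S))"
proof -
  obtain f :: "'a list list list \<Rightarrow> 'a list list" where f: "inj f" using ex_inj_flatten by blast
  obtain g :: "'a list list \<Rightarrow> 'a list" where g: "inj g" using ex_inj_flatten by blast
  define supp :: "('s \<Rightarrow> 'a) \<Rightarrow> 's list" where "supp c = (SOME ps. set ps = {s. c s \<noteq> \<zero>\<^bsub>R\<^esub>})" for c
  have set_supp: "set (supp c) = {s. c s \<noteq> \<zero>\<^bsub>R\<^esub>}" if "c \<in> carrier (free_module R S)" for c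
    unfolding supp_def by (rule someI_ex, rule finite_list) (use that in \<open>simp add: carrier_free_module\<close>)
  \<comment> \<open>The coefficient is stored as a singleton in front of the coded index. Only the
    set of entries is used for decoding, so the arbitrary order of the support does no harm.\<close>
  define e :: "('s \<Rightarrow> 'a) \<Rightarrow> 'a list list list" where "e c = map (\<lambda>s. [c s] # \<iota> s) (supp c)" for c
  have "inj_on e (carrier (free_module R S))"
  proof (rule inj_onI, rule ext)
    fix c d s assume *: "c \<in> carrier (free_module R S)" "d \<in> carrier (free_module R S)" "e c = e d"
    let ?G = "\<lambda>c. (\<lambda>s. [c s] # \<iota> s) ` {s. c s \<noteq> \<zero>\<^bsub>R\<^esub>}"
    have "set (e c) = ?G c" "set (e d) = ?G d"
      using set_supp[OF *(1)] set_supp[OF *(2)] by (simp_all add: e_def)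
    then have G: "?G c = ?G d" using *(3) by simp
    have le: "c t = d t"
      if "?G c = ?G d" "c t \<noteq> \<zero>\<^bsub>R\<^esub>" "c \<in> carrier (free_module R S)" "d \<in> carrier (free_module R S)"
      for c d :: "'s \<Rightarrow> 'a" and t
    proof -
      have "[c t] # \<iota> t \<in> ?G d" using that(2) unfolding that(1)[symmetric] by blast
      then obtain t' where "c t = d t'" "\<iota> t = \<iota> t'" "d t' \<noteq> \<zero>\<^bsub>R\<^esub>" by auto
      moreover from this have "t = t'"
        using inj_onD[OF \<iota>, of t t'] that(2-4) by (simp add: carrier_free_module subset_iff)
      ultimately show ?thesis by simp
    qed
    show "c s = d s"
      using le[OF G _ *(1,2), of s] le[OF G[symmetric] _ *(2,1), of s] by metis
  qed
  then have "inj_on (\<lambda>c. map (\<lambda>a. (a, undefined)) (g (f (e c)))) (carrier (free_module R S))"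
    unfolding inj_on_def by (simp add: inj_map_eq_map inj_def inj_eq[OF f] inj_eq[OF g])
  then show ?thesis by blast
qed

text \<open>The free module and the kernel are the terms in degrees 0 and 1; all later terms are
  zero modules on the one-element set \<open>{[]}\<close>.\<close>

lemma projective_dimension_le_one:
  fixes M :: "('a, 'm, 'c) module_scheme" and S :: "'s set" and \<Phi> :: "('s \<Rightarrow> 'a) \<Rightarrow> ('a \<times> 'm) list"
  assumes M: "module R M" and \<rho>: "\<rho> \<in> mod_hom R (free_module R S) M"
    and surj: "\<rho> ` carrier (free_module R S) = carrier M"
    and \<Phi>: "inj_on \<Phi> (carrier (free_module R S))"
    and K: "projective_module R
      ((free_module R S)\<lparr>carrier := {x \<in> carrier (free_module R S). \<rho> x = \<zero>\<^bsub>M\<^esub>}\<rparr>)"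
  shows "projective_dimension R M \<le> 1"
proof -
  interpret M: module R M by fact
  let ?F = "free_module R S"
  let ?ker = "{x \<in> carrier ?F. \<rho> x = \<zero>\<^bsub>M\<^esub>}"
  let ?K = "?F\<lparr>carrier := ?ker\<rparr>"
  have \<Phi>K: "inj_on \<Phi> (carrier ?K)" using \<Phi> by (rule inj_on_subset) auto
  have F: "projective_module R ?F" by (rule projective_free_module[OF M.is_cring])
  have modF: "module R ?F" and modK: "module R ?K" using F K by (auto simp: projective_module_def)
  have carrier_T: "carrier (transport_module \<Phi> N) = \<Phi> ` carrier N" for N :: "('a, 's \<Rightarrow> 'a) module"
    by (simp add: transport_module_def Let_def)
  have zero_T: "\<zero>\<^bsub>transport_module \<Phi> N\<^esub> = \<Phi> \<zero>\<^bsub>N\<^esub>" for N :: "('a, 's \<Rightarrow> 'a) module"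
    by (simp add: transport_module_def Let_def)
  let ?Z = "transport_module (\<lambda>_. []) (free_module R ({} :: 's set)) :: ('a, ('a \<times> 'm) list) module"
  have carrier_0: "carrier (free_module R ({} :: 's set)) = {\<lambda>_. \<zero>\<^bsub>R\<^esub>}"
    by (auto simp: carrier_free_module)
  have carrier_Z: "carrier ?Z = {[]}" and zero_Z: "\<zero>\<^bsub>?Z\<^esub> = []"
    by (simp_all add: transport_module_def Let_def carrier_0)
  define P where "P i = (if i = 0 then transport_module \<Phi> ?F else if i = 1 then transport_module \<Phi> ?K else ?Z)"
    for i :: nat
  have P_simps: "P 0 = transport_module \<Phi> ?F" "P 1 = transport_module \<Phi> ?K" "P (Suc 0) = transport_module \<Phi> ?K"
    "P (Suc (Suc i)) = ?Z" for i by (simp_all add: P_def)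
  have proj: "projective_module R (P i)" for i
    using projective_transport[OF F \<Phi>] projective_transport[OF K \<Phi>K]
      projective_transport[OF projective_free_module[OF M.is_cring, of "{} :: 's set"], of "\<lambda>_. [] :: ('a \<times> 'm) list"] carrier_0
    by (simp add: P_def)
  then have modP: "module R (P i)" for i by (simp add: projective_module_def)
  define \<epsilon> where "\<epsilon> x = \<rho> (inv_into (carrier ?F) \<Phi> x)" for x
  \<comment> \<open>Free module and kernel are copied along the same \<open>\<Phi>\<close>, so the
    inclusion of the kernel acts as the identity on codes.\<close>
  define d where "d i x = (if i = 0 then \<Phi> (inv_into (carrier ?K) \<Phi> x) else \<zero>\<^bsub>P i\<^esub>)" for i :: nat and x
  have incl: "(\<lambda>x. x) \<in> mod_hom R ?K ?F" by (auto simp: mod_hom_def)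
  have \<epsilon>: "\<epsilon> \<in> mod_hom R (P 0) M"
    unfolding \<epsilon>_def[abs_def] P_simps by (rule mod_hom_comp[OF transport_inv_hom[OF modF \<Phi>] \<rho>])
  have d0: "d 0 \<in> mod_hom R (P (Suc 0)) (P 0)"
    unfolding d_def[abs_def] P_simps
    using mod_hom_comp[OF mod_hom_comp[OF transport_inv_hom[OF modK \<Phi>K] incl] transport_hom[OF modF \<Phi>]]
    by simp
  have d: "d i \<in> mod_hom R (P (Suc i)) (P i)" for i
  proof (cases i)
    case 0
    then show ?thesis using d0 by simp
  next
    case (Suc j)
    interpret N: module R "P (Suc j)" by (rule modP)
    show ?thesis
      using Suc N.zero_closed N.l_zero[OF N.zero_closed] N.smult_r_null by (simp add: mod_hom_def d_def)
  qed
  have d0_\<Phi>: "d 0 (\<Phi> x) = \<Phi> x" if "x \<in> ?ker" for x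
    using inv_into_f_f[OF \<Phi>K, of x] that by (simp add: d_def)
  have \<epsilon>_\<Phi>: "\<epsilon> (\<Phi> x) = \<rho> x" if "x \<in> carrier ?F" for x
    using inv_into_f_f[OF \<Phi> that] by (simp add: \<epsilon>_def)
  have zero_ker: "(\<lambda>_. \<zero>\<^bsub>R\<^esub>) \<in> ?ker"
    using abelian_monoid.zero_closed[of ?K] modK by (auto simp: module_def abelian_group_def)
  have exact: "d (Suc i) ` carrier (P (Suc (Suc i))) = {x \<in> carrier (P (Suc i)). d i x = \<zero>\<^bsub>P i\<^esub>}" for i
  proof (cases i)
    case 0
    have "x = (\<lambda>_. \<zero>\<^bsub>R\<^esub>)" if "x \<in> ?ker" "\<Phi> x = \<Phi> (\<lambda>_. \<zero>\<^bsub>R\<^esub>)" for x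
      using inj_onD[OF \<Phi>, of x "\<lambda>_. \<zero>\<^bsub>R\<^esub>"] that zero_ker by blast
    then have "{x \<in> \<Phi> ` ?ker. d 0 x = \<Phi> (\<lambda>_. \<zero>\<^bsub>R\<^esub>)} = {\<Phi> (\<lambda>_. \<zero>\<^bsub>R\<^esub>)}"
      using zero_ker by (auto simp: d0_\<Phi>)
    moreover have "d (Suc 0) x = \<Phi> (\<lambda>_. \<zero>\<^bsub>R\<^esub>)" for x by (simp add: d_def P_simps zero_T)
    ultimately show ?thesis using 0 by (simp add: P_simps carrier_Z carrier_T zero_T)
  next
    case (Suc j)
    then show ?thesis by (auto simp: P_simps carrier_Z zero_Z d_def)
  qed
  have "projective_resolution R M P d \<epsilon>"
    unfolding projective_resolution_def
  proof (intro conjI allI proj d \<epsilon> exact)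
    have "\<epsilon> ` carrier (P 0) = \<rho> ` carrier ?F"
      by (auto simp: P_simps carrier_T image_image \<epsilon>_\<Phi> intro!: image_cong)
    then show "\<epsilon> ` carrier (P 0) = carrier M" using surj by simp
    show "d 0 ` carrier (P 1) = {x \<in> carrier (P 0). \<epsilon> x = \<zero>\<^bsub>M\<^esub>}"
      by (auto simp: P_simps carrier_T d0_\<Phi> \<epsilon>_\<Phi> image_iff)
  qed
  moreover have "carrier (P i) = {\<zero>\<^bsub>P i\<^esub>}" if "i > 1" for i
    using that by (simp add: P_def carrier_Z zero_Z)
  ultimately have "projective_dimension R M \<le> enat 1"
    unfolding projective_dimension_def by (intro Inf_lower) blast
  then show ?thesis by (simp add: one_enat_def)
qed

section \<open>Ideals that become trivial under the epimorphism\<close>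

locale flat_epi = ring_hom_cring R U u
  for R :: "('a, 'k) ring_scheme" (structure) and U :: "('b, 'l) ring_scheme" and u :: "'a \<Rightarrow> 'b" +
  assumes flat_epi: "flat_epimorphism R U u"

text \<open>Testing the unit expresses \<open>I U = U\<close> inside \<open>U\<close>, so that
  intersections and larger ideals can be handled without tensor products.\<close>

definition dense_ideal :: "('a, 'k) ring_scheme \<Rightarrow> ('b, 'l) ring_scheme \<Rightarrow> ('a \<Rightarrow> 'b) \<Rightarrow> 'a set \<Rightarrow> bool" where
  "dense_ideal R U u I \<longleftrightarrow> ideal I R \<and> \<one>\<^bsub>U\<^esub> \<in> Idl\<^bsub>U\<^esub> (u ` I)"

lemma pure_tensor_zero:
  assumes M: "module R M" and N: "module R N"
  shows "y \<in> carrier N \<Longrightarrow> pure_tensor R M N \<zero>\<^bsub>M\<^esub> y = \<one>\<^bsub>tensor R M N\<^esub>"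
    and "x \<in> carrier M \<Longrightarrow> pure_tensor R M N x \<zero>\<^bsub>N\<^esub> = \<one>\<^bsub>tensor R M N\<^esub>"
proof -
  interpret M: module R M by fact
  interpret N: module R N by fact
  interpret T: comm_group "tensor R M N" by (rule comm_group_tensor[OF M N])
  note cl = pure_tensor_closed[OF M N] and bal = balanced_pure_tensor[OF M N, unfolded balanced_def]
  show "pure_tensor R M N \<zero>\<^bsub>M\<^esub> y = \<one>\<^bsub>tensor R M N\<^esub>" if y: "y \<in> carrier N"
  proof -
    have "pure_tensor R M N (\<zero>\<^bsub>M\<^esub> \<oplus>\<^bsub>M\<^esub> \<zero>\<^bsub>M\<^esub>) y
        = pure_tensor R M N \<zero>\<^bsub>M\<^esub> y \<otimes>\<^bsub>tensor R M N\<^esub> pure_tensor R M N \<zero>\<^bsub>M\<^esub> y"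
      using bal y by blast
    then show ?thesis using T.l_cancel_one' cl[OF _ y, of "\<zero>\<^bsub>M\<^esub>"] by simp
  qed
  show "pure_tensor R M N x \<zero>\<^bsub>N\<^esub> = \<one>\<^bsub>tensor R M N\<^esub>" if x: "x \<in> carrier M"
  proof -
    have "pure_tensor R M N x (\<zero>\<^bsub>N\<^esub> \<oplus>\<^bsub>N\<^esub> \<zero>\<^bsub>N\<^esub>)
        = pure_tensor R M N x \<zero>\<^bsub>N\<^esub> \<otimes>\<^bsub>tensor R M N\<^esub> pure_tensor R M N x \<zero>\<^bsub>N\<^esub>"
      using bal x by blast
    then show ?thesis using T.l_cancel_one' cl[OF x, of "\<zero>\<^bsub>N\<^esub>"] by simp
  qed
qed

lemma trivial_group_tensorI:
  assumes M: "module R M" and N: "module R N"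
    and pure: "\<And>x y. \<lbrakk>x \<in> carrier M; y \<in> carrier N\<rbrakk> \<Longrightarrow> pure_tensor R M N x y = \<one>\<^bsub>tensor R M N\<^esub>"
  shows "trivial_group (tensor R M N)"
proof -
  let ?F = "free_Abelian_group (carrier M \<times> carrier N)" and ?K = "tensor_kernel R M N"
  interpret T: comm_group "tensor R M N" by (rule comm_group_tensor[OF M N])
  interpret F: comm_group ?F by (rule abelian_free_Abelian_group)
  interpret K: normal ?K ?F by (rule tensor_kernel_normal[OF M N])
  have one: "\<one>\<^bsub>tensor R M N\<^esub> = ?K" by (simp add: tensor_def FactGroup_def)
  have frag: "frag_of p \<in> ?K" if "p \<in> carrier M \<times> carrier N" for p
  proof (cases p)
    case (Pair x y)
    then have "?K #>\<^bsub>?F\<^esub> frag_of p = ?K" using pure that one by (simp add: pure_tensor_def)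
    then show ?thesis using F.coset_join1[OF _ _ K.subgroup_axioms] that by simp
  qed
  have "c \<in> ?K" if "Poly_Mapping.keys c \<subseteq> carrier M \<times> carrier N" for c
    using that
  proof (induction rule: frag_induction)
    case zero
    then show ?case using K.one_closed by simp
  next
    case (one x)
    then show ?case by (rule frag)
  next
    case (diff a b)
    have "b \<in> carrier ?F" using diff(2) K.subset by blast
    then show ?case using K.m_closed[OF diff(1) K.m_inv_closed[OF diff(2)]] by simp
  qed
  then have "?K #>\<^bsub>?F\<^esub> c = ?K" if "c \<in> carrier ?F" for c
    using F.coset_join2[OF that K.subgroup_axioms] that by simp
  then have "carrier (tensor R M N) \<subseteq> {\<one>\<^bsub>tensor R M N\<^esub>}"
    unfolding one by (auto simp: tensor_def FactGroup_def RCOSETS_def)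
  then show ?thesis unfolding trivial_group_def using T.is_group by blast
qed

text \<open>Chosen representatives replace cosets, so that the quotient keeps the element type of
  \<open>M\<close> and can be moved into the type of the test modules for flatness. Congruent
  elements select from the same set and therefore get the same representative.\<close>

lemma ex_quotient_module:
  fixes M :: "('a, 'm, 'c) module_scheme"
  assumes M: "module R M" and H: "submodule H R M"
  shows "\<exists>(N :: ('a, 'm) module) \<pi>. module R N \<and> \<pi> \<in> mod_hom R M N \<and>
    (\<forall>x\<in>carrier M. \<pi> x = \<zero>\<^bsub>N\<^esub> \<longleftrightarrow> x \<in> H)"
proof -
  interpret M: module R M by fact
  note H = M.submoduleE[OF H]
  have H0: "\<zero>\<^bsub>M\<^esub> \<in> H" using H(1,2,3,5) M.r_neg by (metis equals0I subsetD)
  define \<kappa> where "\<kappa> x = (SOME y. y \<in> carrier M \<and> x \<ominus>\<^bsub>M\<^esub> y \<in> H)" for x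
  have \<kappa>: "\<kappa> x \<in> carrier M" "x \<ominus>\<^bsub>M\<^esub> \<kappa> x \<in> H" if "x \<in> carrier M" for x
    using someI[of "\<lambda>y. y \<in> carrier M \<and> x \<ominus>\<^bsub>M\<^esub> y \<in> H" x] that H0
    by (auto simp: \<kappa>_def M.minus_eq M.r_neg)
  have sym: "y \<ominus>\<^bsub>M\<^esub> x \<in> H" if "x \<ominus>\<^bsub>M\<^esub> y \<in> H" "x \<in> carrier M" "y \<in> carrier M" for x y
    using H(3)[OF that(1)] that(2,3) by (simp add: M.minus_eq M.minus_add M.a_comm)
  have trans: "x \<ominus>\<^bsub>M\<^esub> z \<in> H" if "x \<ominus>\<^bsub>M\<^esub> y \<in> H" "y \<ominus>\<^bsub>M\<^esub> z \<in> H"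
    "x \<in> carrier M" "y \<in> carrier M" "z \<in> carrier M" for x y z
  proof -
    have "(x \<ominus>\<^bsub>M\<^esub> y) \<oplus>\<^bsub>M\<^esub> (y \<ominus>\<^bsub>M\<^esub> z) = x \<ominus>\<^bsub>M\<^esub> z"
      using that(3-5) by (simp add: M.minus_eq M.a_assoc M.r_neg2 M.r_neg1)
    then show ?thesis using H(5)[OF that(1,2)] by simp
  qed
  have \<kappa>_eq: "\<kappa> x = \<kappa> y \<longleftrightarrow> x \<ominus>\<^bsub>M\<^esub> y \<in> H" if x: "x \<in> carrier M" and y: "y \<in> carrier M" for x y
  proof
    assume "\<kappa> x = \<kappa> y"
    then show "x \<ominus>\<^bsub>M\<^esub> y \<in> H" using trans[of x "\<kappa> x" y] sym[OF \<kappa>(2)[OF y]] \<kappa>[OF x] \<kappa>[OF y] x y by simp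
  next
    assume "x \<ominus>\<^bsub>M\<^esub> y \<in> H"
    then have "x \<ominus>\<^bsub>M\<^esub> z \<in> H \<longleftrightarrow> y \<ominus>\<^bsub>M\<^esub> z \<in> H" if "z \<in> carrier M" for z
      using trans sym x y that by blast
    then show "\<kappa> x = \<kappa> y" unfolding \<kappa>_def by (metis (no_types, lifting))
  qed
  have add: "\<kappa> (x \<oplus>\<^bsub>M\<^esub> y) = \<kappa> (x' \<oplus>\<^bsub>M\<^esub> y')" if "\<kappa> x = \<kappa> x'" "\<kappa> y = \<kappa> y'"
    and cl: "x \<in> carrier M" "x' \<in> carrier M" "y \<in> carrier M" "y' \<in> carrier M" for x x' y y'
  proof -
    have "(x \<ominus>\<^bsub>M\<^esub> x') \<oplus>\<^bsub>M\<^esub> (y \<ominus>\<^bsub>M\<^esub> y') \<in> H" using that \<kappa>_eq by (intro H(5)) auto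
    also have "(x \<ominus>\<^bsub>M\<^esub> x') \<oplus>\<^bsub>M\<^esub> (y \<ominus>\<^bsub>M\<^esub> y') = (x \<oplus>\<^bsub>M\<^esub> y) \<ominus>\<^bsub>M\<^esub> (x' \<oplus>\<^bsub>M\<^esub> y')"
      using cl by (simp add: M.minus_eq M.minus_add M.a_ac)
    finally show ?thesis using \<kappa>_eq cl by simp
  qed
  have smult: "\<kappa> (a \<odot>\<^bsub>M\<^esub> x) = \<kappa> (a \<odot>\<^bsub>M\<^esub> x')" if "\<kappa> x = \<kappa> x'"
    and cl: "a \<in> carrier R" "x \<in> carrier M" "x' \<in> carrier M" for a x x'
  proof -
    have "a \<odot>\<^bsub>M\<^esub> (x \<ominus>\<^bsub>M\<^esub> x') \<in> H" using that \<kappa>_eq by (intro H(4)) auto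
    then show ?thesis using \<kappa>_eq cl by (simp add: M.minus_eq M.smult_r_distr M.smult_r_minus)
  qed
  have \<kappa>\<kappa>: "\<kappa> (\<kappa> x) = \<kappa> x" if "x \<in> carrier M" for x
    using \<kappa>_eq \<kappa> sym that by simp
  define N :: "('a, 'm) module" where "N = \<lparr>carrier = \<kappa> ` carrier M, monoid.mult = undefined, one = undefined,
    ring.zero = \<kappa> \<zero>\<^bsub>M\<^esub>, add = (\<lambda>x y. \<kappa> (x \<oplus>\<^bsub>M\<^esub> y)), module.smult = (\<lambda>a x. \<kappa> (a \<odot>\<^bsub>M\<^esub> x))\<rparr>"
  have N: "carrier N = \<kappa> ` carrier M" "\<zero>\<^bsub>N\<^esub> = \<kappa> \<zero>\<^bsub>M\<^esub>" by (simp_all add: N_def)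
  have N_add: "\<kappa> x \<oplus>\<^bsub>N\<^esub> \<kappa> y = \<kappa> (x \<oplus>\<^bsub>M\<^esub> y)" if "x \<in> carrier M" "y \<in> carrier M" for x y
    using that add[OF \<kappa>\<kappa> \<kappa>\<kappa>] \<kappa>(1) by (simp add: N_def)
  have N_smult: "a \<odot>\<^bsub>N\<^esub> \<kappa> x = \<kappa> (a \<odot>\<^bsub>M\<^esub> x)" if "a \<in> carrier R" "x \<in> carrier M" for a x
    using that smult[OF \<kappa>\<kappa>] \<kappa>(1) by (simp add: N_def)
  have "\<exists>y\<in>carrier N. y \<oplus>\<^bsub>N\<^esub> x = \<zero>\<^bsub>N\<^esub>" if "x \<in> carrier N" for x
  proof -
    obtain z where "z \<in> carrier M" "x = \<kappa> z" using \<open>x \<in> carrier N\<close> N by auto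
    then have "\<kappa> (\<ominus>\<^bsub>M\<^esub> z) \<in> carrier N" "\<kappa> (\<ominus>\<^bsub>M\<^esub> z) \<oplus>\<^bsub>N\<^esub> x = \<zero>\<^bsub>N\<^esub>"
      by (simp_all add: N N_add M.l_neg)
    then show ?thesis by blast
  qed
  then have "abelian_group N"
    by (intro abelian_groupI) (auto simp: N N_add M.a_ac)
  then have "module R N"
    by (intro moduleI M.is_cring) (auto simp: N N_add N_smult M.smult_l_distr M.smult_r_distr M.smult_assoc1)
  moreover have "\<kappa> \<in> mod_hom R M N" by (auto simp: mod_hom_def N N_add N_smult)
  moreover have "\<forall>x\<in>carrier M. \<kappa> x = \<zero>\<^bsub>N\<^esub> \<longleftrightarrow> x \<in> H"
  proof -
    have "\<ominus>\<^bsub>M\<^esub> \<zero>\<^bsub>M\<^esub> = \<zero>\<^bsub>M\<^esub>"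
      using M.l_zero[of "\<ominus>\<^bsub>M\<^esub> \<zero>\<^bsub>M\<^esub>"] M.r_neg[of "\<zero>\<^bsub>M\<^esub>"] by (metis M.zero_closed M.a_inv_closed)
    then have "x \<ominus>\<^bsub>M\<^esub> \<zero>\<^bsub>M\<^esub> = x" if "x \<in> carrier M" for x
      using M.r_zero[OF that] unfolding M.minus_eq by metis
    then show ?thesis by (simp add: N \<kappa>_eq)
  qed
  ultimately show ?thesis by blast
qed

section \<open>Dense ideals, flatness and the epimorphism property\<close>

context flat_epi
begin

abbreviation "U' \<equiv> restrict_scalars U u"

abbreviation "dense \<equiv> dense_ideal R U u"

lemma module_U': "module R U'"
  by (rule module_restrict_scalars[OF R.is_cring S.is_cring homh])

text \<open>For \<open>a \<in> I\<close> the tensor of \<open>X\<close> with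
  \<open>u a \<otimes> z\<close> equals that of \<open>a X = 0\<close> with \<open>z\<close>. The
  elements of \<open>U\<close> behaving like \<open>u a\<close> here form an ideal of
  \<open>U\<close>, which contains \<open>\<one>\<close> as soon as \<open>I\<close> is
  dense.\<close>

lemma dense_imp_annihilated:
  assumes "dense I"
  shows "I \<in> annihilated_ideals R U u"
proof -
  have I: "ideal I R" and one: "\<one>\<^bsub>U\<^esub> \<in> Idl\<^bsub>U\<^esub> (u ` I)" using assms by (auto simp: dense_ideal_def)
  interpret I: ideal I R by (rule I)
  let ?M = "restrict_scalars (R Quot I) (\<lambda>a. I +> a)"
  have M: "module R ?M"
    by (intro module_restrict_scalars R.is_cring I.quotient_is_cring I.rcos_ring_hom)
  let ?T = "tensor R ?M U'"
  interpret T: comm_group ?T by (rule comm_group_tensor[OF M module_U'])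
  interpret Q: cring "R Quot I" by (rule I.quotient_is_cring[OF R.is_cring])
  note bal = balanced_pure_tensor[OF M module_U', unfolded balanced_def]
  \<comment> \<open>Quantifying over the factor \<open>z\<close> makes \<open>Z\<close> an ideal of
    \<open>U\<close> without putting a \<open>U\<close>-module structure on the tensor
    product.\<close>
  define Z where "Z = {y \<in> carrier U. \<forall>z\<in>carrier U. \<forall>X\<in>carrier ?M. pure_tensor R ?M U' X (y \<otimes>\<^bsub>U\<^esub> z) = \<one>\<^bsub>?T\<^esub>}"
  have "ideal Z U"
  proof (rule S.idealI_smult)
    show "\<zero>\<^bsub>U\<^esub> \<in> Z" using pure_tensor_zero(2)[OF M module_U'] by (simp add: Z_def)
    show "a \<oplus>\<^bsub>U\<^esub> b \<in> Z" if "a \<in> Z" "b \<in> Z" for a b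
    proof -
      have "pure_tensor R ?M U' X (a \<otimes>\<^bsub>U\<^esub> z \<oplus>\<^bsub>U'\<^esub> b \<otimes>\<^bsub>U\<^esub> z) = \<one>\<^bsub>?T\<^esub>"
        if "X \<in> carrier ?M" "z \<in> carrier U" for X z
      proof -
        have "pure_tensor R ?M U' X (a \<otimes>\<^bsub>U\<^esub> z \<oplus>\<^bsub>U'\<^esub> b \<otimes>\<^bsub>U\<^esub> z)
          = pure_tensor R ?M U' X (a \<otimes>\<^bsub>U\<^esub> z) \<otimes>\<^bsub>?T\<^esub> pure_tensor R ?M U' X (b \<otimes>\<^bsub>U\<^esub> z)"
          using bal that \<open>a \<in> Z\<close> \<open>b \<in> Z\<close> by (simp add: Z_def)
        then show ?thesis using that \<open>a \<in> Z\<close> \<open>b \<in> Z\<close> by (simp add: Z_def)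
      qed
      then show ?thesis using that by (auto simp: Z_def S.l_distr)
    qed
    show "x \<otimes>\<^bsub>U\<^esub> a \<in> Z" if "a \<in> Z" "x \<in> carrier U" for a x
      using that by (auto simp: Z_def S.m_assoc S.m_lcomm[of x a])
  qed (auto simp: Z_def)
  moreover have "u a \<in> Z" if a: "a \<in> I" for a
  proof -
    have "pure_tensor R ?M U' X (u a \<otimes>\<^bsub>U\<^esub> z) = \<one>\<^bsub>?T\<^esub>" if X: "X \<in> carrier ?M" and z: "z \<in> carrier U" for X z
    proof -
      have "pure_tensor R ?M U' X (a \<odot>\<^bsub>U'\<^esub> z) = pure_tensor R ?M U' (a \<odot>\<^bsub>?M\<^esub> X) z"
        using bal X z a I.Icarr by (metis restrict_scalars_simps(1))
      also have "a \<odot>\<^bsub>?M\<^esub> X = \<zero>\<^bsub>?M\<^esub>"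
        using X a R.a_rcos_zero[OF I a] Q.l_null by (simp add: FactRing_def)
      finally show ?thesis using pure_tensor_zero(1)[OF M module_U', of z] z by simp
    qed
    then show ?thesis using a I.Icarr by (auto simp: Z_def)
  qed
  ultimately have "Idl\<^bsub>U\<^esub> (u ` I) \<subseteq> Z" by (intro S.genideal_minimal) auto
  then have "\<one>\<^bsub>U\<^esub> \<in> Z" using one by blast
  then have "trivial_group ?T"
    by (intro trivial_group_tensorI[OF M module_U']) (auto simp: Z_def)
  then show ?thesis using I by (simp add: annihilated_ideals_def)
qed

text \<open>By flatness the tensor of \<open>n\<close> with \<open>\<one>\<close> already vanishes
  over the cyclic submodule \<open>R n\<close>. Since \<open>R n\<close> is \<open>R\<close> modulo
  the annihilator, its tensor product with \<open>U\<close> maps to \<open>U\<close> modulo the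
  ideal generated by the annihilator, and there the image of this tensor is the class of
  \<open>\<one>\<close>.\<close>

lemma tensor_one_zero_imp_dense_annihilator:
  fixes N :: "('a, ('a \<times> 'b) list) module"
  assumes N: "module R N" and n: "n \<in> carrier N"
    and zero: "pure_tensor R N U' n \<one>\<^bsub>U\<^esub> = \<one>\<^bsub>tensor R N U'\<^esub>"
  shows "dense {r \<in> carrier R. r \<odot>\<^bsub>N\<^esub> n = \<zero>\<^bsub>N\<^esub>}"
proof -
  interpret N: module R N by fact
  let ?ann = "{r \<in> carrier R. r \<odot>\<^bsub>N\<^esub> n = \<zero>\<^bsub>N\<^esub>}"
  have ann: "ideal ?ann R"
    by (rule R.idealI_smult) (use n in \<open>auto simp: N.smult_l_distr N.smult_assoc1\<close>)
  let ?H = "(\<lambda>r. r \<odot>\<^bsub>N\<^esub> n) ` carrier R"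
  let ?M = "N\<lparr>carrier := ?H\<rparr>"
  have "submodule ?H R N"
  proof (rule N.submoduleI)
    show "?H \<subseteq> carrier N" using n by auto
    have "\<zero>\<^bsub>N\<^esub> = \<zero> \<odot>\<^bsub>N\<^esub> n" using n by simp
    then show "\<zero>\<^bsub>N\<^esub> \<in> ?H" by blast
    show "\<ominus>\<^bsub>N\<^esub> x \<in> ?H" if "x \<in> ?H" for x
      using that n by (auto simp: N.smult_l_minus[symmetric])
    show "x \<oplus>\<^bsub>N\<^esub> y \<in> ?H" if "x \<in> ?H" "y \<in> ?H" for x y
      using that n by (auto simp: N.smult_l_distr[symmetric])
    show "a \<odot>\<^bsub>N\<^esub> x \<in> ?H" if "a \<in> carrier R" "x \<in> ?H" for a x
      using that n by (auto simp: N.smult_assoc1[symmetric])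
  qed
  then have M: "module R ?M" by (rule submodule.submodule_is_module[OF _ N])
  have nM: "n \<in> carrier ?M" using n by (auto intro: image_eqI[of _ _ \<one>])
  let ?i = "tensor_map R ?M U' N U' (\<lambda>x. x) (\<lambda>x. x)"
  have incl: "(\<lambda>x. x) \<in> mod_hom R ?M N" using n by (auto simp: mod_hom_def)
  have idU: "(\<lambda>x. x) \<in> mod_hom R U' U'" by (auto simp: mod_hom_def)
  have inj: "inj_on ?i (carrier (tensor R ?M U'))"
  proof -
    have "flat_module R U'" using flat_epi by (simp add: flat_epimorphism_def)
    from conjunct2[OF this[unfolded flat_module_def], rule_format, of ?M N "\<lambda>x. x"]
    show ?thesis using M N incl by simp
  qed
  have i_pure: "?i (pure_tensor R ?M U' n \<one>\<^bsub>U\<^esub>) = \<one>\<^bsub>tensor R N U'\<^esub>"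
    using tensor_map_pure[OF M module_U' N module_U' incl idU nM] zero by simp
  have hom: "?i \<in> hom (tensor R ?M U') (tensor R N U')"
    by (rule tensor_map_hom[OF M module_U' N module_U' incl idU])
  have grp: "group (tensor R ?M U')" "group (tensor R N U')"
    using comm_group_tensor[OF M module_U'] comm_group_tensor[OF N module_U']
    by (simp_all add: comm_group.axioms)
  have i_one: "?i \<one>\<^bsub>tensor R ?M U'\<^esub> = \<one>\<^bsub>tensor R N U'\<^esub>"
    using Group.hom_one[OF hom grp] .
  have cl: "pure_tensor R ?M U' n \<one>\<^bsub>U\<^esub> \<in> carrier (tensor R ?M U')"
    by (rule pure_tensor_closed[OF M module_U' nM]) simp
  have zeroM: "pure_tensor R ?M U' n \<one>\<^bsub>U\<^esub> = \<one>\<^bsub>tensor R ?M U'\<^esub>"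
    by (rule inj_onD[OF inj _ cl monoid.one_closed[OF group.is_monoid[OF grp(1)]]])
      (simp only: i_pure i_one)

  let ?J = "Idl\<^bsub>U\<^esub> (u ` ?ann)"
  have J: "ideal ?J U" by (rule S.genideal_ideal) auto
  interpret J: ideal ?J U by (rule J)
  interpret Q: cring "U Quot ?J" by (rule J.quotient_is_cring[OF S.is_cring])
  define \<rho> where "\<rho> m = (SOME r. r \<in> carrier R \<and> r \<odot>\<^bsub>N\<^esub> n = m)" for m
  have \<rho>: "\<rho> m \<in> carrier R" "\<rho> m \<odot>\<^bsub>N\<^esub> n = m" if "m \<in> ?H" for m
    using someI_ex[of "\<lambda>r. r \<in> carrier R \<and> r \<odot>\<^bsub>N\<^esub> n = m"] that by (auto simp: \<rho>_def)
  have J_eq: "?J +>\<^bsub>U\<^esub> (u r \<otimes>\<^bsub>U\<^esub> y) = ?J +>\<^bsub>U\<^esub> (u s \<otimes>\<^bsub>U\<^esub> y)"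
    if "r \<in> carrier R" "s \<in> carrier R" "r \<odot>\<^bsub>N\<^esub> n = s \<odot>\<^bsub>N\<^esub> n" "y \<in> carrier U" for r s y
  proof -
    have "r \<ominus> s \<in> ?ann"
      using that n by (simp add: R.minus_eq N.smult_l_distr N.smult_l_minus N.r_neg)
    then have "u (r \<ominus> s) \<in> ?J" using S.genideal_self[of "u ` ?ann"] by auto
    then have "u (r \<ominus> s) \<otimes>\<^bsub>U\<^esub> y \<in> ?J" using that by (intro J.I_r_closed)
    also have "u (r \<ominus> s) \<otimes>\<^bsub>U\<^esub> y = u r \<otimes>\<^bsub>U\<^esub> y \<ominus>\<^bsub>U\<^esub> u s \<otimes>\<^bsub>U\<^esub> y"
      using that by (simp add: R.minus_eq S.minus_eq S.l_distr S.l_minus)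
    finally show ?thesis using S.quotient_eq_iff_same_a_r_cos[OF J] that by simp
  qed
  \<comment> \<open>This is the map \<open>(r n, y) \<mapsto> u r \<otimes> y\<close>. The
    coefficient \<open>r\<close> is chosen by \<open>\<rho>\<close>, and \<open>J_eq\<close> shows
    that the choice does not matter modulo \<open>?J\<close>.\<close>
  define \<beta> where "\<beta> m y = ?J +>\<^bsub>U\<^esub> (u (\<rho> m) \<otimes>\<^bsub>U\<^esub> y)" for m y
  have \<beta>: "\<beta> (r \<odot>\<^bsub>N\<^esub> n) y = ?J +>\<^bsub>U\<^esub> (u r \<otimes>\<^bsub>U\<^esub> y)" if "r \<in> carrier R" "y \<in> carrier U" for r y
    unfolding \<beta>_def using that \<rho>[of "r \<odot>\<^bsub>N\<^esub> n"] by (intro J_eq) auto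
  have add: "(?J +>\<^bsub>U\<^esub> a) \<oplus>\<^bsub>U Quot ?J\<^esub> (?J +>\<^bsub>U\<^esub> b) = ?J +>\<^bsub>U\<^esub> (a \<oplus>\<^bsub>U\<^esub> b)"
    if "a \<in> carrier U" "b \<in> carrier U" for a b
    using J.a_rcos_sum[OF that] by (simp add: FactRing_def)
  have bal: "balanced R ?M U' (add_monoid (U Quot ?J)) \<beta>"
    unfolding balanced_def
  proof (intro conjI ballI)
    fix x y assume "x \<in> carrier ?M" "y \<in> carrier U'"
    then show "\<beta> x y \<in> carrier (add_monoid (U Quot ?J))"
      using ring_hom_closed[OF J.rcos_ring_hom] by (auto simp: \<beta>)
  next
    fix x x' y assume "x \<in> carrier ?M" "x' \<in> carrier ?M" "y \<in> carrier U'"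
    then show "\<beta> (x \<oplus>\<^bsub>?M\<^esub> x') y = \<beta> x y \<otimes>\<^bsub>add_monoid (U Quot ?J)\<^esub> \<beta> x' y"
      using n by (auto simp: \<beta> N.smult_l_distr[symmetric] add S.l_distr)
  next
    fix x y y' assume "x \<in> carrier ?M" "y \<in> carrier U'" "y' \<in> carrier U'"
    then show "\<beta> x (y \<oplus>\<^bsub>U'\<^esub> y') = \<beta> x y \<otimes>\<^bsub>add_monoid (U Quot ?J)\<^esub> \<beta> x y'"
      using n by (auto simp: \<beta> add S.r_distr)
  next
    fix a x y assume "a \<in> carrier R" "x \<in> carrier ?M" "y \<in> carrier U'"
    then show "\<beta> (a \<odot>\<^bsub>?M\<^esub> x) y = \<beta> x (a \<odot>\<^bsub>U'\<^esub> y)"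
      using n by (auto simp: \<beta> N.smult_assoc1[symmetric] S.m_ac)
  qed
  have G: "comm_group (add_monoid (U Quot ?J))" by (rule Q.a_comm_group)
  let ?lift = "tensor_lift ?M U' (add_monoid (U Quot ?J)) \<beta>"
  have "?lift \<one>\<^bsub>tensor R ?M U'\<^esub> = \<one>\<^bsub>add_monoid (U Quot ?J)\<^esub>"
    by (rule Group.hom_one[OF tensor_lift_hom[OF M module_U' G bal] grp(1)])
      (use G in \<open>simp add: comm_group.axioms\<close>)
  moreover have "?lift (pure_tensor R ?M U' n \<one>\<^bsub>U\<^esub>) = \<beta> n \<one>\<^bsub>U\<^esub>"
    by (rule tensor_lift_pure[OF M module_U' G bal nM]) simp
  moreover have "\<beta> n \<one>\<^bsub>U\<^esub> = ?J +>\<^bsub>U\<^esub> \<one>\<^bsub>U\<^esub>" using \<beta>[of \<one> "\<one>\<^bsub>U\<^esub>"] n by simp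
  ultimately have "?J +>\<^bsub>U\<^esub> \<one>\<^bsub>U\<^esub> = ?J" using zeroM by (simp add: FactRing_def)
  then have "\<one>\<^bsub>U\<^esub> \<in> ?J" using J.rcos_const_imp_mem by blast
  then show ?thesis using ann by (simp add: dense_ideal_def)
qed

text \<open>Applied to \<open>R\<close> as a module over itself: the scalar \<open>t\<close> moves
  across the tensor sign, where it becomes \<open>u t = 0\<close>.\<close>

lemma dense_annihilator:
  assumes t: "t \<in> carrier R" "u t = \<zero>\<^bsub>U\<^esub>"
  shows "dense {r \<in> carrier R. r \<otimes> t = \<zero>}"
proof -
  let ?R = "restrict_scalars R (\<lambda>r. r)"
  have modR: "module R ?R"
    by (intro module_restrict_scalars R.is_cring) (auto intro!: ring_hom_memI)
  define \<phi> :: "'a \<Rightarrow> ('a \<times> 'b) list" where "\<phi> r = [(r, undefined)]" for r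
  have inj: "inj_on \<phi> (carrier ?R)" by (simp add: \<phi>_def inj_on_def)
  let ?N = "transport_module \<phi> ?R"
  note N = module_transport[OF modR inj] and \<phi> = transport_hom[OF modR inj]
  have \<phi>_eq: "\<phi> r = \<phi> s \<longleftrightarrow> r = s" for r s by (simp add: \<phi>_def)
  have \<phi>_smult: "r \<odot>\<^bsub>?N\<^esub> \<phi> s = \<phi> (r \<otimes> s)" if "r \<in> carrier R" "s \<in> carrier R" for r s
    using mod_hom_smult[OF \<phi>, of r s] that by simp
  have \<phi>_zero: "\<zero>\<^bsub>?N\<^esub> = \<phi> \<zero>" using mod_hom_zero[OF modR N \<phi>] by simp
  have cl: "\<phi> r \<in> carrier ?N" if "r \<in> carrier R" for r using mod_hom_closed[OF \<phi>] that by simp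
  have "pure_tensor R ?N U' (t \<odot>\<^bsub>?N\<^esub> \<phi> \<one>) \<one>\<^bsub>U\<^esub> = pure_tensor R ?N U' (\<phi> \<one>) (t \<odot>\<^bsub>U'\<^esub> \<one>\<^bsub>U\<^esub>)"
    using balanced_pure_tensor[OF N module_U', unfolded balanced_def] t cl by simp
  also have "t \<odot>\<^bsub>U'\<^esub> \<one>\<^bsub>U\<^esub> = \<zero>\<^bsub>U'\<^esub>" using t by simp
  also have "pure_tensor R ?N U' (\<phi> \<one>) \<zero>\<^bsub>U'\<^esub> = \<one>\<^bsub>tensor R ?N U'\<^esub>"
    by (rule pure_tensor_zero(2)[OF N module_U']) (simp add: cl)
  finally have "dense {r \<in> carrier R. r \<odot>\<^bsub>?N\<^esub> \<phi> t = \<zero>\<^bsub>?N\<^esub>}"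
    using t by (intro tensor_one_zero_imp_dense_annihilator N cl) (simp_all add: \<phi>_smult)
  also have "{r \<in> carrier R. r \<odot>\<^bsub>?N\<^esub> \<phi> t = \<zero>\<^bsub>?N\<^esub>} = {r \<in> carrier R. r \<otimes> t = \<zero>}"
    using t by (auto simp: \<phi>_smult \<phi>_zero \<phi>_eq)
  finally show ?thesis .
qed

text \<open>Injectivity of multiplication gives \<open>x \<otimes> 1 = 1 \<otimes> x\<close> in the
  tensor square of \<open>U\<close>. In the tensor product of \<open>U / u R\<close> with
  \<open>U\<close> the right side vanishes because the class of \<open>1\<close> does, so the class
  of \<open>x\<close> has a dense annihilator, and this annihilator consists of the denominators of
  \<open>x\<close>.\<close>

lemma dense_denominators:
  assumes x: "x \<in> carrier U"
  shows "dense {r \<in> carrier R. u r \<otimes>\<^bsub>U\<^esub> x \<in> u ` carrier R}"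
proof -
  interpret U': module R U' by (rule module_U')
  have "submodule (u ` carrier R) R U'"
  proof (rule U'.submoduleI)
    show "\<ominus>\<^bsub>U'\<^esub> a \<in> u ` carrier R" if "a \<in> u ` carrier R" for a
    proof -
      obtain r where r: "r \<in> carrier R" "a = u r" using \<open>a \<in> u ` carrier R\<close> by blast
      have a: "a \<in> carrier U'" using r by simp
      have "\<ominus>\<^bsub>U'\<^esub> a = (\<ominus> \<one>) \<odot>\<^bsub>U'\<^esub> a"
        unfolding U'.smult_l_minus[OF R.one_closed a] U'.smult_one[OF a] ..
      also have "\<dots> = u (\<ominus> \<one> \<otimes> r)" using r by (simp only: hom_mult R.a_inv_closed R.one_closed restrict_scalars_simps)
      finally show ?thesis using r by blast
    qed
  qed (auto simp flip: hom_add hom_mult hom_zero)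
  from ex_quotient_module[OF module_U' this]
  obtain N1 :: "('a, 'b) module" and \<pi>1 where N1: "module R N1" and \<pi>1: "\<pi>1 \<in> mod_hom R U' N1"
    and ker: "\<forall>x\<in>carrier U'. \<pi>1 x = \<zero>\<^bsub>N1\<^esub> \<longleftrightarrow> x \<in> u ` carrier R" by blast
  define \<phi> :: "'b \<Rightarrow> ('a \<times> 'b) list" where "\<phi> y = [(undefined, y)]" for y
  have \<phi>_eq: "\<phi> r = \<phi> s \<longleftrightarrow> r = s" for r s by (simp add: \<phi>_def)
  have inj: "inj_on \<phi> (carrier N1)" by (simp add: \<phi>_def inj_on_def)
  define N where "N = transport_module \<phi> N1"
  have N: "module R N" and \<phi>: "\<phi> \<in> mod_hom R N1 N"
    using module_transport[OF N1 inj] transport_hom[OF N1 inj] by (simp_all add: N_def)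
  define \<pi> where "\<pi> = (\<lambda>y. \<phi> (\<pi>1 y))"
  have \<pi>: "\<pi> \<in> mod_hom R U' N" unfolding \<pi>_def by (rule mod_hom_comp[OF \<pi>1 \<phi>])
  have ker: "\<pi> y = \<zero>\<^bsub>N\<^esub> \<longleftrightarrow> y \<in> u ` carrier R" if "y \<in> carrier U" for y
    using ker that mod_hom_zero[OF N1 N \<phi>] by (metis \<pi>_def \<phi>_eq restrict_scalars_simps(1))
  let ?m = "tensor_lift U' U' (add_monoid U) (\<lambda>x y. x \<otimes>\<^bsub>U\<^esub> y)"
  have m: "?m (pure_tensor R U' U' a b) = a \<otimes>\<^bsub>U\<^esub> b" if "a \<in> carrier U" "b \<in> carrier U" for a b
    using tensor_lift_pure[OF module_U' module_U' S.a_comm_group balanced_mult[OF R.is_cring S.is_cring homh]]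
      that by simp
  have "inj_on ?m (carrier (tensor R U' U'))"
    using flat_epi by (simp add: flat_epimorphism_def iso_def bij_betw_def)
  then have swap: "pure_tensor R U' U' x \<one>\<^bsub>U\<^esub> = pure_tensor R U' U' \<one>\<^bsub>U\<^esub> x"
    by (rule inj_onD) (use x in \<open>simp_all add: m pure_tensor_closed[OF module_U' module_U']\<close>)
  have idU: "(\<lambda>x. x) \<in> mod_hom R U' U'" by (auto simp: mod_hom_def)
  note t = tensor_map_pure[OF module_U' module_U' N module_U' \<pi> idU]
  have "pure_tensor R N U' (\<pi> x) \<one>\<^bsub>U\<^esub> = pure_tensor R N U' (\<pi> \<one>\<^bsub>U\<^esub>) x"
    using t[of x "\<one>\<^bsub>U\<^esub>"] t[of "\<one>\<^bsub>U\<^esub>" x] x swap by simp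
  also have "\<pi> \<one>\<^bsub>U\<^esub> = \<zero>\<^bsub>N\<^esub>" using ker[of "\<one>\<^bsub>U\<^esub>"] hom_one by (metis S.one_closed R.one_closed imageI)
  also have "pure_tensor R N U' \<zero>\<^bsub>N\<^esub> x = \<one>\<^bsub>tensor R N U'\<^esub>"
    by (rule pure_tensor_zero(1)[OF N module_U']) (simp add: x)
  finally have "dense {r \<in> carrier R. r \<odot>\<^bsub>N\<^esub> \<pi> x = \<zero>\<^bsub>N\<^esub>}"
    using mod_hom_closed[OF \<pi>, of x] x by (intro tensor_one_zero_imp_dense_annihilator N) auto
  also have "{r \<in> carrier R. r \<odot>\<^bsub>N\<^esub> \<pi> x = \<zero>\<^bsub>N\<^esub>} = {r \<in> carrier R. u r \<otimes>\<^bsub>U\<^esub> x \<in> u ` carrier R}"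
  proof -
    have "r \<odot>\<^bsub>N\<^esub> \<pi> x = \<zero>\<^bsub>N\<^esub> \<longleftrightarrow> u r \<otimes>\<^bsub>U\<^esub> x \<in> u ` carrier R" if "r \<in> carrier R" for r
      using mod_hom_smult[OF \<pi> that, of x] ker[of "u r \<otimes>\<^bsub>U\<^esub> x"] x that by simp
    then show ?thesis by blast
  qed
  finally show ?thesis .
qed

lemma dense_superset:
  assumes "dense I" "ideal J R" "I \<subseteq> J"
  shows "dense J"
proof -
  interpret J: ideal J R by fact
  have "Idl\<^bsub>U\<^esub> (u ` I) \<subseteq> Idl\<^bsub>U\<^esub> (u ` J)" using assms(3) by (intro S.subset_Idl_subset) auto
  then show ?thesis using assms by (auto simp: dense_ideal_def)
qed

text \<open>Products of elements of \<open>I\<close> and \<open>J\<close> lie in the intersection.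
  Fixing \<open>a \<in> I\<close> and letting the other factor run through \<open>J\<close> gives
  \<open>u a\<close>; letting \<open>a\<close> vary gives \<open>\<one>\<close>.\<close>

lemma dense_Int:
  assumes "dense I" "dense J"
  shows "dense (I \<inter> J)"
proof -
  interpret I: ideal I R using assms by (simp add: dense_ideal_def)
  interpret J: ideal J R using assms by (simp add: dense_ideal_def)
  have IJ: "ideal (I \<inter> J) R" by (rule R.i_intersect) (rule I.is_ideal J.is_ideal)+
  let ?A = "Idl\<^bsub>U\<^esub> (u ` (I \<inter> J))"
  have "ideal ?A U" by (rule S.genideal_ideal) auto
  then interpret A: ideal ?A U .
  have in_A: "u a \<in> ?A" if a: "a \<in> I" for a
  proof -
    let ?B = "{x \<in> carrier U. u a \<otimes>\<^bsub>U\<^esub> x \<in> ?A}"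
    have "ideal ?B U"
      using a by (intro S.idealI_smult) (auto simp: S.r_distr S.m_lcomm[of "u a"] A.I_l_closed)
    moreover have "u b \<in> ?B" if b: "b \<in> J" for b
    proof -
      have "a \<otimes> b \<in> I \<inter> J" using a b by (auto intro: I.I_r_closed J.I_l_closed)
      moreover have "u ` (I \<inter> J) \<subseteq> ?A" by (rule S.genideal_self) auto
      ultimately have "u (a \<otimes> b) \<in> ?A" by blast
      then show ?thesis using a b by simp
    qed
    ultimately have "Idl\<^bsub>U\<^esub> (u ` J) \<subseteq> ?B" by (intro S.genideal_minimal) auto
    then show ?thesis using assms(2) a by (auto simp: dense_ideal_def)
  qed
  then have "Idl\<^bsub>U\<^esub> (u ` I) \<subseteq> ?A" by (intro S.genideal_minimal) (auto intro: A.is_ideal)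
  then show ?thesis using assms(1) IJ by (auto simp: dense_ideal_def)
qed

lemma dense_carrier: "dense (carrier R)"
proof -
  have "\<one>\<^bsub>U\<^esub> \<in> u ` carrier R" using hom_one by (metis R.one_closed imageI)
  then show ?thesis
    using S.genideal_self[of "u ` carrier R"] R.oneideal by (auto simp: dense_ideal_def)
qed

lemma dense_finite_annihilator:
  assumes "finite X" "X \<subseteq> carrier R" "\<And>t. t \<in> X \<Longrightarrow> u t = \<zero>\<^bsub>U\<^esub>"
  shows "dense {r \<in> carrier R. \<forall>t\<in>X. r \<otimes> t = \<zero>}"
  using assms
proof (induction X rule: finite_induct)
  case empty
  then show ?case using dense_carrier by simp
next
  case (insert t X)
  then have "dense ({r \<in> carrier R. r \<otimes> t = \<zero>} \<inter> {r \<in> carrier R. \<forall>t\<in>X. r \<otimes> t = \<zero>})"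
    by (intro dense_Int dense_annihilator) auto
  also have "{r \<in> carrier R. r \<otimes> t = \<zero>} \<inter> {r \<in> carrier R. \<forall>t\<in>X. r \<otimes> t = \<zero>}
    = {r \<in> carrier R. \<forall>t\<in>insert t X. r \<otimes> t = \<zero>}" by auto
  finally show ?case .
qed

lemma dense_finite_combination:
  assumes "dense I"
  obtains S \<xi> where "finite S" "S \<subseteq> I" "\<And>a. \<xi> a \<in> carrier U"
    "(\<Oplus>\<^bsub>U\<^esub>a\<in>S. u a \<otimes>\<^bsub>U\<^esub> \<xi> a) = \<one>\<^bsub>U\<^esub>"
proof -
  interpret I: ideal I R using assms by (simp add: dense_ideal_def)
  \<comment> \<open>Coefficients vanish outside \<open>S\<close>, so two combinations can be
    extended to a common index set and added.\<close>
  define A where "A = {x. \<exists>S \<xi>. finite S \<and> S \<subseteq> I \<and> (\<forall>a. \<xi> a \<in> carrier U) \<and>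
    (\<forall>a. a \<notin> S \<longrightarrow> \<xi> a = \<zero>\<^bsub>U\<^esub>) \<and> x = (\<Oplus>\<^bsub>U\<^esub>a\<in>S. u a \<otimes>\<^bsub>U\<^esub> \<xi> a)}"
  have uI: "u a \<in> carrier U" if "a \<in> I" for a using that by simp
  have "ideal A U"
  proof (rule S.idealI_smult)
    show "A \<subseteq> carrier U" by (auto simp: A_def intro!: S.finsum_closed)
    show "\<zero>\<^bsub>U\<^esub> \<in> A"
      unfolding A_def by (intro CollectI exI[of _ "{}"] exI[of _ "\<lambda>_. \<zero>\<^bsub>U\<^esub>"]) auto
    show "x \<oplus>\<^bsub>U\<^esub> y \<in> A" if "x \<in> A" "y \<in> A" for x y
    proof -
      obtain S \<xi> where 1: "finite S" "S \<subseteq> I" "\<forall>a. \<xi> a \<in> carrier U"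
        "\<forall>a. a \<notin> S \<longrightarrow> \<xi> a = \<zero>\<^bsub>U\<^esub>" "x = (\<Oplus>\<^bsub>U\<^esub>a\<in>S. u a \<otimes>\<^bsub>U\<^esub> \<xi> a)"
        using \<open>x \<in> A\<close> by (auto simp: A_def)
      obtain T \<eta> where 2: "finite T" "T \<subseteq> I" "\<forall>a. \<eta> a \<in> carrier U"
        "\<forall>a. a \<notin> T \<longrightarrow> \<eta> a = \<zero>\<^bsub>U\<^esub>" "y = (\<Oplus>\<^bsub>U\<^esub>a\<in>T. u a \<otimes>\<^bsub>U\<^esub> \<eta> a)"
        using \<open>y \<in> A\<close> by (auto simp: A_def)
      have ext: "(\<Oplus>\<^bsub>U\<^esub>a\<in>S. u a \<otimes>\<^bsub>U\<^esub> \<xi> a) = (\<Oplus>\<^bsub>U\<^esub>a\<in>S\<union>T. u a \<otimes>\<^bsub>U\<^esub> \<xi> a)"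
        "(\<Oplus>\<^bsub>U\<^esub>a\<in>T. u a \<otimes>\<^bsub>U\<^esub> \<eta> a) = (\<Oplus>\<^bsub>U\<^esub>a\<in>S\<union>T. u a \<otimes>\<^bsub>U\<^esub> \<eta> a)"
        using 1 2 uI by (intro S.add.finprod_mono_neutral_cong_left; auto)+
      have "x \<oplus>\<^bsub>U\<^esub> y = (\<Oplus>\<^bsub>U\<^esub>a\<in>S\<union>T. u a \<otimes>\<^bsub>U\<^esub> \<xi> a \<oplus>\<^bsub>U\<^esub> u a \<otimes>\<^bsub>U\<^esub> \<eta> a)"
        unfolding 1(5) 2(5) ext using 1 2 uI by (intro S.finsum_addf[symmetric]) auto
      also have "\<dots> = (\<Oplus>\<^bsub>U\<^esub>a\<in>S\<union>T. u a \<otimes>\<^bsub>U\<^esub> (\<xi> a \<oplus>\<^bsub>U\<^esub> \<eta> a))"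
        using 1 2 uI by (intro S.finsum_cong') (auto simp: S.r_distr)
      finally show ?thesis
        unfolding A_def using 1 2
        by (intro CollectI exI[of _ "S \<union> T"] exI[of _ "\<lambda>a. \<xi> a \<oplus>\<^bsub>U\<^esub> \<eta> a"]) auto
    qed
    show "z \<otimes>\<^bsub>U\<^esub> x \<in> A" if "x \<in> A" "z \<in> carrier U" for x z
    proof -
      obtain S \<xi> where 1: "finite S" "S \<subseteq> I" "\<forall>a. \<xi> a \<in> carrier U"
        "\<forall>a. a \<notin> S \<longrightarrow> \<xi> a = \<zero>\<^bsub>U\<^esub>" "x = (\<Oplus>\<^bsub>U\<^esub>a\<in>S. u a \<otimes>\<^bsub>U\<^esub> \<xi> a)"
        using \<open>x \<in> A\<close> by (auto simp: A_def)
      have "z \<otimes>\<^bsub>U\<^esub> x = (\<Oplus>\<^bsub>U\<^esub>a\<in>S. z \<otimes>\<^bsub>U\<^esub> (u a \<otimes>\<^bsub>U\<^esub> \<xi> a))"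
        unfolding 1(5) using 1 that uI by (intro S.finsum_rdistr) auto
      also have "\<dots> = (\<Oplus>\<^bsub>U\<^esub>a\<in>S. u a \<otimes>\<^bsub>U\<^esub> (z \<otimes>\<^bsub>U\<^esub> \<xi> a))"
        using 1 that uI by (intro S.finsum_cong' refl) (auto intro!: S.m_lcomm)
      finally show ?thesis
        unfolding A_def using 1 that
        by (intro CollectI exI[of _ S] exI[of _ "\<lambda>a. z \<otimes>\<^bsub>U\<^esub> \<xi> a"]) auto
    qed
  qed
  moreover have "u a \<in> A" if "a \<in> I" for a
    unfolding A_def using that
    by (intro CollectI exI[of _ "{a}"] exI[of _ "\<lambda>b. if b = a then \<one>\<^bsub>U\<^esub> else \<zero>\<^bsub>U\<^esub>"]) auto
  ultimately have "Idl\<^bsub>U\<^esub> (u ` I) \<subseteq> A" by (intro S.genideal_minimal) auto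
  then have "\<one>\<^bsub>U\<^esub> \<in> A" using assms by (auto simp: dense_ideal_def)
  then obtain S \<xi> where "finite S" "S \<subseteq> I" "\<forall>a. \<xi> a \<in> carrier U"
    "\<one>\<^bsub>U\<^esub> = (\<Oplus>\<^bsub>U\<^esub>a\<in>S. u a \<otimes>\<^bsub>U\<^esub> \<xi> a)"
    unfolding A_def by blast
  then show ?thesis by (intro that[of S \<xi>]) auto
qed

end

section \<open>Semilocal and zero-dimensional quotients, read off in the ring itself\<close>

lemma (in cring) rcos_mem_image_iff:
  assumes "ideal I R" "ideal J R" "I \<subseteq> J" "r \<in> carrier R"
  shows "I +> r \<in> (+>) I ` J \<longleftrightarrow> r \<in> J"
proof
  interpret J: ideal J R by fact
  assume "I +> r \<in> (+>) I ` J"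
  then obtain j where j: "j \<in> J" "I +> r = I +> j" by blast
  then have "r \<ominus> j \<in> J"
    using quotient_eq_iff_same_a_r_cos[OF assms(1,4), of j] J.Icarr assms(3) by blast
  then have "(r \<ominus> j) \<oplus> j \<in> J" using j by (intro J.a_closed)
  then show "r \<in> J" using assms(4) J.Icarr[OF j(1)] by (simp add: minus_eq a_assoc l_neg)
qed auto

lemma (in cring) ideal_finsum_closed:
  assumes I: "ideal I R" and "finite A" "\<And>a. a \<in> A \<Longrightarrow> f a \<in> I"
  shows "(\<Oplus>a\<in>A. f a) \<in> I"
proof -
  interpret I: ideal I R by fact
  show ?thesis
    using assms(2,3)
  proof (induction A rule: finite_induct)
    case (insert a A)
    then have "(\<Oplus>b\<in>insert a A. f b) = f a \<oplus> (\<Oplus>b\<in>A. f b)"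
      using I.Icarr by (intro finsum_insert) auto
    then show ?case using insert by (simp add: I.a_closed)
  qed simp
qed

lemma (in cring) finite_maximalideals_above:
  assumes I: "ideal I R" and fin: "semilocal (R Quot I)"
  shows "finite {\<mm>. maximalideal \<mm> R \<and> I \<subseteq> \<mm>}"
proof (rule inj_on_finite)
  interpret I: ideal I R by fact
  interpret Q: cring "R Quot I" by (rule I.quotient_is_cring[OF is_cring])
  have carrier_Q: "carrier (R Quot I) = (+>) I ` carrier R"
    by (auto simp: FactRing_def A_RCOSETS_def')
  let ?f = "(`) ((+>) I)"
  show "inj_on ?f {\<mm>. maximalideal \<mm> R \<and> I \<subseteq> \<mm>}"
  proof (rule inj_onI)
    fix \<mm> \<nn> assume *: "\<mm> \<in> {\<mm>. maximalideal \<mm> R \<and> I \<subseteq> \<mm>}" "\<nn> \<in> {\<mm>. maximalideal \<mm> R \<and> I \<subseteq> \<mm>}"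
      "?f \<mm> = ?f \<nn>"
    then have i: "ideal \<mm> R" "ideal \<nn> R" by (auto intro: maximalideal.axioms)
    have "r \<in> \<mm> \<longleftrightarrow> r \<in> \<nn>" if "r \<in> carrier R" for r
      using rcos_mem_image_iff[OF I i(1) _ that] rcos_mem_image_iff[OF I i(2) _ that] * by simp
    then show "\<mm> = \<nn>" using ideal.Icarr[OF i(1)] ideal.Icarr[OF i(2)] by blast
  qed
  show "finite {\<mm>. maximalideal \<mm> (R Quot I)}" using fin by (simp add: semilocal_def)
  have "maximalideal (?f \<mm>) (R Quot I)" if \<mm>: "maximalideal \<mm> R" and "I \<subseteq> \<mm>" for \<mm>
  proof (rule maximalidealI)
    interpret \<mm>: maximalideal \<mm> R by fact
    note mem = rcos_mem_image_iff[OF I \<mm>.is_ideal \<open>I \<subseteq> \<mm>\<close>]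
    show "ideal (?f \<mm>) (R Quot I)" by (rule ring_ideal_imp_quot_ideal[OF I \<mm>.is_ideal])
    show "carrier (R Quot I) \<noteq> ?f \<mm>"
      using mem[OF one_closed] maximalideal_one_notin[OF \<mm>] unfolding carrier_Q by blast
    fix J assume J: "ideal J (R Quot I)" "?f \<mm> \<subseteq> J" "J \<subseteq> carrier (R Quot I)"
    interpret J: ideal J "R Quot I" by fact
    let ?P = "{r \<in> carrier R. I +> r \<in> J}"
    have hom: "ring_hom_ring R (R Quot I) ((+>) I)" by (rule I.rcos_ring_hom_ring)
    note h = ring_hom_add[OF I.rcos_ring_hom] ring_hom_mult[OF I.rcos_ring_hom]
    have "ideal ?P R"
    proof (rule idealI_smult)
      have "\<zero> \<in> \<mm>" by simp
      then show "\<zero> \<in> ?P" using J(2) by auto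
      show "a \<oplus> b \<in> ?P" if "a \<in> ?P" "b \<in> ?P" for a b
        using that J.a_closed by (auto simp: h)
      show "x \<otimes> a \<in> ?P" if "a \<in> ?P" "x \<in> carrier R" for a x
        using that J.I_l_closed[of "I +> a" "I +> x"] by (auto simp: h carrier_Q)
    qed auto
    moreover have "\<mm> \<subseteq> ?P" using J(2) by auto
    ultimately have "?P = \<mm> \<or> ?P = carrier R" by (intro \<mm>.I_maximal) auto
    moreover have "J = ?f ?P" using J(3) unfolding carrier_Q by auto
    ultimately show "J = ?f \<mm> \<or> J = carrier (R Quot I)" unfolding carrier_Q by (elim disjE) simp_all
  qed
  then show "?f ` {\<mm>. maximalideal \<mm> R \<and> I \<subseteq> \<mm>} \<subseteq> {\<mm>. maximalideal \<mm> (R Quot I)}" by auto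
qed

text \<open>The quotient is a domain, so its zero ideal is prime and hence, in dimension zero,
  maximal; ideals above \<open>\<pp>\<close> correspond to ideals of the quotient.\<close>

lemma (in cring) primeideal_imp_maximalideal:
  assumes p: "primeideal \<pp> R" and dim: "krull_dimension_zero (R Quot \<pp>)"
  shows "maximalideal \<pp> R"
proof (rule maximalidealI)
  interpret \<pp>: primeideal \<pp> R by fact
  interpret Q: domain "R Quot \<pp>" by (rule \<pp>.quotient_is_domain)
  have carrier_Q: "carrier (R Quot \<pp>) = (+>) \<pp> ` carrier R"
    by (auto simp: FactRing_def A_RCOSETS_def')
  have zero_Q: "\<zero>\<^bsub>R Quot \<pp>\<^esub> = \<pp>" by (simp add: FactRing_def)
  show "ideal \<pp> R" by (rule \<pp>.is_ideal)
  show "carrier R \<noteq> \<pp>" by (rule \<pp>.I_notcarr)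
  have max: "maximalideal {\<pp>} (R Quot \<pp>)"
    using Q.zeroprimeideal dim by (simp add: krull_dimension_zero_def zero_Q)
  fix J assume J: "ideal J R" "\<pp> \<subseteq> J" "J \<subseteq> carrier R"
  interpret J: ideal J R by fact
  note mem = rcos_mem_image_iff[OF \<pp>.is_ideal J(1,2)]
  have "ideal ((+>) \<pp> ` J) (R Quot \<pp>)" by (rule ring_ideal_imp_quot_ideal[OF \<pp>.is_ideal J(1)])
  moreover have "\<pp> = \<pp> +> \<zero>" by (simp add: a_rcos_zero[OF \<pp>.is_ideal])
  then have "{\<pp>} \<subseteq> (+>) \<pp> ` J" by auto
  moreover have "(+>) \<pp> ` J \<subseteq> carrier (R Quot \<pp>)" using J(3) by (auto simp: carrier_Q)
  ultimately have "(+>) \<pp> ` J = {\<pp>} \<or> (+>) \<pp> ` J = carrier (R Quot \<pp>)"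
    by (rule maximalideal.I_maximal[OF max])
  then show "J = \<pp> \<or> J = carrier R"
  proof
    assume "(+>) \<pp> ` J = {\<pp>}"
    then have "j \<in> \<pp>" if "j \<in> J" for j using \<pp>.rcos_const_imp_mem[of j] that J(3) by blast
    then show ?thesis using J(2) by blast
  next
    assume "(+>) \<pp> ` J = carrier (R Quot \<pp>)"
    then have "r \<in> J" if "r \<in> carrier R" for r using mem[OF that] that unfolding carrier_Q by simp
    then show ?thesis using J(3) by blast
  qed
qed

section \<open>Generators at the maximal ideals of the exceptional set\<close>

text \<open>The two assumptions are the consequences of the hypothesis on quotients, restated for
  ideals of \<open>R\<close>: semilocality gives the first, dimension zero of the quotient by the
  prime itself gives the second.\<close>

locale flat_epi_zero_dim = flat_epi R U u
  for R :: "('a, 'k) ring_scheme" (structure) and U :: "('b, 'l) ring_scheme" and u :: "'a \<Rightarrow> 'b" +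
  assumes dense_finite: "dense I \<Longrightarrow> finite {\<mm>. maximalideal \<mm> R \<and> I \<subseteq> \<mm>}"
    and dense_prime: "\<lbrakk>dense \<pp>; primeideal \<pp> R\<rbrakk> \<Longrightarrow> maximalideal \<pp> R"
begin

definition \<Lambda> where "\<Lambda> = {\<mm>. maximalideal \<mm> R \<and> dense \<mm>}"

lemma dense_subset_imp_\<Lambda>:
  assumes "dense I" "maximalideal \<mm> R" "I \<subseteq> \<mm>"
  shows "\<mm> \<in> \<Lambda>"
  using dense_superset[OF assms(1) maximalideal.axioms(1)[OF assms(2)] assms(3)] assms(2)
  by (simp add: \<Lambda>_def)

lemma ex_generators:
  assumes "\<mm> \<in> \<Lambda>"
  shows "\<exists>S \<xi>. finite S \<and> S \<subseteq> \<mm> \<and> (\<forall>a. \<xi> a \<in> carrier U) \<and>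
    (\<Oplus>\<^bsub>U\<^esub>a\<in>S. u a \<otimes>\<^bsub>U\<^esub> \<xi> a) = \<one>\<^bsub>U\<^esub> \<and> (\<forall>\<nn>. maximalideal \<nn> R \<and> S \<subseteq> \<nn> \<longrightarrow> \<nn> = \<mm>)"
proof -
  have max: "maximalideal \<mm> R" and "dense \<mm>" using assms by (auto simp: \<Lambda>_def)
  interpret \<mm>: maximalideal \<mm> R by fact
  obtain S \<xi> where S: "finite S" "S \<subseteq> \<mm>" "\<And>a. \<xi> a \<in> carrier U"
    "(\<Oplus>\<^bsub>U\<^esub>a\<in>S. u a \<otimes>\<^bsub>U\<^esub> \<xi> a) = \<one>\<^bsub>U\<^esub>"
    using dense_finite_combination[OF \<open>dense \<mm>\<close>] by blast
  have SR: "S \<subseteq> carrier R" using S(2) \<mm>.Icarr by blast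
  let ?I = "Idl S"
  have I: "ideal ?I R" by (rule R.genideal_ideal[OF SR])
  have "(\<Oplus>\<^bsub>U\<^esub>a\<in>S. u a \<otimes>\<^bsub>U\<^esub> \<xi> a) \<in> Idl\<^bsub>U\<^esub> (u ` ?I)"
  proof -
    have uI: "u ` ?I \<subseteq> carrier U" using ideal.Icarr[OF I] by auto
    interpret A: ideal "Idl\<^bsub>U\<^esub> (u ` ?I)" U by (rule S.genideal_ideal[OF uI])
    have "u a \<otimes>\<^bsub>U\<^esub> \<xi> a \<in> Idl\<^bsub>U\<^esub> (u ` ?I)" if "a \<in> S" for a
      using that R.genideal_self[OF SR] S.genideal_self[OF uI] S(3) by (intro A.I_r_closed) auto
    then show ?thesis using S(1) by (intro S.ideal_finsum_closed A.is_ideal) auto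
  qed
  then have "dense ?I" using S(4) I by (simp add: dense_ideal_def)
  \<comment> \<open>The unwanted maximal ideals. They are finitely many because \<open>S\<close>
    alone already generates a dense ideal.\<close>
  define V where "V = {\<nn>. maximalideal \<nn> R \<and> ?I \<subseteq> \<nn>} - {\<mm>}"
  have "finite V" using dense_finite[OF \<open>dense ?I\<close>] by (simp add: V_def)
  have "\<exists>g. g \<in> \<mm> \<and> g \<notin> \<nn>" if "\<nn> \<in> V" for \<nn>
  proof (rule ccontr)
    assume "\<not> ?thesis"
    then have "\<mm> \<subseteq> \<nn>" by blast
    moreover have "maximalideal \<nn> R" "\<nn> \<noteq> \<mm>" using that by (auto simp: V_def)
    ultimately show False
      using R.maximalideal_subset_eq[OF max maximalideal.axioms(1)] R.maximalideal_one_notin by blast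
  qed
  then obtain g where g: "\<And>\<nn>. \<nn> \<in> V \<Longrightarrow> g \<nn> \<in> \<mm> \<and> g \<nn> \<notin> \<nn>" by metis
  \<comment> \<open>The elements that exclude the ideals in \<open>V\<close> receive coefficient
    zero, so the combination still equals \<open>\<one>\<close>.\<close>
  let ?S = "S \<union> g ` V" and ?\<xi> = "\<lambda>a. if a \<in> S then \<xi> a else \<zero>\<^bsub>U\<^esub>"
  have sub: "?S \<subseteq> \<mm>" using S(2) g by blast
  then have SR': "a \<in> carrier R" if "a \<in> ?S" for a using that \<mm>.Icarr by blast
  have "(\<Oplus>\<^bsub>U\<^esub>a\<in>?S. u a \<otimes>\<^bsub>U\<^esub> ?\<xi> a) = (\<Oplus>\<^bsub>U\<^esub>a\<in>S. u a \<otimes>\<^bsub>U\<^esub> \<xi> a)"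
    using S(1,3) \<open>finite V\<close> SR' by (intro S.add.finprod_mono_neutral_cong_right) auto
  moreover have "\<nn> = \<mm>" if "maximalideal \<nn> R" "?S \<subseteq> \<nn>" for \<nn>
  proof -
    have "?I \<subseteq> \<nn>" using that by (intro R.genideal_minimal) (auto intro: maximalideal.axioms)
    then show ?thesis using that g[of \<nn>] by (auto simp: V_def)
  qed
  ultimately show ?thesis
    using S sub \<open>finite V\<close> by (intro exI[of _ ?S] exI[of _ ?\<xi>]) auto
qed

definition gens :: "'a set \<Rightarrow> 'a set" where
  "gens \<mm> = (SOME S. \<exists>\<xi>. finite S \<and> S \<subseteq> \<mm> \<and> (\<forall>a. \<xi> a \<in> carrier U) \<and>
    (\<Oplus>\<^bsub>U\<^esub>a\<in>S. u a \<otimes>\<^bsub>U\<^esub> \<xi> a) = \<one>\<^bsub>U\<^esub> \<and> (\<forall>\<nn>. maximalideal \<nn> R \<and> S \<subseteq> \<nn> \<longrightarrow> \<nn> = \<mm>))"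

definition coef :: "'a set \<Rightarrow> 'a \<Rightarrow> 'b" where
  "coef \<mm> = (SOME \<xi>. (\<forall>a. \<xi> a \<in> carrier U) \<and> (\<Oplus>\<^bsub>U\<^esub>a\<in>gens \<mm>. u a \<otimes>\<^bsub>U\<^esub> \<xi> a) = \<one>\<^bsub>U\<^esub>)"

lemma
  assumes "\<mm> \<in> \<Lambda>"
  shows finite_gens: "finite (gens \<mm>)"
    and gens_subset: "gens \<mm> \<subseteq> \<mm>"
    and gens_maximal: "\<lbrakk>maximalideal \<nn> R; gens \<mm> \<subseteq> \<nn>\<rbrakk> \<Longrightarrow> \<nn> = \<mm>"
    and coef_closed: "coef \<mm> a \<in> carrier U"
    and sum_coef: "(\<Oplus>\<^bsub>U\<^esub>a\<in>gens \<mm>. u a \<otimes>\<^bsub>U\<^esub> coef \<mm> a) = \<one>\<^bsub>U\<^esub>"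
proof -
  from someI_ex[OF ex_generators[OF assms], folded gens_def]
  obtain \<xi> where \<xi>: "finite (gens \<mm>)" "gens \<mm> \<subseteq> \<mm>" "\<forall>\<nn>. maximalideal \<nn> R \<and> gens \<mm> \<subseteq> \<nn> \<longrightarrow> \<nn> = \<mm>"
    "(\<forall>a. \<xi> a \<in> carrier U) \<and> (\<Oplus>\<^bsub>U\<^esub>a\<in>gens \<mm>. u a \<otimes>\<^bsub>U\<^esub> \<xi> a) = \<one>\<^bsub>U\<^esub>" by blast
  from someI[of "\<lambda>\<xi>. (\<forall>a. \<xi> a \<in> carrier U) \<and> (\<Oplus>\<^bsub>U\<^esub>a\<in>gens \<mm>. u a \<otimes>\<^bsub>U\<^esub> \<xi> a) = \<one>\<^bsub>U\<^esub>", OF \<xi>(4), folded coef_def]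
  show "finite (gens \<mm>)" "gens \<mm> \<subseteq> \<mm>" "\<lbrakk>maximalideal \<nn> R; gens \<mm> \<subseteq> \<nn>\<rbrakk> \<Longrightarrow> \<nn> = \<mm>"
    "coef \<mm> a \<in> carrier U" "(\<Oplus>\<^bsub>U\<^esub>a\<in>gens \<mm>. u a \<otimes>\<^bsub>U\<^esub> coef \<mm> a) = \<one>\<^bsub>U\<^esub>"
    using \<xi> by blast+
qed

lemma maximal_\<Lambda>: "\<mm> \<in> \<Lambda> \<Longrightarrow> maximalideal \<mm> R"
  by (simp add: \<Lambda>_def)

lemma gens_closed: "\<lbrakk>\<mm> \<in> \<Lambda>; a \<in> gens \<mm>\<rbrakk> \<Longrightarrow> a \<in> carrier R"
  using gens_subset[of \<mm>] ideal.Icarr[OF maximalideal.axioms(1)[OF maximal_\<Lambda>[of \<mm>]]] by blast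

definition words :: "'a set \<Rightarrow> nat \<Rightarrow> 'a list set" where
  "words \<mm> N = {w. length w = N \<and> set w \<subseteq> gens \<mm>}"

definition wprod :: "'a list \<Rightarrow> 'a" where "wprod w = foldr (\<otimes>) w \<one>"

lemma wprod_simps [simp]: "wprod [] = \<one>" "wprod (a # w) = a \<otimes> wprod w"
  by (simp_all add: wprod_def)

lemma wprod_closed [simp]: "set w \<subseteq> carrier R \<Longrightarrow> wprod w \<in> carrier R"
  by (induction w) auto

lemma wprod_append: "\<lbrakk>set v \<subseteq> carrier R; set w \<subseteq> carrier R\<rbrakk> \<Longrightarrow> wprod (v @ w) = wprod v \<otimes> wprod w"
  by (induction v) (auto simp: R.m_assoc)

lemma finite_words: "\<mm> \<in> \<Lambda> \<Longrightarrow> finite (words \<mm> N)"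
  using finite_lists_length_eq[OF finite_gens, of \<mm> N] by (simp add: words_def conj_commute)

lemma words_carrier: "\<lbrakk>\<mm> \<in> \<Lambda>; set w \<subseteq> gens \<mm>\<rbrakk> \<Longrightarrow> set w \<subseteq> carrier R"
  using gens_closed by blast

lemma wprod_words_closed: "\<lbrakk>\<mm> \<in> \<Lambda>; w \<in> words \<mm> N\<rbrakk> \<Longrightarrow> wprod w \<in> carrier R"
  using words_carrier by (auto simp: words_def)

text \<open>
  Otherwise an ideal maximal among those containing \<open>I\<close> and violating the claim would be
  prime, hence equal to \<open>\<mm>\<close>.
\<close>

lemma dense_locally_nilpotent:
  assumes "dense I" "\<mm> \<in> \<Lambda>"
  shows "\<exists>e N. e \<in> carrier R \<and> e \<notin> \<mm> \<and> (\<forall>w\<in>words \<mm> N. wprod w \<otimes> e \<in> I)"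
proof (rule ccontr)
  \<comment> \<open>An ideal violates the claim exactly if it contains none of these sets, each of
    which is finite because there are finitely many words of each length.\<close>
  let ?\<X> = "{(\<lambda>w. wprod w \<otimes> e) ` words \<mm> N | e N. e \<in> carrier R - \<mm>}"
  note max = maximal_\<Lambda>[OF assms(2)]
  interpret \<mm>: maximalideal \<mm> R by (rule max)
  interpret I: ideal I R using assms(1) by (simp add: dense_ideal_def)
  assume no: "\<not> ?thesis"
  have "finite X \<and> \<not> X \<subseteq> I" if "X \<in> ?\<X>" for X
  proof -
    obtain e N where e: "e \<in> carrier R" "e \<notin> \<mm>" and X: "X = (\<lambda>w. wprod w \<otimes> e) ` words \<mm> N"
      using \<open>X \<in> ?\<X>\<close> by blast
    from no e have "\<exists>w\<in>words \<mm> N. wprod w \<otimes> e \<notin> I" by blast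
    then show ?thesis using finite_words[OF assms(2)] by (auto simp: X)
  qed
  then obtain H where H: "ideal H R" "I \<subseteq> H" and avoid: "\<And>X. X \<in> ?\<X> \<Longrightarrow> \<not> X \<subseteq> H"
    and maxH: "\<And>J. \<lbrakk>ideal J R; H \<subseteq> J; \<And>X. X \<in> ?\<X> \<Longrightarrow> \<not> X \<subseteq> J\<rbrakk> \<Longrightarrow> J = H"
    using R.ideal_avoiding_finite_sets[OF I.is_ideal, of ?\<X> thesis] by blast
  interpret H: ideal H R by fact
  have avoid: "\<exists>w\<in>words \<mm> N. wprod w \<otimes> e \<notin> H" if "e \<in> carrier R" "e \<notin> \<mm>" for e N
    using avoid[of "(\<lambda>w. wprod w \<otimes> e) ` words \<mm> N"] that by blast
  \<comment> \<open>Length zero: the only word is empty, so an element of \<open>H\<close> outside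
    \<open>\<mm>\<close> would contradict avoidance.\<close>
  have HM: "H \<subseteq> \<mm>"
  proof
    fix e assume "e \<in> H"
    then show "e \<in> \<mm>" using avoid[of e 0] by (auto simp: words_def)
  qed
  \<comment> \<open>By maximality of \<open>H\<close> the ideal \<open>H + R a\<close> satisfies the
    claim.\<close>
  have enlarge: "\<exists>e N. e \<in> carrier R \<and> e \<notin> \<mm> \<and>
      (\<forall>w\<in>words \<mm> N. \<exists>h\<in>H. \<exists>r\<in>carrier R. wprod w \<otimes> e = h \<oplus> r \<otimes> a)"
    if a: "a \<in> carrier R" "a \<notin> H" for a
  proof (rule ccontr)
    assume none: "\<not> ?thesis"
    let ?J = "{h \<oplus> r \<otimes> a | h r. h \<in> H \<and> r \<in> carrier R}"
    have "ideal ?J R"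
    proof (rule R.idealI_smult)
      show "?J \<subseteq> carrier R" using a H.Icarr by auto
      show "\<zero> \<in> ?J" using a by (intro CollectI exI[of _ \<zero>]) auto
      show "x \<oplus> y \<in> ?J" if "x \<in> ?J" "y \<in> ?J" for x y
      proof -
        obtain h r h' r' where *: "h \<in> H" "r \<in> carrier R" "x = h \<oplus> r \<otimes> a"
          "h' \<in> H" "r' \<in> carrier R" "y = h' \<oplus> r' \<otimes> a" using \<open>x \<in> ?J\<close> \<open>y \<in> ?J\<close> by blast
        then have "x \<oplus> y = (h \<oplus> h') \<oplus> (r \<oplus> r') \<otimes> a"
          using a H.Icarr by (simp add: R.l_distr R.a_ac)
        then show ?thesis using * by (intro CollectI exI[of _ "h \<oplus> h'"] exI[of _ "r \<oplus> r'"]) auto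
      qed
      show "z \<otimes> x \<in> ?J" if "x \<in> ?J" "z \<in> carrier R" for x z
      proof -
        obtain h r where *: "h \<in> H" "r \<in> carrier R" "x = h \<oplus> r \<otimes> a" using \<open>x \<in> ?J\<close> by blast
        then have "z \<otimes> x = z \<otimes> h \<oplus> (z \<otimes> r) \<otimes> a"
          using a H.Icarr \<open>z \<in> carrier R\<close> by (simp add: R.r_distr R.m_assoc)
        then show ?thesis using * \<open>z \<in> carrier R\<close> H.I_l_closed by blast
      qed
    qed
    moreover have "H \<subseteq> ?J"
    proof
      fix h assume "h \<in> H"
      then show "h \<in> ?J" using a H.Icarr by (intro CollectI exI[of _ h] exI[of _ \<zero>]) auto
    qed
    moreover have "\<not> X \<subseteq> ?J" if "X \<in> ?\<X>" for X
    proof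
      assume sub: "X \<subseteq> ?J"
      obtain e N where e: "e \<in> carrier R" "e \<notin> \<mm>" and X: "X = (\<lambda>w. wprod w \<otimes> e) ` words \<mm> N"
        using \<open>X \<in> ?\<X>\<close> by blast
      have "\<forall>w\<in>words \<mm> N. \<exists>h\<in>H. \<exists>r\<in>carrier R. wprod w \<otimes> e = h \<oplus> r \<otimes> a"
        using sub unfolding X by blast
      then show False using none e by blast
    qed
    ultimately have "?J = H" by (rule maxH)
    moreover have "a \<in> ?J" using a by (intro CollectI exI[of _ \<zero>] exI[of _ \<one>]) auto
    ultimately show False using a by simp
  qed
  have "primeideal H R"
  proof (rule primeidealI[OF H.is_ideal R.is_cring])
    show "carrier R \<noteq> H" using HM \<mm>.I_notcarr \<mm>.a_subset by blast
    fix a b assume ab: "a \<in> carrier R" "b \<in> carrier R" "a \<otimes> b \<in> H"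
    show "a \<in> H \<or> b \<in> H"
    proof (rule ccontr)
      assume "\<not> (a \<in> H \<or> b \<in> H)"
      then have "a \<notin> H" "b \<notin> H" by auto
      obtain e N where e: "e \<in> carrier R" "e \<notin> \<mm>"
        "\<And>w. w \<in> words \<mm> N \<Longrightarrow> \<exists>h\<in>H. \<exists>r\<in>carrier R. wprod w \<otimes> e = h \<oplus> r \<otimes> a"
        using enlarge[OF ab(1) \<open>a \<notin> H\<close>] by blast
      obtain e' N' where e': "e' \<in> carrier R" "e' \<notin> \<mm>"
        "\<And>w. w \<in> words \<mm> N' \<Longrightarrow> \<exists>h\<in>H. \<exists>r\<in>carrier R. wprod w \<otimes> e' = h \<oplus> r \<otimes> b"
        using enlarge[OF ab(2) \<open>b \<notin> H\<close>] by blast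
      \<comment> \<open>Cutting the word into a prefix of length \<open>N\<close> and a suffix of
        length \<open>N'\<close> puts the product into \<open>(H + R a) (H + R b)\<close>, which
        lies in \<open>H\<close> since \<open>a \<otimes> b\<close> does.\<close>
      have "wprod w \<otimes> (e \<otimes> e') \<in> H" if w: "w \<in> words \<mm> (N + N')" for w
      proof -
        let ?v = "take N w" and ?v' = "drop N w"
        have v: "?v \<in> words \<mm> N" "?v' \<in> words \<mm> N'"
          using w set_take_subset[of N w] set_drop_subset[of N w] by (auto simp: words_def)
        obtain h r where h: "h \<in> H" "r \<in> carrier R" "wprod ?v \<otimes> e = h \<oplus> r \<otimes> a" using e(3)[OF v(1)] by blast
        obtain h' r' where h': "h' \<in> H" "r' \<in> carrier R" "wprod ?v' \<otimes> e' = h' \<oplus> r' \<otimes> b"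
          using e'(3)[OF v(2)] by blast
        have c: "wprod ?v \<in> carrier R" "wprod ?v' \<in> carrier R"
          using wprod_words_closed[OF assms(2)] v by blast+
        have "wprod w = wprod ?v \<otimes> wprod ?v'"
          using wprod_append[of ?v ?v'] v words_carrier[OF assms(2)] by (simp add: words_def)
        then have "wprod w \<otimes> (e \<otimes> e') = (wprod ?v \<otimes> e) \<otimes> (wprod ?v' \<otimes> e')"
          using c e(1) e'(1) by (simp add: R.m_ac)
        also have "\<dots> = h \<otimes> (h' \<oplus> r' \<otimes> b) \<oplus> (r \<otimes> a \<otimes> h' \<oplus> r \<otimes> r' \<otimes> (a \<otimes> b))"
          unfolding h(3) h'(3) using h h' ab H.Icarr by (simp add: R.l_distr R.r_distr R.m_ac)
        also have "\<dots> \<in> H"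
        proof -
          have "h \<otimes> (h' \<oplus> r' \<otimes> b) \<in> H" "r \<otimes> a \<otimes> h' \<in> H" "r \<otimes> r' \<otimes> (a \<otimes> b) \<in> H"
            using h h' ab H.I_r_closed[OF h(1)] H.I_l_closed[OF h'(1)] H.I_l_closed[OF ab(3)] H.Icarr
            by simp_all
          then show ?thesis by (intro H.a_closed)
        qed
        finally show ?thesis .
      qed
      moreover have "e \<otimes> e' \<notin> \<mm>" using R.maximalideal_m_notin[OF max] e e' by blast
      ultimately show False using avoid[of "e \<otimes> e'" "N + N'"] e(1) e'(1) by auto
    qed
  qed
  moreover have "dense H" by (rule dense_superset[OF assms(1) H.is_ideal H(2)])
  ultimately have "maximalideal H R" by (intro dense_prime)
  then have "\<mm> = H"
    using R.maximalideal_subset_eq[OF _ \<mm>.is_ideal HM] R.maximalideal_one_notin[OF max] by blast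
  \<comment> \<open>Length one with factor \<open>\<one>\<close>: some generator avoids
    \<open>H\<close>, although \<open>H = \<mm>\<close> contains all of them.\<close>
  moreover obtain w where "w \<in> words \<mm> 1" "wprod w \<otimes> \<one> \<notin> H"
    using avoid[of \<one> 1] R.maximalideal_one_notin[OF max] by blast
  then obtain a where "a \<in> gens \<mm>" "a \<otimes> \<one> \<otimes> \<one> \<notin> H"
    by (auto simp: words_def length_Suc_conv)
  ultimately show False using gens_subset[OF assms(2)] gens_closed[OF assms(2)] by auto
qed

end

section \<open>The presentation\<close>

lemma finsum_restrict_scalars: "finsum (restrict_scalars S h) f A = finsum S f A"
  by (simp add: finsum_def finprod_def)

lemma (in cring) diff_mult_add:
  "\<lbrakk>x \<in> carrier R; y \<in> carrier R; a \<in> carrier R; p \<in> carrier R; q \<in> carrier R\<rbrakk>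
    \<Longrightarrow> (x \<oplus> y) \<ominus> a \<otimes> (p \<oplus> q) = (x \<ominus> a \<otimes> p) \<oplus> (y \<ominus> a \<otimes> q)"
  by algebra

lemma (in cring) diff_mult_smult:
  "\<lbrakk>r \<in> carrier R; x \<in> carrier R; a \<in> carrier R; p \<in> carrier R\<rbrakk>
    \<Longrightarrow> r \<otimes> x \<ominus> a \<otimes> (r \<otimes> p) = r \<otimes> (x \<ominus> a \<otimes> p)"
  by algebra

context flat_epi_zero_dim
begin

lemma \<Lambda>_nonempty: "\<mm> \<in> \<Lambda> \<Longrightarrow> \<mm> \<noteq> {}"
  using additive_subgroup.zero_closed[OF ideal.axioms(1)[OF maximalideal.axioms(1)[OF maximal_\<Lambda>]]] by blast

text \<open>
  A nonempty word \<open>w\<close> over the generators at \<open>\<mm>\<close> is the index \<open>(\<mm>, w)\<close>; the empty words at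
  the various \<open>\<mm>\<close> are identified with each other and represented by \<open>({}, [])\<close>.
\<close>

definition indices :: "('a set \<times> 'a list) set" where
  "indices = insert ({}, []) {(\<mm>, w). \<mm> \<in> \<Lambda> \<and> w \<noteq> [] \<and> set w \<subseteq> gens \<mm>}"

text \<open>Here the empty words at different \<open>\<mm>\<close> stay apart: each
  \<open>\<mm>\<close> contributes its own relator expanding the common root.\<close>

definition relation_indices :: "('a set \<times> 'a list) set" where
  "relation_indices = {(\<mm>, w). \<mm> \<in> \<Lambda> \<and> set w \<subseteq> gens \<mm>}"

abbreviation "F \<equiv> free_module R indices"

abbreviation "Q \<equiv> free_module R relation_indices"

abbreviation "R' \<equiv> restrict_scalars R (\<lambda>r. r)"

definition value_at :: "'a set \<times> 'a list \<Rightarrow> 'b" where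
  "value_at = (\<lambda>(\<mm>, w). foldr (\<lambda>a x. coef \<mm> a \<otimes>\<^bsub>U\<^esub> x) w \<one>\<^bsub>U\<^esub>)"

definition \<rho> :: "('a set \<times> 'a list \<Rightarrow> 'a) \<Rightarrow> 'b" where
  "\<rho> = linear_combination R U' value_at"

text \<open>The sum of the coefficients at all empty words. It is the root coordinate of
  \<open>D c\<close>, because the relators at the various \<open>(\<mm>, [])\<close> share the root;
  the modules at different \<open>\<mm>\<close> are coupled only here.\<close>

definition aug :: "('a set \<times> 'a list \<Rightarrow> 'a) \<Rightarrow> 'a" where
  "aug = linear_combination R R' (\<lambda>(\<mm>, w). if w = [] then \<one> else \<zero>)"

text \<open>The relator at \<open>(\<mm>, w)\<close> is \<open>w - (\<Sum>a \<in> gens \<mm>. a \<cdot> (a # w))\<close>.\<close>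

definition D :: "('a set \<times> 'a list \<Rightarrow> 'a) \<Rightarrow> ('a set \<times> 'a list \<Rightarrow> 'a)" where
  "D c = (\<lambda>(\<mm>, w). case w of
      [] \<Rightarrow> if \<mm> = {} then aug c else \<zero>
    | a # v \<Rightarrow> if \<mm> \<in> \<Lambda> \<and> a \<in> gens \<mm> then c (\<mm>, a # v) \<ominus> a \<otimes> c (\<mm>, v) else \<zero>)"

lemma D_simps [simp]:
  "D c ({}, []) = aug c"
  "\<mm> \<noteq> {} \<Longrightarrow> D c (\<mm>, []) = \<zero>"
  "D c (\<mm>, a # v) = (if \<mm> \<in> \<Lambda> \<and> a \<in> gens \<mm> then c (\<mm>, a # v) \<ominus> a \<otimes> c (\<mm>, v) else \<zero>)"
  by (simp_all add: D_def)

lemma module_F: "module R F" and module_Q: "module R Q"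
  by (rule module_free_module[OF R.is_cring])+

lemma module_R': "module R R'"
  by (intro module_restrict_scalars R.is_cring) (auto intro!: ring_hom_memI)

sublocale F: module R F by (rule module_F)
sublocale Q: module R Q by (rule module_Q)

lemma value_at_simps [simp]:
  "value_at (\<mm>, []) = \<one>\<^bsub>U\<^esub>" "value_at (\<mm>, a # w) = coef \<mm> a \<otimes>\<^bsub>U\<^esub> value_at (\<mm>, w)"
  by (simp_all add: value_at_def)

lemma value_at_closed: "\<mm> \<in> \<Lambda> \<Longrightarrow> value_at (\<mm>, w) \<in> carrier U"
  by (induction w) (auto simp: coef_closed)

lemma value_at_indices: "value_at \<in> indices \<rightarrow> carrier U'"
  using value_at_closed by (auto simp: indices_def)

lemma \<rho>_hom: "\<rho> \<in> mod_hom R F U'"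
  unfolding \<rho>_def by (rule linear_combination_hom[OF module_U' value_at_indices])

lemma \<rho>_simps:
  "x \<in> carrier F \<Longrightarrow> \<rho> x \<in> carrier U"
  "\<lbrakk>x \<in> carrier F; y \<in> carrier F\<rbrakk> \<Longrightarrow> \<rho> (x \<oplus>\<^bsub>F\<^esub> y) = \<rho> x \<oplus>\<^bsub>U\<^esub> \<rho> y"
  "\<lbrakk>r \<in> carrier R; x \<in> carrier F\<rbrakk> \<Longrightarrow> \<rho> (r \<odot>\<^bsub>F\<^esub> x) = u r \<otimes>\<^bsub>U\<^esub> \<rho> x"
  using mod_hom_closed[OF \<rho>_hom] mod_hom_add[OF \<rho>_hom] mod_hom_smult[OF \<rho>_hom] by simp_all

lemma aug_hom: "aug \<in> mod_hom R Q R'"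
  unfolding aug_def by (rule linear_combination_hom[OF module_R']) auto

lemma aug_simps:
  "x \<in> carrier Q \<Longrightarrow> aug x \<in> carrier R"
  "\<lbrakk>x \<in> carrier Q; y \<in> carrier Q\<rbrakk> \<Longrightarrow> aug (x \<oplus>\<^bsub>Q\<^esub> y) = aug x \<oplus> aug y"
  "\<lbrakk>r \<in> carrier R; x \<in> carrier Q\<rbrakk> \<Longrightarrow> aug (r \<odot>\<^bsub>Q\<^esub> x) = r \<otimes> aug x"
  using mod_hom_closed[OF aug_hom] mod_hom_add[OF aug_hom] mod_hom_smult[OF aug_hom] by simp_all

lemma aug_single:
  assumes c: "c \<in> carrier Q" and "\<And>\<nn>. \<nn> \<noteq> \<mm> \<Longrightarrow> c (\<nn>, []) = \<zero>"
  shows "aug c = c (\<mm>, [])"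
proof -
  note cl = R.free_moduleD[OF c]
  let ?f = "\<lambda>i. c i \<otimes> (case i of (\<mm>, w) \<Rightarrow> if w = [] then \<one> else \<zero>)"
  have "aug c = (\<Oplus>i\<in>{i. c i \<noteq> \<zero>}. ?f i)"
    by (simp add: aug_def linear_combination_def finsum_restrict_scalars)
  also have "\<dots> = (\<Oplus>i\<in>{(\<mm>, [])}. ?f i)"
  proof (rule R.add.finprod_mono_neutral_cong)
    fix i assume "i \<in> {i. c i \<noteq> \<zero>} - {(\<mm>, [])}"
    then show "?f i = \<zero>" using assms(2) cl(1)[of i] by (cases i) auto
  qed (use cl in auto)
  also have "\<dots> = c (\<mm>, [])" using cl by simp
  finally show ?thesis .
qed

lemma D_closed:
  assumes c: "c \<in> carrier Q"
  shows "D c \<in> carrier F"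
proof (rule R.free_moduleI)
  note cl = R.free_moduleD[OF c]
  have nz: "\<mm> \<in> \<Lambda> \<and> a \<in> gens \<mm> \<and> (c (\<mm>, a # v) \<noteq> \<zero> \<or> c (\<mm>, v) \<noteq> \<zero>)"
    if "D c (\<mm>, a # v) \<noteq> \<zero>" for \<mm> a v
    using that gens_closed by (auto simp: R.minus_eq split: if_splits)
  show "D c i \<in> carrier R" for i
  proof (cases i)
    case (Pair \<mm> w)
    then show ?thesis
      using cl(1) aug_simps(1)[OF c] gens_closed by (cases w; cases "\<mm> = {}") auto
  qed
  show "D c i = \<zero>" if "i \<notin> indices" for i
  proof (rule ccontr)
    assume *: "D c i \<noteq> \<zero>"
    obtain \<mm> w where i: "i = (\<mm>, w)" by (cases i)
    show False
    proof (cases w)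
      case Nil
      then show ?thesis using * that i by (cases "\<mm> = {}") (auto simp: indices_def)
    next
      case (Cons a v)
      then have "\<mm> \<in> \<Lambda>" "a \<in> gens \<mm>" "(\<mm>, a # v) \<in> relation_indices \<or> (\<mm>, v) \<in> relation_indices"
        using nz[of \<mm> a v] * i cl(2) by blast+
      then show ?thesis using that i Cons by (auto simp: indices_def relation_indices_def)
    qed
  qed
  \<comment> \<open>A word in the support of \<open>D c\<close> is the root, a word in the support
    of \<open>c\<close>, or such a word with one generator prefixed.\<close>
  let ?A = "insert ({}, []) ({i. c i \<noteq> \<zero>} \<union> (\<Union>(\<mm>, v)\<in>{i. c i \<noteq> \<zero>}. (\<lambda>a. (\<mm>, a # v)) ` gens \<mm>))"
  have "i \<in> ?A" if "D c i \<noteq> \<zero>" for i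
  proof -
    obtain \<mm> w where i: "i = (\<mm>, w)" by (cases i)
    show ?thesis
    proof (cases w)
      case Nil
      then show ?thesis using that i by (cases "\<mm> = {}") auto
    next
      case (Cons a v)
      then show ?thesis using nz[of \<mm> a v] that i by auto
    qed
  qed
  then have "{i. D c i \<noteq> \<zero>} \<subseteq> ?A" by (intro subsetI, elim CollectE)
  moreover have "finite (gens \<mm>)" if "c (\<mm>, v) \<noteq> \<zero>" for \<mm> v
    using cl(2)[of "(\<mm>, v)"] that finite_gens by (auto simp: relation_indices_def)
  then have "finite ?A" using cl(3) by (auto split: prod.splits)
  ultimately show "finite {i. D c i \<noteq> \<zero>}" by (rule finite_subset)
qed

lemma D_hom: "D \<in> mod_hom R Q F"
  unfolding mod_hom_def
proof (intro CollectI conjI ballI funcsetI D_closed)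
  fix c d assume c: "c \<in> carrier Q" and d: "d \<in> carrier Q"
  note cl = R.free_moduleD(1)[OF c] R.free_moduleD(1)[OF d]
  have "D (c \<oplus>\<^bsub>Q\<^esub> d) i = D c i \<oplus> D d i" for i
  proof (cases i)
    case (Pair \<mm> w)
    show ?thesis
    proof (cases w)
      case Nil
      then show ?thesis using Pair aug_simps(2)[OF c d] by (cases "\<mm> = {}") auto
    next
      case (Cons a v)
      then show ?thesis
        using Pair cl gens_closed[of \<mm> a] by (simp add: R.diff_mult_add)
    qed
  qed
  then show "D (c \<oplus>\<^bsub>Q\<^esub> d) = D c \<oplus>\<^bsub>F\<^esub> D d" by (simp add: fun_eq_iff)
next
  fix r c assume r: "r \<in> carrier R" and c: "c \<in> carrier Q"
  note cl = R.free_moduleD(1)[OF c]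
  have "D (r \<odot>\<^bsub>Q\<^esub> c) i = r \<otimes> D c i" for i
  proof (cases i)
    case (Pair \<mm> w)
    show ?thesis
    proof (cases w)
      case Nil
      then show ?thesis using Pair r aug_simps(3)[OF r c] by (cases "\<mm> = {}") auto
    next
      case (Cons a v)
      then show ?thesis
        using Pair cl r gens_closed[of \<mm> a] by (simp add: R.diff_mult_smult)
    qed
  qed
  then show "D (r \<odot>\<^bsub>Q\<^esub> c) = r \<odot>\<^bsub>F\<^esub> D c" by (simp add: fun_eq_iff)
qed

text \<open>The relator at \<open>(\<mm>, w)\<close> is sent to the value of \<open>w\<close> times
  \<open>1 - (\<Sum> u a \<cdot> coef \<mm> a)\<close>, and the second factor is zero.\<close>

lemma \<rho>_D:
  assumes c: "c \<in> carrier Q"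
  shows "\<rho> (D c) = \<zero>\<^bsub>U\<^esub>"
proof (rule mod_hom_free_module_eqI[OF module_U' mod_hom_comp[OF D_hom \<rho>_hom] _ _ c])
  interpret U': module R U' by (rule module_U')
  show "(\<lambda>_. \<zero>\<^bsub>U\<^esub>) \<in> mod_hom R Q U'" using U'.smult_r_null by (auto simp: mod_hom_def)
  fix s assume s: "s \<in> relation_indices"
  obtain \<mm> w where sw: "s = (\<mm>, w)" by (cases s)
  have \<mm>: "\<mm> \<in> \<Lambda>" and w: "set w \<subseteq> gens \<mm>" using s sw by (auto simp: relation_indices_def)
  let ?b = "basis_vector R s :: 'a set \<times> 'a list \<Rightarrow> 'a"
  let ?ix = "if w = [] then ({}, []) else (\<mm>, w)"
  let ?A = "insert ?ix ((\<lambda>a. (\<mm>, a # w)) ` gens \<mm>)"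
  have bQ: "?b \<in> carrier Q" using s by simp
  have aug: "aug ?b = (if w = [] then \<one> else \<zero>)"
    unfolding aug_def by (subst linear_combination_basis_vector[OF module_R' _ s]) (auto simp: sw)
  \<comment> \<open>At an index \<open>(\<mm>, a # w)\<close> the coefficient is \<open>- a\<close>;
    the letter is recovered as the head of the word.\<close>
  have D_eq: "D ?b i = (if i = ?ix then \<one> else if i \<in> (\<lambda>a. (\<mm>, a # w)) ` gens \<mm> then \<ominus> hd (snd i) else \<zero>)" for i
  proof (cases i)
    case (Pair \<nn> v)
    show ?thesis
    proof (cases v)
      case Nil
      then show ?thesis using Pair aug \<Lambda>_nonempty[OF \<mm>] by (cases "\<nn> = {}") auto
    next
      case (Cons a v')
      then show ?thesis
        using Pair \<mm> w gens_closed[of \<nn> a] by (auto simp: basis_vector_def sw R.minus_eq)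
    qed
  qed
  have fin: "finite (gens \<mm>)" by (rule finite_gens[OF \<mm>])
  have "?A \<subseteq> indices" using \<mm> w by (auto simp: indices_def)
  then have "\<rho> (D ?b) = (\<Oplus>\<^bsub>U'\<^esub>i\<in>?A. D ?b i \<odot>\<^bsub>U'\<^esub> value_at i)"
    unfolding \<rho>_def
    using fin R.free_moduleD(1)[OF D_closed[OF bQ]]
    by (intro linear_combination_eq[OF module_U' value_at_indices]) (auto simp: D_eq)
  also have "\<dots> = (\<Oplus>\<^bsub>U\<^esub>i\<in>?A. u (D ?b i) \<otimes>\<^bsub>U\<^esub> value_at i)"
    by (simp add: finsum_restrict_scalars)
  also have "\<dots> = u (D ?b ?ix) \<otimes>\<^bsub>U\<^esub> value_at ?ix \<oplus>\<^bsub>U\<^esub>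
      (\<Oplus>\<^bsub>U\<^esub>i\<in>(\<lambda>a. (\<mm>, a # w)) ` gens \<mm>. u (D ?b i) \<otimes>\<^bsub>U\<^esub> value_at i)"
    using fin \<mm> R.free_moduleD(1)[OF D_closed[OF bQ]]
    by (intro S.finsum_insert) (auto simp: value_at_closed coef_closed simp del: D_simps)
  also have "(\<Oplus>\<^bsub>U\<^esub>i\<in>(\<lambda>a. (\<mm>, a # w)) ` gens \<mm>. u (D ?b i) \<otimes>\<^bsub>U\<^esub> value_at i)
    = (\<Oplus>\<^bsub>U\<^esub>a\<in>gens \<mm>. u (D ?b (\<mm>, a # w)) \<otimes>\<^bsub>U\<^esub> value_at (\<mm>, a # w))"
    using \<mm> R.free_moduleD(1)[OF D_closed[OF bQ]]
    by (intro S.add.finprod_reindex) (auto simp: value_at_closed coef_closed inj_on_def simp del: D_simps)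
  also have "\<dots> = (\<Oplus>\<^bsub>U\<^esub>a\<in>gens \<mm>. (u a \<otimes>\<^bsub>U\<^esub> coef \<mm> a) \<otimes>\<^bsub>U\<^esub> (\<ominus>\<^bsub>U\<^esub> value_at (\<mm>, w)))"
    unfolding D_eq using \<mm> gens_closed[OF \<mm>]
    by (intro S.finsum_cong')
      (auto simp: value_at_closed coef_closed S.m_assoc S.l_minus S.r_minus)
  also have "\<dots> = (\<Oplus>\<^bsub>U\<^esub>a\<in>gens \<mm>. u a \<otimes>\<^bsub>U\<^esub> coef \<mm> a) \<otimes>\<^bsub>U\<^esub> (\<ominus>\<^bsub>U\<^esub> value_at (\<mm>, w))"
    using \<mm> gens_closed[OF \<mm>] fin
    by (intro S.finsum_ldistr[symmetric]) (auto simp: value_at_closed coef_closed)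
  also have "\<dots> = \<ominus>\<^bsub>U\<^esub> value_at (\<mm>, w)" using \<mm> by (simp add: sum_coef value_at_closed)
  also have "u (D ?b ?ix) \<otimes>\<^bsub>U\<^esub> value_at ?ix = value_at (\<mm>, w)"
    unfolding D_eq using \<mm> by (simp add: value_at_closed)
  finally show "\<rho> (D ?b) = \<zero>\<^bsub>U\<^esub>" using \<mm> by (simp add: value_at_closed S.r_neg)
qed

section \<open>Words outside a maximal ideal, and injectivity of the relator map\<close>

lemma wprod_notin:
  assumes "maximalideal \<nn> R" "a \<in> carrier R" "a \<notin> \<nn>"
  shows "wprod (replicate N a) \<notin> \<nn> \<and> wprod (replicate N a) \<in> carrier R"
  using assms R.maximalideal_m_notin[OF assms(1)] R.maximalideal_one_notin[OF assms(1)]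
  by (induction N) auto

lemma ex_word_notin:
  assumes "\<mm> \<in> \<Lambda>" "maximalideal \<nn> R" "\<nn> \<noteq> \<mm>"
  shows "\<exists>w\<in>words \<mm> N. wprod w \<notin> \<nn>"
proof -
  obtain a where a: "a \<in> gens \<mm>" "a \<notin> \<nn>" using gens_maximal[OF assms(1,2)] assms(3) by blast
  then have "wprod (replicate N a) \<notin> \<nn>" using wprod_notin[OF assms(2)] gens_closed[OF assms(1)] by blast
  moreover have "replicate N a \<in> words \<mm> N" using a by (auto simp: words_def)
  ultimately show ?thesis by blast
qed

text \<open>A product of one word outside \<open>\<nn>\<close> for every
  \<open>\<mm> \<in> L\<close>. Multiplying by \<open>e\<close> treats all the ideals in
  \<open>L\<close> at once without losing information at \<open>\<nn>\<close>.\<close>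

lemma ex_common_multiple_notin:
  assumes "finite L" "L \<subseteq> \<Lambda>" "maximalideal \<nn> R" "\<nn> \<notin> L"
  shows "\<exists>e\<in>carrier R. e \<notin> \<nn> \<and> (\<forall>\<mm>\<in>L. \<exists>w\<in>words \<mm> N. \<exists>b\<in>carrier R. e = wprod w \<otimes> b)"
  using assms
proof (induction L rule: finite_induct)
  case empty
  then show ?case using R.maximalideal_one_notin[OF assms(3)] by blast
next
  case (insert \<mm> L)
  then obtain e where e: "e \<in> carrier R" "e \<notin> \<nn>"
    "\<forall>\<mm>\<in>L. \<exists>w\<in>words \<mm> N. \<exists>b\<in>carrier R. e = wprod w \<otimes> b" by auto
  obtain v where v: "v \<in> words \<mm> N" "wprod v \<notin> \<nn>"
    using ex_word_notin[of \<mm> \<nn> N] insert by auto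
  have vR: "wprod v \<in> carrier R" using v(1) wprod_words_closed[of \<mm> v N] insert by auto
  have "\<exists>w\<in>words \<mm>' N. \<exists>b\<in>carrier R. wprod v \<otimes> e = wprod w \<otimes> b" if m: "\<mm>' \<in> insert \<mm> L" for \<mm>'
  proof (cases "\<mm>' = \<mm>")
    case True
    then show ?thesis using v e by blast
  next
    case False
    then obtain w b where w: "w \<in> words \<mm>' N" "b \<in> carrier R" "e = wprod w \<otimes> b" using e(3) m by blast
    have "wprod w \<in> carrier R" using w(1) wprod_words_closed[of \<mm>' w N] m insert by auto
    then have "wprod v \<otimes> e = wprod w \<otimes> (wprod v \<otimes> b)" using w vR by (simp add: R.m_lcomm)
    then show ?thesis using w vR by blast
  qed
  then show ?case
    using R.maximalideal_m_notin[OF assms(3) vR e(1) v(2) e(2)] vR e(1) by (intro bexI[of _ "wprod v \<otimes> e"]) auto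
qed

text \<open>The nonempty coordinates of \<open>D c = 0\<close> force
  \<open>c (\<mm>, w) = wprod w \<otimes> t\<close> with \<open>t = c (\<mm>, [])\<close>. Finite
  support makes long words kill \<open>t\<close>, so \<open>t\<close> vanishes at every maximal
  ideal other than \<open>\<mm>\<close>. At \<open>\<mm>\<close> the root coordinate says that the
  various \<open>t\<close> sum to zero, and those belonging to other ideals vanish there.\<close>

lemma D_zero_imp:
  assumes c: "c \<in> carrier Q" and Dc: "D c = (\<lambda>_. \<zero>)"
  shows "c = (\<lambda>_. \<zero>)"
proof -
  note cl = R.free_moduleD[OF c]
  have step: "c (\<mm>, a # v) = a \<otimes> c (\<mm>, v)" if "\<mm> \<in> \<Lambda>" "a \<in> gens \<mm>" for \<mm> a v
  proof -
    have "c (\<mm>, a # v) \<ominus> a \<otimes> c (\<mm>, v) = \<zero>" using fun_cong[OF Dc, of "(\<mm>, a # v)"] that by simp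
    then show ?thesis using cl(1) gens_closed[OF that] by (simp add: R.r_right_minus_eq)
  qed
  have c_word: "c (\<mm>, w) = wprod w \<otimes> c (\<mm>, [])" if "\<mm> \<in> \<Lambda>" "set w \<subseteq> gens \<mm>" for \<mm> w
    using that(2)
    by (induction w) (use cl(1) gens_closed[OF that(1)] words_carrier[OF that(1)] in
        \<open>auto simp: step[OF that(1)] R.m_assoc\<close>)
  \<comment> \<open>\<open>N\<close> exceeds the length of every word in the support; the inserted
    root keeps the maximum defined when the support is empty.\<close>
  define N where "N = Suc (Max (length ` snd ` insert ({}, []) {i. c i \<noteq> \<zero>}))"
  have big: "c (\<mm>, w) = \<zero>" if "length w \<ge> N" for \<mm> w
  proof (rule ccontr)
    assume "c (\<mm>, w) \<noteq> \<zero>"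
    then have "length w \<in> length ` snd ` insert ({}, []) {i. c i \<noteq> \<zero>}" by force
    then have "length w < N" unfolding N_def using cl(3) by (intro le_imp_less_Suc Max_ge) auto
    then show False using that by simp
  qed
  have kill: "wprod w \<otimes> c (\<mm>, []) = \<zero>" if "\<mm> \<in> \<Lambda>" "w \<in> words \<mm> N" for \<mm> w
    using c_word[OF that(1), of w] big[of w \<mm>] that(2) by (simp add: words_def)
  have aug0: "aug c = \<zero>" using fun_cong[OF Dc, of "({}, [])"] by simp
  have c0: "c (\<mm>, []) = \<zero>" if \<mm>: "\<mm> \<in> \<Lambda>" for \<mm>
  proof -
    let ?t = "c (\<mm>, [])" and ?X = "{f \<in> carrier R. f \<otimes> c (\<mm>, []) = \<zero>}"
    have "ideal ?X R" by (rule R.idealI_smult) (use cl(1) in \<open>auto simp: R.l_distr R.m_assoc\<close>)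
    moreover have "\<exists>f\<in>?X. f \<notin> \<nn>" if \<nn>: "maximalideal \<nn> R" for \<nn>
    proof (cases "\<nn> = \<mm>")
      case False
      then obtain w where "w \<in> words \<mm> N" "wprod w \<notin> \<nn>" using ex_word_notin[OF \<mm> \<nn>] by blast
      then show ?thesis using kill[OF \<mm>] wprod_words_closed[OF \<mm>] by blast
    next
      case True
      \<comment> \<open>A factor \<open>e\<close> outside \<open>\<mm>\<close> kills the
        coefficients at all other empty words, so \<open>e \<otimes> aug c\<close> reduces to
        \<open>e \<otimes> c (\<mm>, [])\<close>.\<close>
      define L where "L = {\<nn>. c (\<nn>, []) \<noteq> \<zero>} - {\<mm>}"
      have "(\<lambda>\<nn>. (\<nn>, [])) ` L \<subseteq> {i. c i \<noteq> \<zero>}" by (auto simp: L_def)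
      then have "finite ((\<lambda>\<nn>. (\<nn>, [] :: 'a list)) ` L)" using cl(3) finite_subset by blast
      then have "finite L" by (rule finite_imageD) (simp add: inj_on_def)
      moreover have "L \<subseteq> \<Lambda>" using cl(2) by (auto simp: L_def relation_indices_def)
      ultimately obtain e where e: "e \<in> carrier R" "e \<notin> \<mm>"
        "\<forall>\<nn>\<in>L. \<exists>w\<in>words \<nn> N. \<exists>b\<in>carrier R. e = wprod w \<otimes> b"
        using ex_common_multiple_notin[of L \<mm> N] maximal_\<Lambda>[OF \<mm>] by (auto simp: L_def)
      have "e \<otimes> c (\<nn>, []) = \<zero>" if "\<nn> \<noteq> \<mm>" for \<nn>
      proof (cases "\<nn> \<in> L")
        case True
        then obtain w b where w: "w \<in> words \<nn> N" "b \<in> carrier R" "e = wprod w \<otimes> b" using e(3) by blast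
        have "\<nn> \<in> \<Lambda>" using True \<open>L \<subseteq> \<Lambda>\<close> by blast
        then have "e \<otimes> c (\<nn>, []) = b \<otimes> (wprod w \<otimes> c (\<nn>, []))"
          using w cl(1) wprod_words_closed[of \<nn> w N] by (simp add: R.m_ac)
        then show ?thesis using kill[OF \<open>\<nn> \<in> \<Lambda>\<close> w(1)] w(2) by simp
      next
        case False
        then show ?thesis using that e(1) by (simp add: L_def)
      qed
      then have "aug (e \<odot>\<^bsub>Q\<^esub> c) = (e \<odot>\<^bsub>Q\<^esub> c) (\<mm>, [])"
        using c e(1) by (intro aug_single Q.smult_closed) auto
      then have "e \<otimes> c (\<mm>, []) = \<zero>" using aug_simps(3)[OF e(1) c] aug0 e(1) by simp
      then show ?thesis using e True by blast
    qed
    ultimately have "\<one> \<in> ?X" by (rule R.one_in_ideal_if_local)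
    then show ?thesis using cl(1) by simp
  qed
  have "c i = \<zero>" for i
  proof (cases "i \<in> relation_indices")
    case True
    then obtain \<mm> w where "i = (\<mm>, w)" "\<mm> \<in> \<Lambda>" "set w \<subseteq> gens \<mm>" by (auto simp: relation_indices_def)
    then show ?thesis using c_word[of \<mm> w] c0[of \<mm>] words_carrier[of \<mm> w] by simp
  qed (rule cl(2))
  then show ?thesis by blast
qed

lemma inj_on_D: "inj_on D (carrier Q)"
proof (rule inj_onI)
  fix c d assume c: "c \<in> carrier Q" and d: "d \<in> carrier Q" and eq: "D c = D d"
  note cl = R.free_moduleD(1)[OF c] R.free_moduleD(1)[OF d]
  let ?d = "(\<ominus> \<one>) \<odot>\<^bsub>Q\<^esub> d"
  have d': "?d \<in> carrier Q" using d by (intro Q.smult_closed) auto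
  have "D (c \<oplus>\<^bsub>Q\<^esub> ?d) = D c \<oplus>\<^bsub>F\<^esub> (\<ominus> \<one>) \<odot>\<^bsub>F\<^esub> D d"
    using mod_hom_add[OF D_hom c d'] mod_hom_smult[OF D_hom _ d, of "\<ominus> \<one>"] by simp
  also have "\<dots> = (\<lambda>_. \<zero>)"
    using R.free_moduleD(1)[OF D_closed[OF d]] by (simp add: eq R.l_minus R.r_neg)
  finally have "c \<oplus>\<^bsub>Q\<^esub> ?d = (\<lambda>_. \<zero>)" by (rule D_zero_imp[OF Q.a_closed[OF c d']])
  then have "c i \<oplus> (\<ominus> \<one>) \<otimes> d i = \<zero>" for i by (simp add: fun_eq_iff del: split_paired_All)
  then have "c i \<ominus> d i = \<zero>" for i using cl by (simp add: R.minus_eq R.l_minus)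
  then have "c i = d i" for i using cl R.r_right_minus_eq by blast
  then show "c = d" by blast
qed

text \<open>Expanding the root \<open>N\<close> times telescopes: with
  \<open>c (\<mm>, w) = wprod w \<otimes> s \<mm>\<close> on words shorter than \<open>N\<close>,
  the contributions of intermediate lengths cancel. What remains is \<open>s \<mm>\<close> at the
  root and \<open>- wprod w \<otimes> s \<mm>\<close> on words of length \<open>N\<close>.
  Positivity of \<open>N\<close> makes the empty word count as shorter.\<close>

lemma ex_unwinding:
  assumes "finite L" "L \<subseteq> \<Lambda>" "\<And>\<mm>. \<mm> \<in> L \<Longrightarrow> s \<mm> \<in> carrier R" "N > 0"
  shows "\<exists>c\<in>carrier Q.
    (\<forall>\<mm> w. w \<noteq> [] \<longrightarrow> D c (\<mm>, w) = (if \<mm> \<in> L \<and> w \<in> words \<mm> N then \<ominus> (wprod w \<otimes> s \<mm>) else \<zero>)) \<and>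
    (\<forall>\<mm>. L = {\<mm>} \<longrightarrow> aug c = s \<mm>)"
proof -
  define c where "c = (\<lambda>(\<mm>, w). if \<mm> \<in> L \<and> set w \<subseteq> gens \<mm> \<and> length w < N then wprod w \<otimes> s \<mm> else \<zero>)"
  have c_eq: "c (\<mm>, w) = (if \<mm> \<in> L \<and> set w \<subseteq> gens \<mm> \<and> length w < N then wprod w \<otimes> s \<mm> else \<zero>)" for \<mm> w
    by (simp add: c_def)
  have cl: "c i \<in> carrier R" for i
    using assms words_carrier by (cases i) (auto simp: c_eq subset_iff)
  have "{i. c i \<noteq> \<zero>} \<subseteq> (\<Union>\<mm>\<in>L. \<Union>k\<in>{..<N}. Pair \<mm> ` words \<mm> k)"
  proof
    fix i assume "i \<in> {i. c i \<noteq> \<zero>}"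
    moreover obtain \<mm> w where i: "i = (\<mm>, w)" by (cases i)
    ultimately have "\<mm> \<in> L" "length w < N" "w \<in> words \<mm> (length w)"
      by (auto simp: c_eq words_def split: if_splits)
    then show "i \<in> (\<Union>\<mm>\<in>L. \<Union>k\<in>{..<N}. Pair \<mm> ` words \<mm> k)" unfolding i by blast
  qed
  moreover have "finite (\<Union>\<mm>\<in>L. \<Union>k\<in>{..<N}. Pair \<mm> ` words \<mm> k)"
    using assms finite_words by blast
  ultimately have fin: "finite {i. c i \<noteq> \<zero>}" by (rule finite_subset)
  have "c i = \<zero>" if "i \<notin> relation_indices" for i
    using that assms(2) by (cases i) (auto simp: c_eq relation_indices_def)
  with cl fin have c: "c \<in> carrier Q" by (intro R.free_moduleI) blast+
  have "D c (\<mm>, w) = (if \<mm> \<in> L \<and> w \<in> words \<mm> N then \<ominus> (wprod w \<otimes> s \<mm>) else \<zero>)" if "w \<noteq> []" for \<mm> w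
  proof -
    obtain a v where w: "w = a # v" using \<open>w \<noteq> []\<close> by (cases w) auto
    show ?thesis
    proof (cases "\<mm> \<in> L \<and> set w \<subseteq> gens \<mm>")
      case False
      then show ?thesis using w gens_closed[of \<mm> a] by (auto simp: c_eq words_def R.minus_eq)
    next
      case True
      then have "\<mm> \<in> \<Lambda>" "a \<in> gens \<mm>" "a \<in> carrier R" "wprod v \<in> carrier R" "s \<mm> \<in> carrier R"
        using w assms(2,3) gens_closed[of \<mm> a] words_carrier[of \<mm> v] by auto
      then show ?thesis
        using True w by (auto simp: c_eq words_def R.minus_eq R.m_assoc R.r_neg)
    qed
  qed
  moreover have "aug c = s \<mm>" if "L = {\<mm>}" for \<mm>
    using aug_single[OF c, of \<mm>] assms(3,4) that by (auto simp: c_eq)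
  ultimately show ?thesis using c by blast
qed

section \<open>Values in \<open>U\<close> of combinations of words of one length\<close>

lemma \<rho>_words:
  assumes \<mm>: "\<mm> \<in> \<Lambda>" and z: "z \<in> carrier F" and N: "N > 0"
    and supp: "\<And>i. i \<notin> Pair \<mm> ` words \<mm> N \<Longrightarrow> z i = \<zero>"
  shows "\<rho> z = (\<Oplus>\<^bsub>U\<^esub>w\<in>words \<mm> N. u (z (\<mm>, w)) \<otimes>\<^bsub>U\<^esub> value_at (\<mm>, w))"
proof -
  let ?A = "Pair \<mm> ` words \<mm> N"
  note cl = R.free_moduleD(1)[OF z]
  have "?A \<subseteq> indices" using \<mm> N by (auto simp: words_def indices_def)
  then have "\<rho> z = (\<Oplus>\<^bsub>U'\<^esub>i\<in>?A. z i \<odot>\<^bsub>U'\<^esub> value_at i)"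
    unfolding \<rho>_def using cl finite_words[OF \<mm>]
    by (intro linear_combination_eq[OF module_U' value_at_indices]) (use supp in blast)+
  also have "\<dots> = (\<Oplus>\<^bsub>U\<^esub>i\<in>?A. u (z i) \<otimes>\<^bsub>U\<^esub> value_at i)"
    by (simp add: finsum_restrict_scalars)
  also have "\<dots> = (\<Oplus>\<^bsub>U\<^esub>w\<in>words \<mm> N. u (z (\<mm>, w)) \<otimes>\<^bsub>U\<^esub> value_at (\<mm>, w))"
    using cl \<mm> by (intro S.add.finprod_reindex) (auto simp: value_at_closed inj_on_def)
  finally show ?thesis .
qed

text \<open>The copy of \<open>R\<close> along which the modules at the various \<open>\<mm>\<close>
  are amalgamated.\<close>

definition root :: "'a \<Rightarrow> 'a set \<times> 'a list \<Rightarrow> 'a" where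
  "root r = r \<odot>\<^bsub>F\<^esub> basis_vector R ({}, [])"

lemma root_eq: "r \<in> carrier R \<Longrightarrow> root r i = (if i = ({}, []) then r else \<zero>)"
  by (simp add: root_def basis_vector_def)

lemma root_closed: "r \<in> carrier R \<Longrightarrow> root r \<in> carrier F"
  unfolding root_def by (intro F.smult_closed) (auto simp: indices_def)

lemma \<rho>_root: "r \<in> carrier R \<Longrightarrow> \<rho> (root r) = u r"
  unfolding root_def using linear_combination_basis_vector[OF module_U' value_at_indices, of "({}, [])"]
  by (subst \<rho>_simps(3)) (auto simp: \<rho>_def indices_def)

text \<open>This is the \<open>N\<close>-th power of
  \<open>\<Sum> u a \<cdot> coef \<mm> a = 1\<close>. It results from applying \<open>\<rho>\<close>
  to the unwinding of the root, since \<open>\<rho>\<close> vanishes on relators.\<close>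

lemma sum_words:
  assumes \<mm>: "\<mm> \<in> \<Lambda>" and N: "N > 0"
  shows "(\<Oplus>\<^bsub>U\<^esub>w\<in>words \<mm> N. u (wprod w) \<otimes>\<^bsub>U\<^esub> value_at (\<mm>, w)) = \<one>\<^bsub>U\<^esub>"
proof -
  obtain c where c: "c \<in> carrier Q" "aug c = \<one>"
    "\<And>\<nn> w. w \<noteq> [] \<Longrightarrow> D c (\<nn>, w) = (if \<nn> = \<mm> \<and> w \<in> words \<mm> N then \<ominus> wprod w else \<zero>)"
    using ex_unwinding[of "{\<mm>}" "\<lambda>_. \<one>" N] \<mm> N wprod_words_closed[OF \<mm>] by fastforce
  let ?z = "root \<one> \<oplus>\<^bsub>F\<^esub> (\<ominus> \<one>) \<odot>\<^bsub>F\<^esub> D c"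
  have z: "?z \<in> carrier F"
    by (intro F.a_closed F.smult_closed root_closed D_closed c) auto
  have z_eq: "?z i = (if i \<in> Pair \<mm> ` words \<mm> N then wprod (snd i) else \<zero>)" for i
  proof (cases i)
    case (Pair \<nn> w)
    show ?thesis
    proof (cases "w = []")
      case True
      then show ?thesis using Pair c(2) N by (cases "\<nn> = {}") (auto simp: root_eq words_def R.l_minus R.r_neg)
    next
      case False
      then show ?thesis using Pair c(3) wprod_words_closed[OF \<mm>] by (auto simp: root_eq R.l_minus)
    qed
  qed
  have "\<rho> ?z = u \<one> \<oplus>\<^bsub>U\<^esub> u (\<ominus> \<one>) \<otimes>\<^bsub>U\<^esub> \<zero>\<^bsub>U\<^esub>"
    using \<rho>_D[OF c(1)] D_closed[OF c(1)] root_closed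
    by (simp add: \<rho>_simps(2,3) \<rho>_root F.smult_closed del: free_module_simps)
  also have "\<dots> = \<one>\<^bsub>U\<^esub>" by simp
  also have "\<rho> ?z = (\<Oplus>\<^bsub>U\<^esub>w\<in>words \<mm> N. u (?z (\<mm>, w)) \<otimes>\<^bsub>U\<^esub> value_at (\<mm>, w))"
    by (rule \<rho>_words[OF \<mm> z N]) (simp only: z_eq if_False)
  also have "\<dots> = (\<Oplus>\<^bsub>U\<^esub>w\<in>words \<mm> N. u (wprod w) \<otimes>\<^bsub>U\<^esub> value_at (\<mm>, w))"
    unfolding z_eq using \<mm> wprod_words_closed[OF \<mm>]
    by (intro S.finsum_cong') (auto simp: value_at_closed)
  finally show ?thesis by simp
qed

text \<open>Factoring out \<open>y\<close> leaves the sum in \<open>sum_words\<close>. This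
  recognises a combination of words as a lift of a prescribed element of \<open>U\<close>.\<close>

lemma \<rho>_compatible:
  assumes \<mm>: "\<mm> \<in> \<Lambda>" and z: "z \<in> carrier F" and N: "N > 0" and y: "y \<in> carrier U"
    and supp: "\<And>i. i \<notin> Pair \<mm> ` words \<mm> N \<Longrightarrow> z i = \<zero>"
    and eq: "\<And>w. w \<in> words \<mm> N \<Longrightarrow> u (z (\<mm>, w)) = u (wprod w) \<otimes>\<^bsub>U\<^esub> y"
  shows "\<rho> z = y"
proof -
  have "\<rho> z = (\<Oplus>\<^bsub>U\<^esub>w\<in>words \<mm> N. u (z (\<mm>, w)) \<otimes>\<^bsub>U\<^esub> value_at (\<mm>, w))"
    by (rule \<rho>_words[OF \<mm> z N supp])
  also have "\<dots> = (\<Oplus>\<^bsub>U\<^esub>w\<in>words \<mm> N. (u (wprod w) \<otimes>\<^bsub>U\<^esub> value_at (\<mm>, w)) \<otimes>\<^bsub>U\<^esub> y)"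
    using \<mm> wprod_words_closed[OF \<mm>] y by (intro S.finsum_cong') (auto simp: eq value_at_closed S.m_ac)
  also have "\<dots> = y"
    using \<mm> wprod_words_closed[OF \<mm>] y finite_words[OF \<mm>] sum_words[OF \<mm> N]
    by (subst S.finsum_ldistr[symmetric]) (auto simp: value_at_closed)
  finally show ?thesis .
qed

section \<open>Compatible elements\<close>

lemma F_index:
  assumes "z \<in> carrier F" "w \<noteq> []" "z (\<mm>, w) \<noteq> \<zero>"
  shows "\<mm> \<in> \<Lambda>" "set w \<subseteq> gens \<mm>"
  using R.free_moduleD(2)[OF assms(1), of "(\<mm>, w)"] assms(2,3) by (auto simp: indices_def)

lemma F_empty_word: "\<lbrakk>z \<in> carrier F; \<mm> \<noteq> {}\<rbrakk> \<Longrightarrow> z (\<mm>, []) = \<zero>"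
  using R.free_moduleD(2)[of z indices "(\<mm>, [])"] by (auto simp: indices_def)

text \<open>
  On words of length \<open>N\<close> at \<open>\<mm>\<close> a compatible element looks like \<open>w \<mapsto> wprod w \<cdot> y\<close> for an
  element \<open>y\<close> that need not exist in \<open>R\<close>.
\<close>

definition compatible :: "nat \<Rightarrow> ('a set \<times> 'a list \<Rightarrow> 'a) set" where
  "compatible N = {z \<in> carrier F. (\<forall>\<mm> w. w \<noteq> [] \<longrightarrow> length w \<noteq> N \<longrightarrow> z (\<mm>, w) = \<zero>) \<and>
     (\<forall>\<mm>\<in>\<Lambda>. \<forall>v\<in>words \<mm> N. \<forall>w\<in>words \<mm> N. wprod v \<otimes> z (\<mm>, w) = wprod w \<otimes> z (\<mm>, v))}"

lemma compatibleD:
  assumes "z \<in> compatible N"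
  shows "z \<in> carrier F" "\<lbrakk>w \<noteq> []; length w \<noteq> N\<rbrakk> \<Longrightarrow> z (\<mm>, w) = \<zero>"
    "\<lbrakk>\<mm> \<in> \<Lambda>; v \<in> words \<mm> N; w \<in> words \<mm> N\<rbrakk> \<Longrightarrow> wprod v \<otimes> z (\<mm>, w) = wprod w \<otimes> z (\<mm>, v)"
  using assms by (auto simp: compatible_def)

lemma compatible_zero_outside:
  assumes "z \<in> compatible N" "w \<noteq> []" "w \<notin> words \<mm> N"
  shows "z (\<mm>, w) = \<zero>"
  using compatibleD(1,2)[OF assms(1)] F_index(2)[of z w \<mm>] assms(2,3) by (auto simp: words_def)

lemma compatible_add:
  assumes y: "y \<in> compatible N" and z: "z \<in> compatible N"
  shows "y \<oplus>\<^bsub>F\<^esub> z \<in> compatible N"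
  unfolding compatible_def
proof (intro CollectI conjI allI impI ballI)
  show "y \<oplus>\<^bsub>F\<^esub> z \<in> carrier F" by (intro F.a_closed compatibleD(1)[OF y] compatibleD(1)[OF z])
  show "(y \<oplus>\<^bsub>F\<^esub> z) (\<mm>, w) = \<zero>" if "w \<noteq> []" "length w \<noteq> N" for \<mm> w
    using compatibleD(2)[OF y that] compatibleD(2)[OF z that] by simp
  show "wprod v \<otimes> (y \<oplus>\<^bsub>F\<^esub> z) (\<mm>, w) = wprod w \<otimes> (y \<oplus>\<^bsub>F\<^esub> z) (\<mm>, v)"
    if "\<mm> \<in> \<Lambda>" "v \<in> words \<mm> N" "w \<in> words \<mm> N" for \<mm> v w
    using compatibleD(3)[OF y that] compatibleD(3)[OF z that] wprod_words_closed[OF that(1)] that(2,3)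
      R.free_moduleD(1)[OF compatibleD(1)[OF y]] R.free_moduleD(1)[OF compatibleD(1)[OF z]]
    by (simp add: R.r_distr)
qed

lemma compatible_smult:
  assumes r: "r \<in> carrier R" and z: "z \<in> compatible N"
  shows "r \<odot>\<^bsub>F\<^esub> z \<in> compatible N"
  unfolding compatible_def
proof (intro CollectI conjI allI impI ballI)
  show "r \<odot>\<^bsub>F\<^esub> z \<in> carrier F" by (intro F.smult_closed r compatibleD(1)[OF z])
  show "(r \<odot>\<^bsub>F\<^esub> z) (\<mm>, w) = \<zero>" if "w \<noteq> []" "length w \<noteq> N" for \<mm> w
    using compatibleD(2)[OF z that] r by simp
  show "wprod v \<otimes> (r \<odot>\<^bsub>F\<^esub> z) (\<mm>, w) = wprod w \<otimes> (r \<odot>\<^bsub>F\<^esub> z) (\<mm>, v)"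
    if "\<mm> \<in> \<Lambda>" "v \<in> words \<mm> N" "w \<in> words \<mm> N" for \<mm> v w
    using compatibleD(3)[OF z that] wprod_words_closed[OF that(1)] that(2,3) r
      R.free_moduleD(1)[OF compatibleD(1)[OF z]]
    by (simp add: R.m_lcomm[of _ r])
qed

lemma compatible_root: "r \<in> carrier R \<Longrightarrow> root r \<in> compatible N"
  using root_closed wprod_words_closed \<Lambda>_nonempty by (auto simp: compatible_def root_eq)

text \<open>Each nonempty word is expanded by its relator, \<open>w\<close> becoming
  \<open>\<Sum> a \<cdot> (a # w)\<close>. Compatibility survives, because for words
  \<open>a # v\<close> and \<open>b # w\<close> both sides acquire the same factor
  \<open>a \<otimes> b\<close>.\<close>

lemma compatible_lengthen1:
  assumes z: "z \<in> compatible N" and N: "N > 0"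
  shows "\<exists>y\<in>compatible (Suc N). \<exists>c\<in>carrier Q. z = y \<oplus>\<^bsub>F\<^esub> D c \<and> y ({}, []) = z ({}, []) \<and>
    (\<forall>\<mm>\<in>\<Lambda>. \<forall>a\<in>gens \<mm>. \<forall>w\<in>words \<mm> N. y (\<mm>, a # w) = a \<otimes> z (\<mm>, w))"
proof -
  note zF = compatibleD(1)[OF z] and zcl = R.free_moduleD(1)[OF compatibleD(1)[OF z]]
  \<comment> \<open>The empty word is left out, so \<open>aug c = 0\<close> and the root coefficient
    stays as it is.\<close>
  define c where "c i = (if snd i = [] then \<zero> else z i)" for i
  have c: "c \<in> carrier Q"
  proof (rule R.free_moduleI)
    show "c i \<in> carrier R" for i using zcl by (simp add: c_def)
    show "c i = \<zero>" if "i \<notin> relation_indices" for i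
      using that F_index[OF zF, of "snd i" "fst i"] by (cases i) (auto simp: c_def relation_indices_def)
    have "{i. c i \<noteq> \<zero>} \<subseteq> {i. z i \<noteq> \<zero>}" by (auto simp: c_def)
    then show "finite {i. c i \<noteq> \<zero>}" using R.free_moduleD(3)[OF zF] by (rule finite_subset)
  qed
  have aug: "aug c = \<zero>" using aug_single[OF c, of "{}"] by (simp add: c_def)
  define y where "y = z \<oplus>\<^bsub>F\<^esub> (\<ominus> \<one>) \<odot>\<^bsub>F\<^esub> D c"
  have yF: "y \<in> carrier F" unfolding y_def by (intro F.a_closed F.smult_closed D_closed c zF) auto
  have z_eq: "z = y \<oplus>\<^bsub>F\<^esub> D c"
    unfolding y_def using zcl R.free_moduleD(1)[OF D_closed[OF c]]
    by (simp add: fun_eq_iff R.l_minus R.a_assoc R.l_neg del: split_paired_All)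
  have y_empty: "y ({}, []) = z ({}, [])" using zcl by (simp add: y_def aug)
  have y_Cons: "y (\<mm>, a # v) = (if \<mm> \<in> \<Lambda> \<and> a \<in> gens \<mm> \<and> v \<noteq> [] then a \<otimes> z (\<mm>, v) else \<zero>)" for \<mm> a v
  proof (cases "\<mm> \<in> \<Lambda> \<and> a \<in> gens \<mm>")
    case False
    then have "z (\<mm>, a # v) = \<zero>" using F_index[OF zF, of "a # v" \<mm>] by auto
    then show ?thesis using False by (auto simp: y_def)
  next
    case True
    have *: "x \<oplus> (\<ominus> \<one>) \<otimes> (x \<ominus> q) = q" if "x \<in> carrier R" "q \<in> carrier R" for x q
      using that by algebra
    have a: "a \<in> carrier R" using True gens_closed by blast
    then have "a \<otimes> c (\<mm>, v) \<in> carrier R" using zcl by (simp add: c_def)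
    then have "y (\<mm>, a # v) = a \<otimes> c (\<mm>, v)"
      using True zcl *[of "z (\<mm>, a # v)" "a \<otimes> c (\<mm>, v)"] by (simp add: y_def c_def)
    then show ?thesis using True a by (simp add: c_def)
  qed
  have "y \<in> compatible (Suc N)"
    unfolding compatible_def
  proof (intro CollectI conjI allI impI ballI yF)
    fix \<mm> and w :: "'a list" assume "w \<noteq> []" "length w \<noteq> Suc N"
    then obtain a v where w: "w = a # v" "length v \<noteq> N" by (cases w) auto
    then show "y (\<mm>, w) = \<zero>"
      using compatibleD(2)[OF z, of v \<mm>] gens_closed[of \<mm> a] by (auto simp: y_Cons)
  next
    fix \<mm> v w assume \<mm>: "\<mm> \<in> \<Lambda>" and v: "v \<in> words \<mm> (Suc N)" and w: "w \<in> words \<mm> (Suc N)"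
    obtain a v' where v': "v = a # v'" "a \<in> gens \<mm>" "v' \<in> words \<mm> N"
      using v by (cases v) (auto simp: words_def)
    obtain b w' where w': "w = b # w'" "b \<in> gens \<mm>" "w' \<in> words \<mm> N"
      using w by (cases w) (auto simp: words_def)
    have ne: "v' \<noteq> []" "w' \<noteq> []" using v'(3) w'(3) N by (auto simp: words_def)
    have cl: "a \<in> carrier R" "b \<in> carrier R" "wprod v' \<in> carrier R" "wprod w' \<in> carrier R"
      "z (\<mm>, v') \<in> carrier R" "z (\<mm>, w') \<in> carrier R"
      using gens_closed[OF \<mm>] wprod_words_closed[OF \<mm>] v' w' zcl by auto
    have "wprod v \<otimes> y (\<mm>, w) = a \<otimes> b \<otimes> (wprod v' \<otimes> z (\<mm>, w'))"
      using \<mm> v' w' ne cl by (simp add: y_Cons R.m_ac)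
    also have "\<dots> = a \<otimes> b \<otimes> (wprod w' \<otimes> z (\<mm>, v'))" using compatibleD(3)[OF z \<mm> v'(3) w'(3)] by simp
    also have "\<dots> = wprod w \<otimes> y (\<mm>, v)"
      using \<mm> v' w' ne cl by (simp add: y_Cons R.m_ac)
    finally show "wprod v \<otimes> y (\<mm>, w) = wprod w \<otimes> y (\<mm>, v)" .
  qed
  moreover have "\<forall>\<mm>\<in>\<Lambda>. \<forall>a\<in>gens \<mm>. \<forall>w\<in>words \<mm> N. y (\<mm>, a # w) = a \<otimes> z (\<mm>, w)"
    using N by (auto simp: y_Cons words_def)
  ultimately show ?thesis using c z_eq y_empty by blast
qed

text \<open>Lengthening serves two ends: elements of different lengths can be added, and
  coefficients killed by all words of length \<open>k\<close> disappear modulo relators.\<close>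

lemma compatible_lengthen:
  assumes z: "z \<in> compatible N" and N: "N > 0"
  shows "\<exists>y\<in>compatible (N + k). \<exists>c\<in>carrier Q. z = y \<oplus>\<^bsub>F\<^esub> D c \<and> y ({}, []) = z ({}, []) \<and>
    (\<forall>\<mm>\<in>\<Lambda>. \<forall>v\<in>words \<mm> k. \<forall>w\<in>words \<mm> N. y (\<mm>, v @ w) = wprod v \<otimes> z (\<mm>, w))"
proof (induction k)
  case 0
  note zcl = R.free_moduleD(1)[OF compatibleD(1)[OF z]]
  have "z = z \<oplus>\<^bsub>F\<^esub> D \<zero>\<^bsub>Q\<^esub>"
    using mod_hom_zero[OF module_Q module_F D_hom] F.r_zero[OF compatibleD(1)[OF z]] by simp
  then show ?case
    using z zcl by (intro bexI[of _ z] bexI[of _ "\<zero>\<^bsub>Q\<^esub>"]) (auto simp: words_def intro: Q.zero_closed simp del: free_module_simps)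
next
  case (Suc k)
  then obtain y c where y: "y \<in> compatible (N + k)" and c: "c \<in> carrier Q" and
    z_eq: "z = y \<oplus>\<^bsub>F\<^esub> D c" "y ({}, []) = z ({}, [])"
    and y_eq: "\<And>\<mm> v w. \<mm> \<in> \<Lambda> \<Longrightarrow> v \<in> words \<mm> k \<Longrightarrow> w \<in> words \<mm> N \<Longrightarrow> y (\<mm>, v @ w) = wprod v \<otimes> z (\<mm>, w)"
    by blast
  obtain y' c' where y': "y' \<in> compatible (Suc (N + k))" and c': "c' \<in> carrier Q" and
    y_eq': "y = y' \<oplus>\<^bsub>F\<^esub> D c'" "y' ({}, []) = y ({}, [])"
    "\<And>\<mm> a w. \<mm> \<in> \<Lambda> \<Longrightarrow> a \<in> gens \<mm> \<Longrightarrow> w \<in> words \<mm> (N + k) \<Longrightarrow> y' (\<mm>, a # w) = a \<otimes> y (\<mm>, w)"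
    using compatible_lengthen1[OF y] N by (metis add_pos_nonneg le0)
  have "z = y' \<oplus>\<^bsub>F\<^esub> (D c' \<oplus>\<^bsub>F\<^esub> D c)"
    unfolding z_eq(1) y_eq'(1) by (intro F.a_assoc compatibleD(1)[OF y'] D_closed c c')
  also have "D c' \<oplus>\<^bsub>F\<^esub> D c = D (c' \<oplus>\<^bsub>Q\<^esub> c)" using mod_hom_add[OF D_hom c' c] by (rule sym)
  finally have "z = y' \<oplus>\<^bsub>F\<^esub> D (c' \<oplus>\<^bsub>Q\<^esub> c)" .
  moreover have "c' \<oplus>\<^bsub>Q\<^esub> c \<in> carrier Q" by (rule Q.a_closed[OF c' c])
  moreover have "y' (\<mm>, v @ w) = wprod v \<otimes> z (\<mm>, w)"
    if \<mm>: "\<mm> \<in> \<Lambda>" and v: "v \<in> words \<mm> (Suc k)" and w: "w \<in> words \<mm> N" for \<mm> v w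
  proof -
    obtain a v' where v': "v = a # v'" "a \<in> gens \<mm>" "v' \<in> words \<mm> k"
      using v by (cases v) (auto simp: words_def)
    then have "v' @ w \<in> words \<mm> (N + k)" using w by (auto simp: words_def)
    then have "y' (\<mm>, v @ w) = a \<otimes> (wprod v' \<otimes> z (\<mm>, w))"
      using y_eq'(3)[OF \<mm> v'(2)] y_eq[OF \<mm> v'(3) w] v'(1) by simp
    then show ?thesis
      using v' wprod_words_closed[OF \<mm> v'(3)] gens_closed[OF \<mm>] R.free_moduleD(1)[OF compatibleD(1)[OF z]]
      by (simp add: R.m_assoc)
  qed
  ultimately show ?case
    using y' y_eq'(2) z_eq(2) by (intro bexI[of _ y'] bexI[of _ "c' \<oplus>\<^bsub>Q\<^esub> c"]) auto
qed

section \<open>Compatible elements in the kernel are relators\<close>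

definition relators :: "('a set \<times> 'a list \<Rightarrow> 'a) set" where
  "relators = D ` carrier Q"

lemma relators_add: "\<lbrakk>x \<in> relators; y \<in> relators\<rbrakk> \<Longrightarrow> x \<oplus>\<^bsub>F\<^esub> y \<in> relators"
  unfolding relators_def by (elim imageE) (simp only: mod_hom_add[OF D_hom, symmetric] Q.a_closed imageI)

lemma relators_smult: "\<lbrakk>r \<in> carrier R; x \<in> relators\<rbrakk> \<Longrightarrow> r \<odot>\<^bsub>F\<^esub> x \<in> relators"
  unfolding relators_def by (elim imageE) (simp only: mod_hom_smult[OF D_hom, symmetric] Q.smult_closed imageI)

lemma relators_zero: "(\<lambda>_. \<zero>) \<in> relators"
  unfolding relators_def using mod_hom_zero[OF module_Q module_F D_hom] Q.zero_closed by force

lemma relators_closed: "x \<in> relators \<Longrightarrow> x \<in> carrier F"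
  by (auto simp: relators_def D_closed)

lemma \<rho>_relators: "x \<in> relators \<Longrightarrow> \<rho> x = \<zero>\<^bsub>U\<^esub>"
  by (auto simp: relators_def \<rho>_D)

lemma relators_cancel:
  assumes "x \<in> carrier F" "r \<in> relators" "x \<oplus>\<^bsub>F\<^esub> r \<in> relators"
  shows "x \<in> relators"
proof -
  have "(x \<oplus>\<^bsub>F\<^esub> r) \<oplus>\<^bsub>F\<^esub> (\<ominus> \<one>) \<odot>\<^bsub>F\<^esub> r \<in> relators"
    by (intro relators_add[OF assms(3)] relators_smult assms(2)) auto
  also have "(x \<oplus>\<^bsub>F\<^esub> r) \<oplus>\<^bsub>F\<^esub> (\<ominus> \<one>) \<odot>\<^bsub>F\<^esub> r = x"
    using R.free_moduleD(1)[OF assms(1)] R.free_moduleD(1)[OF relators_closed[OF assms(2)]]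
    by (simp add: fun_eq_iff R.l_minus R.a_assoc R.r_neg del: split_paired_All)
  finally show ?thesis .
qed

text \<open>Compatibility turns \<open>wprod v\<close> times the sum of
  \<open>z w \<cdot> x w\<close>, where \<open>x w\<close> is the value of \<open>w\<close>, into
  \<open>z v\<close> times the sum of \<open>wprod w \<cdot> x w\<close>, which is \<open>1\<close>.
  In particular \<open>\<rho> z = 0\<close> puts every coefficient into the kernel of
  \<open>u\<close>.\<close>

lemma compatible_values:
  assumes \<mm>: "\<mm> \<in> \<Lambda>" and z: "z \<in> compatible N" and N: "N > 0"
    and supp: "\<And>i. i \<notin> Pair \<mm> ` words \<mm> N \<Longrightarrow> z i = \<zero>" and v: "v \<in> words \<mm> N"
  shows "u (z (\<mm>, v)) = u (wprod v) \<otimes>\<^bsub>U\<^esub> \<rho> z"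
proof -
  note zF = compatibleD(1)[OF z] and zcl = R.free_moduleD(1)[OF compatibleD(1)[OF z]]
  have wcl: "wprod w \<in> carrier R" if "w \<in> words \<mm> N" for w using that by (rule wprod_words_closed[OF \<mm>])
  have "u (wprod v) \<otimes>\<^bsub>U\<^esub> \<rho> z = u (wprod v) \<otimes>\<^bsub>U\<^esub> (\<Oplus>\<^bsub>U\<^esub>w\<in>words \<mm> N. u (z (\<mm>, w)) \<otimes>\<^bsub>U\<^esub> value_at (\<mm>, w))"
    using \<rho>_words[OF \<mm> zF N supp] by simp
  also have "\<dots> = (\<Oplus>\<^bsub>U\<^esub>w\<in>words \<mm> N. u (wprod v) \<otimes>\<^bsub>U\<^esub> (u (z (\<mm>, w)) \<otimes>\<^bsub>U\<^esub> value_at (\<mm>, w)))"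
    using finite_words[OF \<mm>] zcl v wcl by (intro S.finsum_rdistr) (auto simp: value_at_closed[OF \<mm>])
  also have "\<dots> = (\<Oplus>\<^bsub>U\<^esub>w\<in>words \<mm> N. u (z (\<mm>, v)) \<otimes>\<^bsub>U\<^esub> (u (wprod w) \<otimes>\<^bsub>U\<^esub> value_at (\<mm>, w)))"
  proof (rule S.finsum_cong')
    fix w assume w: "w \<in> words \<mm> N"
    have "u (wprod v) \<otimes>\<^bsub>U\<^esub> u (z (\<mm>, w)) = u (z (\<mm>, v)) \<otimes>\<^bsub>U\<^esub> u (wprod w)"
      using compatibleD(3)[OF z \<mm> v w] zcl v w wcl
      by (simp add: R.m_comm[of "z (\<mm>, v)"] flip: hom_mult)
    then show "u (wprod v) \<otimes>\<^bsub>U\<^esub> (u (z (\<mm>, w)) \<otimes>\<^bsub>U\<^esub> value_at (\<mm>, w))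
        = u (z (\<mm>, v)) \<otimes>\<^bsub>U\<^esub> (u (wprod w) \<otimes>\<^bsub>U\<^esub> value_at (\<mm>, w))"
      using zcl v w wcl value_at_closed[OF \<mm>] by (simp flip: S.m_assoc)
  qed (use zcl v wcl value_at_closed[OF \<mm>] in auto)
  also have "\<dots> = u (z (\<mm>, v))"
    using finite_words[OF \<mm>] zcl wcl sum_words[OF \<mm> N] value_at_closed[OF \<mm>]
    by (subst S.finsum_rdistr[symmetric]) auto
  finally show ?thesis by simp
qed

text \<open>A factor outside \<open>\<nn>\<close> lets the parts at all other \<open>\<mm>\<close>
  be moved to the root. Off \<open>\<Lambda>\<close> only a root remains, killed by a multiplier
  outside \<open>\<nn>\<close>. On \<open>\<Lambda>\<close> the root is unwound at
  \<open>\<nn>\<close>; the coefficients then lie in the kernel of \<open>u\<close>, so long words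
  kill them up to a factor outside \<open>\<nn>\<close>.\<close>

lemma kernel_local:
  assumes z: "z \<in> compatible N" and N: "N > 0" and \<rho>z: "\<rho> z = \<zero>\<^bsub>U\<^esub>" and \<nn>: "maximalideal \<nn> R"
  shows "\<exists>f\<in>carrier R. f \<notin> \<nn> \<and> f \<odot>\<^bsub>F\<^esub> z \<in> relators"
proof -
  note zF = compatibleD(1)[OF z] and zcl = R.free_moduleD(1)[OF compatibleD(1)[OF z]]
  define L where "L = {\<mm> \<in> \<Lambda>. \<exists>w. z (\<mm>, w) \<noteq> \<zero>} - {\<nn>}"
  have "L \<subseteq> fst ` {i. z i \<noteq> \<zero>}" by (force simp: L_def)
  then have finL: "finite L" using R.free_moduleD(3)[OF zF] finite_surj by blast
  have L\<Lambda>: "L \<subseteq> \<Lambda>" and nL: "\<nn> \<notin> L" by (auto simp: L_def)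
  obtain e where e: "e \<in> carrier R" "e \<notin> \<nn>"
    "\<forall>\<mm>\<in>L. \<exists>w\<in>words \<mm> N. \<exists>b\<in>carrier R. e = wprod w \<otimes> b"
    using ex_common_multiple_notin[OF finL L\<Lambda> \<nn> nL, of N] by blast
  have "\<forall>\<mm>\<in>L. \<exists>s. s \<in> carrier R \<and> (\<forall>w\<in>words \<mm> N. e \<otimes> z (\<mm>, w) = wprod w \<otimes> s)"
  proof
    fix \<mm> assume "\<mm> \<in> L"
    then obtain v b where v: "v \<in> words \<mm> N" "b \<in> carrier R" "e = wprod v \<otimes> b" using e(3) by blast
    have \<mm>: "\<mm> \<in> \<Lambda>" using \<open>\<mm> \<in> L\<close> L\<Lambda> by blast
    have "e \<otimes> z (\<mm>, w) = wprod w \<otimes> (b \<otimes> z (\<mm>, v))" if w: "w \<in> words \<mm> N" for w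
    proof -
      note cl = wprod_words_closed[OF \<mm> v(1)] wprod_words_closed[OF \<mm> w] v(2) zcl
      have "e \<otimes> z (\<mm>, w) = b \<otimes> (wprod v \<otimes> z (\<mm>, w))" using cl by (simp add: v(3) R.m_ac)
      also have "\<dots> = b \<otimes> (wprod w \<otimes> z (\<mm>, v))" by (simp add: compatibleD(3)[OF z \<mm> v(1) w])
      also have "\<dots> = wprod w \<otimes> (b \<otimes> z (\<mm>, v))" using cl by (simp add: R.m_lcomm)
      finally show ?thesis .
    qed
    then show "\<exists>s. s \<in> carrier R \<and> (\<forall>w\<in>words \<mm> N. e \<otimes> z (\<mm>, w) = wprod w \<otimes> s)"
      using v(2) zcl by (intro exI[of _ "b \<otimes> z (\<mm>, v)"]) auto
  qed
  from bchoice[OF this] obtain s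
    where s': "\<forall>\<mm>\<in>L. s \<mm> \<in> carrier R \<and> (\<forall>w\<in>words \<mm> N. e \<otimes> z (\<mm>, w) = wprod w \<otimes> s \<mm>)" ..
  have s: "s \<mm> \<in> carrier R" if "\<mm> \<in> L" for \<mm> using s' that by simp
  have s_eq: "e \<otimes> z (\<mm>, w) = wprod w \<otimes> s \<mm>" if "\<mm> \<in> L" "w \<in> words \<mm> N" for \<mm> w
    using s' that by simp
  obtain c where c: "c \<in> carrier Q" and
    Dc': "\<forall>\<mm> w. w \<noteq> [] \<longrightarrow> D c (\<mm>, w) = (if \<mm> \<in> L \<and> w \<in> words \<mm> N then \<ominus> (wprod w \<otimes> s \<mm>) else \<zero>)"
    by (rule bexE[OF ex_unwinding[of L s N, OF finL L\<Lambda> _ N]], erule s, elim conjE, rule that)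
  have Dc: "D c (\<mm>, w) = (if \<mm> \<in> L \<and> w \<in> words \<mm> N then \<ominus> (wprod w \<otimes> s \<mm>) else \<zero>)"
    if "w \<noteq> []" for \<mm> w using Dc' that by blast
  \<comment> \<open>At each \<open>\<mm> \<in> L\<close> the family \<open>e z\<close> has the form
    \<open>wprod w \<otimes> s \<mm>\<close>. Adding \<open>D c\<close> cancels it and puts
    \<open>s \<mm>\<close> at the root instead.\<close>
  define y where "y = e \<odot>\<^bsub>F\<^esub> z \<oplus>\<^bsub>F\<^esub> D c"
  have ezF: "e \<odot>\<^bsub>F\<^esub> z \<in> carrier F" and DcF: "D c \<in> carrier F"
    by (intro F.smult_closed e(1) zF D_closed c)+
  have yF: "y \<in> carrier F" unfolding y_def by (rule F.a_closed[OF ezF DcF])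
  note ycl = R.free_moduleD(1)[OF yF]
  have y_word: "y (\<mm>, w) = (if \<mm> = \<nn> then e \<otimes> z (\<nn>, w) else \<zero>)" if "w \<noteq> []" for \<mm> w
  proof (cases "\<mm> \<in> L")
    case True
    then have "\<mm> \<in> \<Lambda>" using L\<Lambda> by blast
    show ?thesis
    proof (cases "w \<in> words \<mm> N")
      case w: True
      then have "y (\<mm>, w) = wprod w \<otimes> s \<mm> \<oplus> \<ominus> (wprod w \<otimes> s \<mm>)"
        using True s_eq[OF True w] Dc[OF \<open>w \<noteq> []\<close>, of \<mm>] by (simp add: y_def)
      then show ?thesis using True nL s[OF True] wprod_words_closed[OF \<open>\<mm> \<in> \<Lambda>\<close> w] by (auto simp: R.r_neg)
    next
      case False
      then show ?thesis
        using True nL e(1) Dc[OF \<open>w \<noteq> []\<close>, of \<mm>] compatible_zero_outside[OF z \<open>w \<noteq> []\<close> False]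
        by (auto simp: y_def)
    qed
  next
    case False
    then have "\<mm> = \<nn> \<or> z (\<mm>, w) = \<zero>" using F_index(1)[OF zF \<open>w \<noteq> []\<close>, of \<mm>] by (auto simp: L_def)
    then show ?thesis using False e(1) zcl Dc[OF \<open>w \<noteq> []\<close>, of \<mm>] nL by (auto simp: y_def)
  qed
  have \<rho>y: "\<rho> y = \<zero>\<^bsub>U\<^esub>"
    unfolding y_def using e(1) by (simp only: \<rho>_simps(2)[OF ezF DcF] \<rho>_simps(3)[OF e(1) zF] \<rho>z \<rho>_D[OF c]) simp
  define r where "r = y ({}, [])"
  have r: "r \<in> carrier R" using ycl by (simp add: r_def)
  \<comment> \<open>\<open>y\<close> and \<open>e z\<close> differ by a relator, and
    \<open>e\<close> lies outside \<open>\<nn>\<close>, so a multiplier for \<open>y\<close> gives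
    one for \<open>z\<close>.\<close>
  have reduce: "\<exists>f\<in>carrier R. f \<notin> \<nn> \<and> f \<odot>\<^bsub>F\<^esub> z \<in> relators"
    if d: "d \<in> carrier R" "d \<notin> \<nn>" "d \<odot>\<^bsub>F\<^esub> y \<in> relators" for d
  proof (intro bexI conjI)
    show "d \<otimes> e \<notin> \<nn>" by (rule R.maximalideal_m_notin[OF \<nn> d(1) e(1) d(2) e(2)])
    have sum: "(d \<otimes> e) \<odot>\<^bsub>F\<^esub> z \<oplus>\<^bsub>F\<^esub> d \<odot>\<^bsub>F\<^esub> D c = d \<odot>\<^bsub>F\<^esub> y"
      unfolding y_def by (simp only: F.smult_assoc1[OF d(1) e(1) zF] F.smult_r_distr[OF d(1) ezF DcF])
    have "D c \<in> relators" using c by (simp add: relators_def)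
    then have rel: "d \<odot>\<^bsub>F\<^esub> D c \<in> relators" by (rule relators_smult[OF d(1)])
    have "(d \<otimes> e) \<odot>\<^bsub>F\<^esub> z \<in> carrier F" by (intro F.smult_closed zF R.m_closed d(1) e(1))
    then show "(d \<otimes> e) \<odot>\<^bsub>F\<^esub> z \<in> relators"
      by (rule relators_cancel[OF _ rel]) (simp only: sum d(3))
  qed (use d e in simp)
  show ?thesis
  proof (cases "\<nn> \<in> \<Lambda>")
    case False
    have "y = root r"
    proof
      fix i :: "'a set \<times> 'a list"
      obtain \<mm> w where i: "i = (\<mm>, w)" by (cases i)
      show "y i = root r i"
      proof (cases "w = []")
        case True
        then show ?thesis using F_empty_word[OF yF, of \<mm>] r by (cases "\<mm> = {}") (auto simp: i root_eq r_def)
      next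
        case w: False
        then have "z (\<nn>, w) = \<zero>" using F_index(1)[OF zF, of w \<nn>] False by blast
        then show ?thesis using w y_word[OF w, of \<mm>] e(1) r by (simp add: i root_eq)
      qed
    qed
    then have "u r = \<zero>\<^bsub>U\<^esub>" using \<rho>y \<rho>_root[OF r] by simp
    then have "dense {f \<in> carrier R. f \<otimes> r = \<zero>}" by (rule dense_annihilator[OF r])
    then have "\<not> {f \<in> carrier R. f \<otimes> r = \<zero>} \<subseteq> \<nn>"
      using dense_subset_imp_\<Lambda>[OF _ \<nn>] False by blast
    then obtain d where d: "d \<in> carrier R" "d \<otimes> r = \<zero>" "d \<notin> \<nn>" by blast
    have "d \<odot>\<^bsub>F\<^esub> y = (\<lambda>_. \<zero>)" using d r by (auto simp: \<open>y = root r\<close> root_eq fun_eq_iff)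
    then have "d \<odot>\<^bsub>F\<^esub> y \<in> relators" using relators_zero by (simp only:)
    then show ?thesis by (rule reduce[OF d(1,3)])
  next
    case True
    obtain c' where c': "c' \<in> carrier Q" "aug c' = r" and
      Dc': "\<And>\<mm> w. w \<noteq> [] \<Longrightarrow> D c' (\<mm>, w) = (if \<mm> = \<nn> \<and> w \<in> words \<mm> N then \<ominus> (wprod w \<otimes> r) else \<zero>)"
      using ex_unwinding[of "{\<nn>}" "\<lambda>_. r" N] True N r by auto
    have Dc'F: "D c' \<in> carrier F" by (rule D_closed[OF c'(1)])
    \<comment> \<open>Subtracting \<open>D c'\<close> replaces the root coefficient \<open>r\<close>
      by the family \<open>wprod w \<otimes> r\<close> at \<open>\<nn>\<close>, so \<open>t\<close>
      lives on words of length \<open>N\<close> at \<open>\<nn>\<close> only.\<close>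
    define t where "t = y \<oplus>\<^bsub>F\<^esub> (\<ominus> \<one>) \<odot>\<^bsub>F\<^esub> D c'"
    have mDc'F: "(\<ominus> \<one>) \<odot>\<^bsub>F\<^esub> D c' \<in> carrier F" by (intro F.smult_closed Dc'F) auto
    have tF: "t \<in> carrier F" unfolding t_def by (rule F.a_closed[OF yF mDc'F])
    have m1: "\<ominus> \<one> \<in> carrier R" by simp
    have \<rho>t: "\<rho> t = \<zero>\<^bsub>U\<^esub>"
      unfolding t_def by (simp only: \<rho>_simps(2)[OF yF mDc'F] \<rho>_simps(3)[OF m1 Dc'F] \<rho>_D[OF c'(1)] \<rho>y) simp
    have t_word: "t (\<nn>, w) = e \<otimes> z (\<nn>, w) \<oplus> wprod w \<otimes> r" if "w \<in> words \<nn> N" for w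
    proof -
      have "w \<noteq> []" using that N by (auto simp: words_def)
      then show ?thesis
        using that y_word[of w \<nn>] Dc'[of w \<nn>] wprod_words_closed[OF True that] r
        by (simp add: t_def R.l_minus)
    qed
    have t_supp: "t i = \<zero>" if "i \<notin> Pair \<nn> ` words \<nn> N" for i
    proof -
      obtain \<mm> w where i: "i = (\<mm>, w)" by (cases i)
      show ?thesis
      proof (cases "w = []")
        case w: True
        then show ?thesis
          using F_empty_word[OF tF, of \<mm>] r c'(2) by (cases "\<mm> = {}") (auto simp: i t_def R.l_minus R.r_neg r_def)
      next
        case w: False
        then have "y i = \<zero>"
          using y_word[OF w, of \<mm>] compatible_zero_outside[OF z w, of \<nn>] that e(1)
          by (auto simp: i image_iff)
        then show ?thesis using Dc'[OF w, of \<mm>] that by (auto simp: i t_def)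
      qed
    qed
    have t: "t \<in> compatible N"
      unfolding compatible_def
    proof (intro CollectI conjI allI impI ballI tF)
      fix \<mm> and w :: "'a list" assume "w \<noteq> []" "length w \<noteq> N"
      then show "t (\<mm>, w) = \<zero>" by (intro t_supp) (auto simp: words_def)
    next
      fix \<mm> v w assume \<mm>: "\<mm> \<in> \<Lambda>" and vw: "v \<in> words \<mm> N" "w \<in> words \<mm> N"
      show "wprod v \<otimes> t (\<mm>, w) = wprod w \<otimes> t (\<mm>, v)"
      proof (cases "\<mm> = \<nn>")
        case False
        then have "t (\<mm>, v) = \<zero>" "t (\<mm>, w) = \<zero>" by (simp_all add: t_supp image_iff)
        then show ?thesis using wprod_words_closed[OF \<mm>] vw by simp
      next
        case m: True
        note cl = wprod_words_closed[OF \<mm> vw(1)] wprod_words_closed[OF \<mm> vw(2)] zcl e(1) r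
        have "wprod v \<otimes> (e \<otimes> z (\<mm>, w) \<oplus> wprod w \<otimes> r)
            = e \<otimes> (wprod v \<otimes> z (\<mm>, w)) \<oplus> wprod v \<otimes> wprod w \<otimes> r"
          using cl by (simp add: R.r_distr R.m_ac)
        also have "\<dots> = e \<otimes> (wprod w \<otimes> z (\<mm>, v)) \<oplus> wprod v \<otimes> wprod w \<otimes> r"
          by (simp only: compatibleD(3)[OF z \<mm> vw])
        also have "\<dots> = wprod w \<otimes> (e \<otimes> z (\<mm>, v) \<oplus> wprod v \<otimes> r)"
          using cl by (simp add: R.r_distr R.m_ac)
        finally show ?thesis using vw m by (simp add: t_word)
      qed
    qed
    let ?T = "(\<lambda>w. t (\<nn>, w)) ` words \<nn> N"
    have tcl: "t i \<in> carrier R" for i by (rule R.free_moduleD(1)[OF tF])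
    have "u x = \<zero>\<^bsub>U\<^esub>" if "x \<in> ?T" for x
      using that compatible_values[OF True t N t_supp] \<rho>t wprod_words_closed[OF True] by auto
    then have "dense {f \<in> carrier R. \<forall>x\<in>?T. f \<otimes> x = \<zero>}"
      using tcl finite_words[OF True] by (intro dense_finite_annihilator) auto
    from dense_locally_nilpotent[OF this True]
    obtain d k where d: "d \<in> carrier R" "d \<notin> \<nn>"
      and kill: "\<And>v w. \<lbrakk>v \<in> words \<nn> k; w \<in> words \<nn> N\<rbrakk> \<Longrightarrow> (wprod v \<otimes> d) \<otimes> t (\<nn>, w) = \<zero>"
      by blast
    have dt: "d \<odot>\<^bsub>F\<^esub> t \<in> compatible N" by (rule compatible_smult[OF d(1) t])
    \<comment> \<open>The prefixes of length \<open>k\<close> act by multiplication by their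
      products, which kill every coefficient of \<open>d t\<close>; so the lengthened element
      \<open>x\<close> is zero.\<close>
    from compatible_lengthen[OF dt N, of k]
    obtain x c'' where x: "x \<in> compatible (N + k)" and c'': "c'' \<in> carrier Q"
      and x_eq: "d \<odot>\<^bsub>F\<^esub> t = x \<oplus>\<^bsub>F\<^esub> D c''" "x ({}, []) = (d \<odot>\<^bsub>F\<^esub> t) ({}, [])"
        "\<And>\<mm> v w. \<lbrakk>\<mm> \<in> \<Lambda>; v \<in> words \<mm> k; w \<in> words \<mm> N\<rbrakk> \<Longrightarrow> x (\<mm>, v @ w) = wprod v \<otimes> (d \<odot>\<^bsub>F\<^esub> t) (\<mm>, w)"
      by blast
    have "x i = \<zero>" for i
    proof -
      obtain \<mm> w where i: "i = (\<mm>, w)" by (cases i)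
      consider "w = []" "\<mm> = {}" | "w = []" "\<mm> \<noteq> {}" | "w \<noteq> []" "w \<notin> words \<mm> (N + k)"
        | "w \<noteq> []" "w \<in> words \<mm> (N + k)" "\<mm> \<notin> \<Lambda>" | "w \<in> words \<mm> (N + k)" "\<mm> \<in> \<Lambda>" by blast
      then show ?thesis
      proof cases
        case 1
        have "t ({}, []) = \<zero>" using N by (intro t_supp) (auto simp: words_def)
        then show ?thesis using x_eq(2) d(1) 1 by (simp add: i)
      next
        case 2
        then show ?thesis using F_empty_word[OF compatibleD(1)[OF x]] by (simp add: i)
      next
        case 3
        then show ?thesis using compatible_zero_outside[OF x] by (simp add: i)
      next
        case 4
        then show ?thesis using F_index(1)[OF compatibleD(1)[OF x]] i by blast
      next
        case 5
        let ?v = "take k w" and ?w = "drop k w"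
        have vw: "?v \<in> words \<mm> k" "?w \<in> words \<mm> N"
          using 5 set_take_subset[of k w] set_drop_subset[of k w] by (auto simp: words_def)
        have "x i = wprod ?v \<otimes> (d \<otimes> t (\<mm>, ?w))" using x_eq(3)[OF 5(2) vw] by (simp add: i)
        also have "\<dots> = (wprod ?v \<otimes> d) \<otimes> t (\<mm>, ?w)"
          using wprod_words_closed[OF 5(2) vw(1)] d(1) tcl by (simp add: R.m_assoc)
        also have "\<dots> = \<zero>"
        proof (cases "\<mm> = \<nn>")
          case m: True
          then show ?thesis using kill vw by simp
        next
          case False
          then have "t (\<mm>, ?w) = \<zero>" by (simp add: t_supp image_iff)
          then show ?thesis using wprod_words_closed[OF 5(2) vw(1)] d(1) by simp
        qed
        finally show ?thesis .
      qed
    qed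
    then have "d \<odot>\<^bsub>F\<^esub> t = D c''"
      unfolding x_eq(1) using R.free_moduleD(1)[OF D_closed[OF c'']] by (simp add: fun_eq_iff del: split_paired_All)
    then have dt_rel: "d \<odot>\<^bsub>F\<^esub> t \<in> relators" using c'' by (simp add: relators_def del: free_module_simps)
    have "y = t \<oplus>\<^bsub>F\<^esub> D c'"
      unfolding t_def using ycl R.free_moduleD(1)[OF Dc'F]
      by (simp add: fun_eq_iff R.l_minus R.a_assoc R.l_neg del: split_paired_All)
    then have "d \<odot>\<^bsub>F\<^esub> y = d \<odot>\<^bsub>F\<^esub> t \<oplus>\<^bsub>F\<^esub> d \<odot>\<^bsub>F\<^esub> D c'"
      by (simp only: F.smult_r_distr[OF d(1) tF Dc'F])
    moreover have "D c' \<in> relators" using c' by (simp add: relators_def)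
    ultimately have "d \<odot>\<^bsub>F\<^esub> y \<in> relators"
      using dt_rel d(1) by (simp only: relators_add relators_smult)
    then show ?thesis by (rule reduce[OF d])
  qed
qed

lemma compatible_kernel:
  assumes z: "z \<in> compatible N" and N: "N > 0" and \<rho>z: "\<rho> z = \<zero>\<^bsub>U\<^esub>"
  shows "z \<in> relators"
proof -
  note zF = compatibleD(1)[OF z]
  let ?X = "{f \<in> carrier R. f \<odot>\<^bsub>F\<^esub> z \<in> relators}"
  have "ideal ?X R"
  proof (rule R.idealI_smult)
    show "\<zero> \<in> ?X" using relators_zero R.free_moduleD(1)[OF zF] by simp
    show "a \<oplus> b \<in> ?X" if "a \<in> ?X" "b \<in> ?X" for a b
      using that relators_add zF by (simp add: F.smult_l_distr del: free_module_simps)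
    show "x \<otimes> a \<in> ?X" if "a \<in> ?X" "x \<in> carrier R" for a x
      using that relators_smult zF by (simp add: F.smult_assoc1 del: free_module_simps)
  qed auto
  then have "\<one> \<in> ?X"
    using kernel_local[OF z N \<rho>z] by (intro R.one_in_ideal_if_local) blast+
  then show ?thesis using F.smult_one[OF zF] by (simp del: free_module_simps)
qed

section \<open>The lifts of elements of \<open>U\<close>, and the splitting\<close>

definition lifts :: "('a set \<times> 'a list \<Rightarrow> 'a) set" where
  "lifts = {y \<oplus>\<^bsub>F\<^esub> x | y x N. N > 0 \<and> y \<in> compatible N \<and> x \<in> relators}"

lemma lifts_closed: "z \<in> lifts \<Longrightarrow> z \<in> carrier F"
  using compatibleD(1) relators_closed F.a_closed by (auto simp: lifts_def simp del: free_module_simps)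

lemma compatible_subset_lifts:
  assumes "z \<in> compatible N" "N > 0"
  shows "z \<in> lifts"
proof -
  have "z = z \<oplus>\<^bsub>F\<^esub> \<zero>\<^bsub>F\<^esub>" using F.r_zero[OF compatibleD(1)[OF assms(1)]] by (rule sym)
  moreover have "\<zero>\<^bsub>F\<^esub> \<in> relators" using relators_zero by simp
  ultimately show ?thesis unfolding lifts_def using assms by blast
qed

lemma lifts_smult:
  assumes r: "r \<in> carrier R" and z: "z \<in> lifts"
  shows "r \<odot>\<^bsub>F\<^esub> z \<in> lifts"
proof -
  obtain y x N where y: "N > 0" "y \<in> compatible N" "x \<in> relators" "z = y \<oplus>\<^bsub>F\<^esub> x"
    using z unfolding lifts_def by blast
  have "r \<odot>\<^bsub>F\<^esub> z = r \<odot>\<^bsub>F\<^esub> y \<oplus>\<^bsub>F\<^esub> r \<odot>\<^bsub>F\<^esub> x"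
    unfolding y(4) by (rule F.smult_r_distr[OF r compatibleD(1)[OF y(2)] relators_closed[OF y(3)]])
  then show ?thesis
    unfolding lifts_def using y(1) compatible_smult[OF r y(2)] relators_smult[OF r y(3)] by blast
qed

lemma compatible_lengthen_relators:
  assumes z: "z \<in> compatible N" and N: "N > 0"
  shows "\<exists>y\<in>compatible (N + k). \<exists>x\<in>relators. z = y \<oplus>\<^bsub>F\<^esub> x"
proof -
  obtain y c where "y \<in> compatible (N + k)" "c \<in> carrier Q" "z = y \<oplus>\<^bsub>F\<^esub> D c"
    using compatible_lengthen[OF z N, of k] by blast
  moreover from this have "D c \<in> relators" by (simp add: relators_def)
  ultimately show ?thesis by blast
qed

text \<open>Compatible elements of lengths \<open>N\<close> and \<open>N'\<close> are both
  lengthened to \<open>N + N'\<close>. The change is a relator, which is why relators are included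
  in \<open>lifts\<close>.\<close>

lemma lifts_add:
  assumes "z \<in> lifts" "z' \<in> lifts"
  shows "z \<oplus>\<^bsub>F\<^esub> z' \<in> lifts"
proof -
  obtain y x N where y: "N > 0" "y \<in> compatible N" "x \<in> relators" "z = y \<oplus>\<^bsub>F\<^esub> x"
    using assms(1) unfolding lifts_def by blast
  obtain y' x' N' where y': "N' > 0" "y' \<in> compatible N'" "x' \<in> relators" "z' = y' \<oplus>\<^bsub>F\<^esub> x'"
    using assms(2) unfolding lifts_def by blast
  obtain v p where v: "v \<in> compatible (N + N')" "p \<in> relators" "y = v \<oplus>\<^bsub>F\<^esub> p"
    using compatible_lengthen_relators[OF y(2,1)] by blast
  obtain v' p' where v': "v' \<in> compatible (N' + N)" "p' \<in> relators" "y' = v' \<oplus>\<^bsub>F\<^esub> p'"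
    using compatible_lengthen_relators[OF y'(2,1)] by blast
  have v'': "v' \<in> compatible (N + N')" using v'(1) by (simp add: add.commute)
  note cl = compatibleD(1)[OF v(1)] compatibleD(1)[OF v'(1)] relators_closed[OF v(2)] relators_closed[OF v'(2)]
    relators_closed[OF y(3)] relators_closed[OF y'(3)]
  have "z \<oplus>\<^bsub>F\<^esub> z' = (v \<oplus>\<^bsub>F\<^esub> v') \<oplus>\<^bsub>F\<^esub> ((p \<oplus>\<^bsub>F\<^esub> x) \<oplus>\<^bsub>F\<^esub> (p' \<oplus>\<^bsub>F\<^esub> x'))"
    unfolding y(4) y'(4) v(3) v'(3) using cl by (simp only: F.a_ac F.a_closed)
  moreover have "(p \<oplus>\<^bsub>F\<^esub> x) \<oplus>\<^bsub>F\<^esub> (p' \<oplus>\<^bsub>F\<^esub> x') \<in> relators"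
    by (intro relators_add v(2) v'(2) y(3) y'(3))
  moreover have "N + N' > 0" using y(1) by simp
  ultimately show ?thesis
    unfolding lifts_def using compatible_add[OF v(1) v''] by blast
qed

text \<open>Together with \<open>ex_lift\<close> this says that \<open>\<rho>\<close> maps the lifts
  modulo relators bijectively onto \<open>U\<close>; the inverse is the section that splits the
  amalgam.\<close>

lemma lifts_kernel:
  assumes "z \<in> lifts" "\<rho> z = \<zero>\<^bsub>U\<^esub>"
  shows "z \<in> relators"
proof -
  obtain y x N where y: "N > 0" "y \<in> compatible N" "x \<in> relators" "z = y \<oplus>\<^bsub>F\<^esub> x"
    using assms(1) unfolding lifts_def by blast
  note cl = compatibleD(1)[OF y(2)] relators_closed[OF y(3)]
  have "\<rho> y \<oplus>\<^bsub>U\<^esub> \<zero>\<^bsub>U\<^esub> = \<zero>\<^bsub>U\<^esub>"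
    using assms(2) unfolding y(4) by (simp only: \<rho>_simps(2)[OF cl] \<rho>_relators[OF y(3)])
  then have "\<rho> y = \<zero>\<^bsub>U\<^esub>" using \<rho>_simps(1)[OF cl(1)] by simp
  then have "y \<in> relators" by (rule compatible_kernel[OF y(2,1)])
  then show ?thesis unfolding y(4) by (rule relators_add[OF _ y(3)])
qed

text \<open>Off \<open>\<Lambda>\<close> some denominator of \<open>y\<close> lies outside
  \<open>\<nn>\<close>, and a root is a lift. On \<open>\<Lambda>\<close>, up to a factor outside
  \<open>\<nn>\<close>, all long words are denominators of \<open>y\<close>. The numerators chosen
  for them are compatible only modulo the kernel of \<open>u\<close>; a further prefix and a further
  factor outside \<open>\<nn>\<close> remove this defect.\<close>

lemma lift_local:
  assumes y: "y \<in> carrier U" and \<nn>: "maximalideal \<nn> R"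
  shows "\<exists>f\<in>carrier R. f \<notin> \<nn> \<and> (\<exists>z\<in>lifts. \<rho> z = u f \<otimes>\<^bsub>U\<^esub> y)"
proof -
  let ?I = "{r \<in> carrier R. u r \<otimes>\<^bsub>U\<^esub> y \<in> u ` carrier R}"
  have I: "dense ?I" by (rule dense_denominators[OF y])
  show ?thesis
  proof (cases "\<nn> \<in> \<Lambda>")
    case False
    then have "\<not> ?I \<subseteq> \<nn>" using dense_subset_imp_\<Lambda>[OF I \<nn>] by blast
    then obtain f r where f: "f \<in> carrier R" "f \<notin> \<nn>" "r \<in> carrier R" "u f \<otimes>\<^bsub>U\<^esub> y = u r" by blast
    moreover have "root r \<in> lifts" using compatible_root[OF f(3), of 1] by (rule compatible_subset_lifts) simp
    ultimately show ?thesis using \<rho>_root[OF f(3)] by metis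
  next
    case True
    have II: "ideal ?I R" using I by (simp add: dense_ideal_def)
    obtain e N0 where e: "e \<in> carrier R" "e \<notin> \<nn>" "\<And>w. w \<in> words \<nn> N0 \<Longrightarrow> wprod w \<otimes> e \<in> ?I"
      using dense_locally_nilpotent[OF I True] by blast
    \<comment> \<open>The additional letter guarantees positive length; denominators form an ideal,
      so the longer words are still denominators.\<close>
    define N where "N = Suc N0"
    have wcl: "wprod w \<in> carrier R" if "w \<in> words \<nn> k" for w k using that by (rule wprod_words_closed[OF True])
    have "\<exists>r. r \<in> carrier R \<and> u r = u (wprod w) \<otimes>\<^bsub>U\<^esub> (u e \<otimes>\<^bsub>U\<^esub> y)" if w: "w \<in> words \<nn> N" for w
    proof -
      obtain a v where v: "w = a # v" "a \<in> gens \<nn>" "v \<in> words \<nn> N0"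
        using w by (cases w) (auto simp: words_def N_def)
      have a: "a \<in> carrier R" using gens_closed[OF True v(2)] .
      have "a \<otimes> (wprod v \<otimes> e) \<in> ?I" by (rule ideal.I_l_closed[OF II e(3)[OF v(3)] a])
      then obtain r where r: "r \<in> carrier R" "u (a \<otimes> (wprod v \<otimes> e)) \<otimes>\<^bsub>U\<^esub> y = u r" by blast
      have "u (a \<otimes> (wprod v \<otimes> e)) \<otimes>\<^bsub>U\<^esub> y = u (wprod w) \<otimes>\<^bsub>U\<^esub> (u e \<otimes>\<^bsub>U\<^esub> y)"
        unfolding v(1) wprod_simps
        by (simp only: hom_mult hom_closed R.m_closed S.m_assoc S.m_closed a e(1) y wcl[OF v(3)])
      from trans[OF r(2)[symmetric] this] show ?thesis using r(1) by (intro exI[of _ r] conjI)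
    qed
    then obtain r where r: "\<And>w. w \<in> words \<nn> N \<Longrightarrow> r w \<in> carrier R"
      "\<And>w. w \<in> words \<nn> N \<Longrightarrow> u (r w) = u (wprod w) \<otimes>\<^bsub>U\<^esub> (u e \<otimes>\<^bsub>U\<^esub> y)" by metis
    \<comment> \<open>The finitely many compatibility defects of the numerators. They lie in the
      kernel of \<open>u\<close>, so their common annihilator is dense.\<close>
    let ?t = "\<lambda>(v, w). wprod v \<otimes> r w \<ominus> wprod w \<otimes> r v"
    let ?T = "?t ` (words \<nn> N \<times> words \<nn> N)"
    have "u x = \<zero>\<^bsub>U\<^esub>" if "x \<in> ?T" for x
    proof -
      obtain v w where vw: "v \<in> words \<nn> N" "w \<in> words \<nn> N" and x: "x = wprod v \<otimes> r w \<ominus> wprod w \<otimes> r v"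
        using \<open>x \<in> ?T\<close> by auto
      have "u (wprod v) \<otimes>\<^bsub>U\<^esub> u (r w) = u (wprod w) \<otimes>\<^bsub>U\<^esub> u (r v)"
        unfolding r(2)[OF vw(1)] r(2)[OF vw(2)]
        by (intro S.m_lcomm S.m_closed hom_closed wcl[OF vw(1)] wcl[OF vw(2)] e(1) y)
      then show ?thesis
        using wcl[OF vw(1)] wcl[OF vw(2)] r(1)[OF vw(1)] r(1)[OF vw(2)]
        by (simp add: x R.minus_eq S.r_neg)
    qed
    moreover have "?T \<subseteq> carrier R" using wcl r(1) by auto
    moreover have "finite ?T" using finite_words[OF True] by blast
    ultimately have "dense {f \<in> carrier R. \<forall>x\<in>?T. f \<otimes> x = \<zero>}" by (intro dense_finite_annihilator)
    from dense_locally_nilpotent[OF this True]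
    obtain d k where d: "d \<in> carrier R" "d \<notin> \<nn>"
      and nil: "\<forall>x\<in>words \<nn> k. wprod x \<otimes> d \<in> {f \<in> carrier R. \<forall>x\<in>?T. f \<otimes> x = \<zero>}"
      by (elim exE conjE) (rule that)
    have kill: "(wprod x \<otimes> d) \<otimes> (wprod v \<otimes> r w \<ominus> wprod w \<otimes> r v) = \<zero>"
      if "x \<in> words \<nn> k" "v \<in> words \<nn> N" "w \<in> words \<nn> N" for x v w
    proof -
      show ?thesis using bspec[OF nil that(1)] that(2,3) by simp
    qed
    have swap: "wprod v \<otimes> (wprod x \<otimes> d \<otimes> r w) = wprod w \<otimes> (wprod x \<otimes> d \<otimes> r v)"
      if xvw: "x \<in> words \<nn> k" "v \<in> words \<nn> N" "w \<in> words \<nn> N" for x v w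
    proof -
      note cl = wcl[OF xvw(1)] wcl[OF xvw(2)] wcl[OF xvw(3)] r(1)[OF xvw(2)] r(1)[OF xvw(3)] d(1)
      have "wprod v \<otimes> (wprod x \<otimes> d \<otimes> r w) \<ominus> wprod w \<otimes> (wprod x \<otimes> d \<otimes> r v)
        = (wprod x \<otimes> d) \<otimes> (wprod v \<otimes> r w \<ominus> wprod w \<otimes> r v)"
        using cl by algebra
      then show ?thesis using kill[OF xvw] cl by (simp add: R.r_right_minus_eq)
    qed
    \<comment> \<open>Prefixes of length \<open>k\<close>, together with \<open>d\<close>, kill the
      defects; suffixes of length \<open>N\<close> carry the numerators \<open>r\<close>.\<close>
    define z where "z = (\<lambda>(\<mm>, w). if \<mm> = \<nn> \<and> w \<in> words \<nn> (k + N)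
      then wprod (take k w) \<otimes> d \<otimes> r (drop k w) else \<zero>)"
    have z_eq: "z (\<mm>, w) = (if \<mm> = \<nn> \<and> w \<in> words \<nn> (k + N)
      then wprod (take k w) \<otimes> d \<otimes> r (drop k w) else \<zero>)" for \<mm> w by (simp add: z_def)
    have split: "take k w \<in> words \<nn> k" "drop k w \<in> words \<nn> N" if "w \<in> words \<nn> (k + N)" for w
      using that set_take_subset[of k w] set_drop_subset[of k w] by (auto simp: words_def)
    have wprod_split: "wprod w = wprod (take k w) \<otimes> wprod (drop k w)" if "w \<in> words \<nn> (k + N)" for w
      using wprod_append[of "take k w" "drop k w"] split[OF that] words_carrier[OF True]
      by (simp add: words_def)
    have supp: "z i = \<zero>" if "i \<notin> Pair \<nn> ` words \<nn> (k + N)" for i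
      using that by (cases i) (auto simp: z_eq)
    have zF: "z \<in> carrier F"
    proof (rule R.free_moduleI)
      have "wprod (take k w) \<otimes> d \<otimes> r (drop k w) \<in> carrier R" if "w \<in> words \<nn> (k + N)" for w
        using wcl[OF split(1)[OF that]] r(1)[OF split(2)[OF that]] d(1) by simp
      then show "z i \<in> carrier R" for i by (cases i) (auto simp: z_eq)
      show "z i = \<zero>" if "i \<notin> indices" for i
        using that True by (intro supp) (auto simp: indices_def words_def N_def)
      have "{i. z i \<noteq> \<zero>} \<subseteq> Pair \<nn> ` words \<nn> (k + N)" using supp by blast
      then show "finite {i. z i \<noteq> \<zero>}" by (rule finite_subset) (simp add: finite_words[OF True])
    qed
    have "z \<in> compatible (k + N)"
      unfolding compatible_def
    proof (intro CollectI conjI allI impI ballI zF)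
      show "z (\<mm>, w) = \<zero>" if "w \<noteq> []" "length w \<noteq> k + N" for \<mm> w
        using that by (intro supp) (auto simp: words_def)
      fix \<mm> v w assume \<mm>: "\<mm> \<in> \<Lambda>" and vw: "v \<in> words \<mm> (k + N)" "w \<in> words \<mm> (k + N)"
      show "wprod v \<otimes> z (\<mm>, w) = wprod w \<otimes> z (\<mm>, v)"
      proof (cases "\<mm> = \<nn>")
        case False
        then show ?thesis using vw wprod_words_closed[OF \<mm>] by (simp add: z_eq)
      next
        case m: True
        let ?v1 = "take k v" and ?v2 = "drop k v" and ?w1 = "take k w" and ?w2 = "drop k w"
        have s: "?v1 \<in> words \<nn> k" "?v2 \<in> words \<nn> N" "?w1 \<in> words \<nn> k" "?w2 \<in> words \<nn> N"
          using split vw m by auto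
        note cl = wcl[OF s(1)] wcl[OF s(2)] wcl[OF s(3)] wcl[OF s(4)] r(1)[OF s(2)] r(1)[OF s(4)] d(1)
        have "wprod v \<otimes> z (\<mm>, w) = wprod ?v1 \<otimes> (wprod ?v2 \<otimes> (wprod ?w1 \<otimes> d \<otimes> r ?w2))"
          using cl vw m by (simp add: z_eq wprod_split R.m_assoc)
        also have "\<dots> = wprod ?v1 \<otimes> (wprod ?w2 \<otimes> (wprod ?w1 \<otimes> d \<otimes> r ?v2))"
          by (simp only: swap[OF s(3,2,4)])
        also have "\<dots> = wprod w \<otimes> z (\<mm>, v)"
          using cl vw m by (simp add: z_eq wprod_split R.m_ac)
        finally show ?thesis .
      qed
    qed
    then have "z \<in> lifts" by (rule compatible_subset_lifts) (simp add: N_def)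
    moreover have "\<rho> z = u (d \<otimes> e) \<otimes>\<^bsub>U\<^esub> y"
    proof (rule \<rho>_compatible[OF True zF _ _ supp])
      show "0 < k + N" by (simp add: N_def)
      show "u (d \<otimes> e) \<otimes>\<^bsub>U\<^esub> y \<in> carrier U" using d e y by simp
      fix w assume w: "w \<in> words \<nn> (k + N)"
      note s = split[OF w]
      note cl = wcl[OF s(1)] wcl[OF s(2)] r(1)[OF s(2)] d(1) e(1)
      have "u (z (\<nn>, w)) = u (wprod (take k w)) \<otimes>\<^bsub>U\<^esub> u d \<otimes>\<^bsub>U\<^esub> (u (wprod (drop k w)) \<otimes>\<^bsub>U\<^esub> (u e \<otimes>\<^bsub>U\<^esub> y))"
        using cl w s by (simp add: z_eq r(2))
      also have "\<dots> = u (wprod w) \<otimes>\<^bsub>U\<^esub> (u (d \<otimes> e) \<otimes>\<^bsub>U\<^esub> y)"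
        using cl w y by (simp add: wprod_split S.m_ac)
      finally show "u (z (\<nn>, w)) = u (wprod w) \<otimes>\<^bsub>U\<^esub> (u (d \<otimes> e) \<otimes>\<^bsub>U\<^esub> y)" .
    qed
    moreover have "d \<otimes> e \<notin> \<nn>" by (rule R.maximalideal_m_notin[OF \<nn> d(1) e(1) d(2) e(2)])
    ultimately show ?thesis using d(1) e(1) by blast
  qed
qed

lemma ex_lift:
  assumes y: "y \<in> carrier U"
  shows "\<exists>z\<in>lifts. \<rho> z = y"
proof -
  let ?X = "{f \<in> carrier R. \<exists>z\<in>lifts. \<rho> z = u f \<otimes>\<^bsub>U\<^esub> y}"
  have "ideal ?X R"
  proof (rule R.idealI_smult)
    have "root \<zero> \<in> lifts" using compatible_root[of \<zero> 1] by (intro compatible_subset_lifts) auto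
    then show "\<zero> \<in> ?X" using \<rho>_root[of \<zero>] y by auto
    show "a \<oplus> b \<in> ?X" if ab: "a \<in> ?X" "b \<in> ?X" for a b
    proof -
      obtain x z where "x \<in> lifts" "\<rho> x = u a \<otimes>\<^bsub>U\<^esub> y" "z \<in> lifts" "\<rho> z = u b \<otimes>\<^bsub>U\<^esub> y" using ab by blast
      then have "x \<oplus>\<^bsub>F\<^esub> z \<in> lifts" "\<rho> (x \<oplus>\<^bsub>F\<^esub> z) = u (a \<oplus> b) \<otimes>\<^bsub>U\<^esub> y"
        using ab y lifts_add by (simp_all add: \<rho>_simps(2) lifts_closed S.l_distr del: free_module_simps)
      then show ?thesis using ab by blast
    qed
    show "r \<otimes> a \<in> ?X" if a: "a \<in> ?X" and r: "r \<in> carrier R" for a r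
    proof -
      obtain x where "x \<in> lifts" "\<rho> x = u a \<otimes>\<^bsub>U\<^esub> y" using a by blast
      then have "r \<odot>\<^bsub>F\<^esub> x \<in> lifts" "\<rho> (r \<odot>\<^bsub>F\<^esub> x) = u (r \<otimes> a) \<otimes>\<^bsub>U\<^esub> y"
        using a r y lifts_smult by (simp_all add: \<rho>_simps(3) lifts_closed S.m_assoc del: free_module_simps)
      then show ?thesis using a r by blast
    qed
  qed auto
  then have "\<one> \<in> ?X" using lift_local[OF y] by (intro R.one_in_ideal_if_local) blast+
  then show ?thesis using y by simp
qed

text \<open>The finite set of generators determines \<open>\<mm>\<close>. This allows an index to be
  coded by lists of ring elements, although \<open>\<mm>\<close> itself may be an infinite
  set.\<close>

lemma inj_gens: "\<lbrakk>\<mm> \<in> \<Lambda>; \<nn> \<in> \<Lambda>; gens \<mm> = gens \<nn>\<rbrakk> \<Longrightarrow> \<mm> = \<nn>"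
  using gens_maximal[OF _ maximal_\<Lambda>, of \<nn> \<mm>] gens_subset[of \<mm>] by simp

text \<open>Lifts of the values of the basis vectors define an endomorphism \<open>E\<close> of
  \<open>F\<close> with values in \<open>lifts\<close> and \<open>\<rho> E = \<rho>\<close>. On the
  kernel of \<open>\<rho>\<close> the values of \<open>E\<close> are relators, that is, elements of
  the image of the free module \<open>Q\<close>; hence the kernel is projective.\<close>

lemma projective_dimension_le_one_U: "projective_dimension R U' \<le> 1"
proof -
  have "\<forall>i\<in>indices. \<exists>z. z \<in> lifts \<and> \<rho> z = value_at i"
  proof
    fix i assume "i \<in> indices"
    then have "value_at i \<in> carrier U" using value_at_indices by auto
    then show "\<exists>z. z \<in> lifts \<and> \<rho> z = value_at i" using ex_lift by blast
  qed
  from bchoice[OF this] obtain b where b: "\<forall>i\<in>indices. b i \<in> lifts \<and> \<rho> (b i) = value_at i" ..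
  define E where "E = linear_combination R F b"
  have bF: "b \<in> indices \<rightarrow> carrier F" using b lifts_closed by blast
  have E: "E \<in> mod_hom R F F" unfolding E_def by (rule linear_combination_hom[OF module_F bF])
  have E_basis: "E (basis_vector R i) = b i" if "i \<in> indices" for i
    unfolding E_def by (rule linear_combination_basis_vector[OF module_F bF that])
  have \<rho>E: "\<rho> (E x) = \<rho> x" if "x \<in> carrier F" for x
  proof (rule mod_hom_free_module_eqI[OF module_U' mod_hom_comp[OF E \<rho>_hom] \<rho>_hom _ that])
    fix i assume i: "i \<in> indices"
    show "\<rho> (E (basis_vector R i)) = \<rho> (basis_vector R i)"
      using b i linear_combination_basis_vector[OF module_U' value_at_indices i]
      by (simp add: E_basis \<rho>_def)
  qed
  have E_lifts: "E x \<in> lifts" if "x \<in> carrier F" for x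
    using R.is_cring that
  proof (induction rule: free_module_induct)
    case zero
    have "E \<zero>\<^bsub>F\<^esub> = \<zero>\<^bsub>F\<^esub>" by (rule mod_hom_zero[OF module_F module_F E])
    moreover have "(\<lambda>_. \<zero>) = root \<zero>" by (auto simp: root_eq)
    then have "\<zero>\<^bsub>F\<^esub> \<in> lifts" using compatible_root[of \<zero> 1] compatible_subset_lifts by simp
    ultimately show ?case by simp
  next
    case (add a i c)
    have bi: "basis_vector R i \<in> carrier F" using add by simp
    have "E (a \<odot>\<^bsub>F\<^esub> basis_vector R i \<oplus>\<^bsub>F\<^esub> c) = a \<odot>\<^bsub>F\<^esub> b i \<oplus>\<^bsub>F\<^esub> E c"
      by (simp only: mod_hom_add[OF E F.smult_closed[OF add(1) bi] add(3)]
          mod_hom_smult[OF E add(1) bi] E_basis[OF add(2)])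
    moreover have "b i \<in> lifts" using b add(2) by blast
    ultimately show ?case using add lifts_add lifts_smult by (simp only:)
  qed
  have surj: "\<rho> ` carrier F = carrier U'"
  proof (intro equalityI subsetI)
    fix y assume "y \<in> carrier U'"
    then obtain z where "z \<in> lifts" "\<rho> z = y" using ex_lift[of y] by auto
    then show "y \<in> \<rho> ` carrier F" using lifts_closed by blast
  qed (use mod_hom_closed[OF \<rho>_hom] in blast)
  \<comment> \<open>A nonempty word is coded together with an enumeration of the generators at its
    ideal, the root by the empty list.\<close>
  define \<iota> :: "'a set \<times> 'a list \<Rightarrow> 'a list list"
    where "\<iota> = (\<lambda>(\<mm>, w). if w = [] then [] else [SOME l. set l = gens \<mm>, w])"
  have "inj_on \<iota> indices"
  proof (rule inj_onI)
    fix i j assume i: "i \<in> indices" and j: "j \<in> indices" and eq: "\<iota> i = \<iota> j"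
    obtain \<mm> w \<nn> v where ij: "i = (\<mm>, w)" "j = (\<nn>, v)" by (cases i; cases j)
    show "i = j"
    proof (cases "w = [] \<or> v = []")
      case True
      then show ?thesis using i j eq by (auto simp: ij \<iota>_def indices_def split: if_splits)
    next
      case False
      then have mn: "\<mm> \<in> \<Lambda>" "\<nn> \<in> \<Lambda>" using i j by (auto simp: ij indices_def)
      have gens_eq: "set (SOME l. set l = gens \<mm>) = gens \<mm>" if "\<mm> \<in> \<Lambda>" for \<mm>
        by (rule someI_ex[OF finite_list[OF finite_gens[OF that]]])
      have l: "(SOME l. set l = gens \<mm>) = (SOME l. set l = gens \<nn>)" and "w = v"
        using eq False by (simp_all add: ij \<iota>_def)
      have "gens \<mm> = gens \<nn>"
        by (rule trans[OF sym[OF gens_eq[OF mn(1)]] trans[OF arg_cong[OF l, of set] gens_eq[OF mn(2)]]])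
      then show ?thesis using inj_gens[OF mn] \<open>w = v\<close> by (simp add: ij)
    qed
  qed
  from ex_inj_free_module[OF this] obtain \<Phi> :: "('a set \<times> 'a list \<Rightarrow> 'a) \<Rightarrow> ('a \<times> 'b) list"
    where \<Phi>: "inj_on \<Phi> (carrier F)" by blast
  have "projective_module R (F\<lparr>carrier := {x \<in> carrier F. \<rho> x = \<zero>\<^bsub>U'\<^esub>}\<rparr>)"
  proof (rule projective_kernel[OF module_U' \<rho>_hom E \<rho>E D_hom inj_on_D])
    show "\<rho> (D c) = \<zero>\<^bsub>U'\<^esub>" if "c \<in> carrier Q" for c using \<rho>_D[OF that] by simp
    show "E x \<in> D ` carrier Q" if "x \<in> carrier F" "\<rho> x = \<zero>\<^bsub>U'\<^esub>" for x
      using lifts_kernel[OF E_lifts[OF that(1)]] \<rho>E[OF that(1)] that(2) by (simp add: relators_def)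
  qed
  then show ?thesis by (rule projective_dimension_le_one[OF module_U' \<rho>_hom surj \<Phi>])
qed

end

theorem theorem14:
  fixes R :: "('a, 'k) ring_scheme" and U :: "('b, 'l) ring_scheme" and u :: "'a \<Rightarrow> 'b"
  assumes "flat_epimorphism R U u"
    and "\<And>I. I \<in> annihilated_ideals R U u \<Longrightarrow> semilocal (R Quot I) \<and> krull_dimension_zero (R Quot I)"
  shows "projective_dimension R (restrict_scalars U u) \<le> 1"
proof -
  have "cring R" "cring U" "u \<in> ring_hom R U" using assms(1) by (auto simp: flat_epimorphism_def)
  then interpret flat_epi R U u
    by (intro flat_epi.intro ring_hom_cring.intro ring_hom_cring_axioms.intro flat_epi_axioms.intro assms(1))
  have quot: "ideal I R" "semilocal (R Quot I)" "krull_dimension_zero (R Quot I)" if "dense I" for I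
    using assms(2)[OF dense_imp_annihilated[OF that]] that by (auto simp: dense_ideal_def)
  interpret flat_epi_zero_dim R U u
  proof (intro flat_epi_zero_dim.intro flat_epi_zero_dim_axioms.intro)
    show "flat_epi R U u" ..
    show "finite {\<mm>. maximalideal \<mm> R \<and> I \<subseteq> \<mm>}" if "dense I" for I
      by (rule R.finite_maximalideals_above[OF quot(1,2)[OF that]])
    show "maximalideal \<pp> R" if "dense \<pp>" "primeideal \<pp> R" for \<pp>
      by (rule R.primeideal_imp_maximalideal[OF that(2) quot(3)[OF that(1)]])
  qed
  show ?thesis by (rule projective_dimension_le_one_U)
qed

end
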